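(* Let $X=X_1\times X_2\times\cdots\times X_r$ be a product of locally compact Hadamard spaces and let $\Gamma<\mathrm{Is}(X_1)\times\mathrm{Is}(X_2)\times\cdots\times\mathrm{Is}(X_r)$ be a group which acts properly discontinuously on $X$ and contains two independent regular axial isometries. Then the Furstenberg limit set $F_\Gamma$ is a boundary limit set for the action of $\Gamma$ on the Furstenberg boundary $\partial^F X$, i.e. the $\Gamma$-invariant subset $F_\Gamma\subset\partial^F X$ satisfies the following: (1) For all $\zeta\in\partial^F X$ and every open subset $U\subset\partial^F X$ with $U\cap F_\Gamma\neq\emptyset$ there exists $\gamma\in\Gamma$ such that $\gamma\zeta\in U$. (2) For all $\zeta,\eta\in\partial^F X$ there exists $\xi\in F_\Gamma$ such that for any neighborhood $U$ of $\xi$ in $\partial^F X$ there exists $\gamma\in\Gamma$ with $\{\gamma\zeta,\gamma\eta\}\subset U$. (3) For all $\zeta\in\partial^F X$ there exist a neighborhood $V$ of $\zeta$ in $\partial^F X$ and a point $\xi\in F_\Gamma$ such that for any neighborhood $U$ of $\xi$ in $\partial^F X$ there exists $\gamma\in\Gamma$ with $\gamma V\subset U$.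
   Context: A Hadamard space is a complete CAT(0) metric space. Let $(X_i,d_i)$, $i=1,\ldots,r$, be locally compact Hadamard spaces, and let $X=X_1\times\cdots\times X_r$ carry the product distance $d=\sqrt{d_1^2+\cdots+d_r^2}$. $\partial X_i$ and $\partial X$ denote the geometric boundaries (classes of asymptotic geodesic rays) with the cone topology. An isometry $h$ of a Hadamard space $Y$ is axial if there are $l(h)>0$ and a geodesic line $\sigma:\mathbb{R}\to Y$ (an axis) with $h(\sigma(t))=\sigma(t+l(h))$ for all $t$; set $h^+=\sigma(\infty)$, $h^-=\sigma(-\infty)$. It is rank one if it has an axis which does not bound a flat half-plane (a closed convex subset of $Y$ isometric to $[0,\infty)\times\mathbb{R}$ whose boundary line is the axis). Two rank one isometries $g,h$ of $Y$ are independent if $\{g^+,g^-\}\cap\{h^+,h^-\}=\emptyset$. An element $h=(h_1,\ldots,h_r)\in\mathrm{Is}(X_1)\times\cdots\times\mathrm{Is}(X_r)$ is regular axial if each $h_i$ is a rank one isometry of $X_i$. Two regular axial isometries $g,h$ are independent if $g_i,h_i$ are independent for all $i$. The Furstenberg boundary is $\partial^F X=\partial X_1\times\cdots\times\partial X_r$ with the product topology; $\mathrm{Is}(X_1)\times\cdots\times\mathrm{Is}(X_r)$ acts on it componentwise. Every geodesic ray in $X$ has the form $\sigma(t)=(\sigma_1(\theta_1 t),\ldots,\sigma_r(\theta_r t))$ with $\sigma_i$ geodesic rays in $X_i$, $\theta_i\ge 0$, $\sum\theta_i^2=1$; the vector $\theta$ is its slope (it depends only on the class of $\sigma$ in $\partial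 X$). The regular boundary $\partial X^{reg}$ is the set of boundary points whose slope has all coordinates positive, and $\pi^F:\partial X^{reg}\to\partial^F X$ maps the class of $\sigma$ to $(\sigma_1(\infty),\ldots,\sigma_r(\infty))$. The geometric limit set is $L_\Gamma=\overline{\Gamma\cdot x}\cap\partial X$ ($x\in X$ arbitrary) and the Furstenberg limit set is $F_\Gamma=\pi^F(L_\Gamma\cap\partial X^{reg})$. *)

theory Defs
  imports "HOL-Analysis.Analysis" "HOL-Algebra.Bij" "HOL-Algebra.Product_Groups"
begin

section \<open>Hadamard spaces\<close>

definition geodesic_segment :: "'a metric \<Rightarrow> (real \<Rightarrow> 'a) \<Rightarrow> 'a \<Rightarrow> 'a \<Rightarrow> bool" where
  "geodesic_segment m c x y \<longleftrightarrow>
     c 0 = x \<and> c (mdist m x y) = y \<and> c ` {0..mdist m x y} \<subseteq> mspace m \<and>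
     (\<forall>s\<in>{0..mdist m x y}. \<forall>t\<in>{0..mdist m x y}. mdist m (c s) (c t) = \<bar>s - t\<bar>)"

definition geodesic_space :: "'a metric \<Rightarrow> bool" where
  "geodesic_space m \<longleftrightarrow> (\<forall>x\<in>mspace m. \<forall>y\<in>mspace m. \<exists>c. geodesic_segment m c x y)"

text \<open>
  The comparison triangle \<open>p' q' r'\<close> lives in the Euclidean plane, here the type of complex numbers.
  The inequality is required for points on the sides \<open>[p,q]\<close> and \<open>[q,r]\<close>; since \<open>p, q, r\<close>
  are arbitrary this covers every pair of distinct sides of a geodesic triangle, and for two points
  on one side it holds with equality.  The third side plays no role and exists by geodesicity.
\<close>

definition CAT0_space :: "'a metric \<Rightarrow> bool" where
  "CAT0_space m \<longleftrightarrow> geodesic_space m \<and>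
     (\<forall>p\<in>mspace m. \<forall>q\<in>mspace m. \<forall>r\<in>mspace m. \<forall>\<alpha> \<beta>. \<forall>p' q' r' :: complex.
        geodesic_segment m \<alpha> p q \<and> geodesic_segment m \<beta> q r \<and>
        dist p' q' = mdist m p q \<and> dist q' r' = mdist m q r \<and> dist p' r' = mdist m p r \<longrightarrow>
        (\<forall>x'\<in>closed_segment p' q'. \<forall>y'\<in>closed_segment q' r'.
           mdist m (\<alpha> (dist p' x')) (\<beta> (dist q' y')) \<le> dist x' y'))"

definition Hadamard_space :: "'a metric \<Rightarrow> bool" where
  "Hadamard_space m \<longleftrightarrow> mcomplete_of m \<and> CAT0_space m"


section \<open>Geometric boundary and cone topology\<close>

text \<open>
  A ray is a total function on the reals of which only the values on \<open>{0..}\<close> matter; functions that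
  agree there are asymptotic, so they give the same boundary point.
\<close>

definition geodesic_ray :: "'a metric \<Rightarrow> (real \<Rightarrow> 'a) \<Rightarrow> bool" where
  "geodesic_ray m \<sigma> \<longleftrightarrow>
     \<sigma> ` {0..} \<subseteq> mspace m \<and> (\<forall>s\<ge>0. \<forall>t\<ge>0. mdist m (\<sigma> s) (\<sigma> t) = \<bar>s - t\<bar>)"

definition asymptotic :: "'a metric \<Rightarrow> ((real \<Rightarrow> 'a) \<times> (real \<Rightarrow> 'a)) set" where
  "asymptotic m = {(\<sigma>, \<tau>). geodesic_ray m \<sigma> \<and> geodesic_ray m \<tau> \<and>
                           (\<exists>C. \<forall>t\<ge>0. mdist m (\<sigma> t) (\<tau> t) \<le> C)}"

definition boundary :: "'a metric \<Rightarrow> (real \<Rightarrow> 'a) set set" where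
  "boundary m = {\<sigma>. geodesic_ray m \<sigma>} // asymptotic m"

lemma equiv_asymptotic: "equiv {\<sigma>. geodesic_ray m \<sigma>} (asymptotic m)"
proof (rule equivI)
  show "refl_on {\<sigma>. geodesic_ray m \<sigma>} (asymptotic m)"
    by (auto simp: refl_on_def asymptotic_def geodesic_ray_def intro: exI[of _ 0])
  show "asymptotic m \<subseteq> {\<sigma>. geodesic_ray m \<sigma>} \<times> {\<sigma>. geodesic_ray m \<sigma>}"
    by (auto simp: asymptotic_def)
  show "sym (asymptotic m)"
    by (auto simp: asymptotic_def intro!: symI) (metis mdist_commute)
  show "trans (asymptotic m)"
  proof (rule transI)
    fix \<rho> \<sigma> \<tau>
    assume "(\<rho>, \<sigma>) \<in> asymptotic m" "(\<sigma>, \<tau>) \<in> asymptotic m"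
    then obtain B C where rays: "geodesic_ray m \<rho>" "geodesic_ray m \<sigma>" "geodesic_ray m \<tau>"
      and B: "\<And>t. t \<ge> 0 \<Longrightarrow> mdist m (\<rho> t) (\<sigma> t) \<le> B"
      and C: "\<And>t. t \<ge> 0 \<Longrightarrow> mdist m (\<sigma> t) (\<tau> t) \<le> C"
      by (auto simp: asymptotic_def)
    have "mdist m (\<rho> t) (\<tau> t) \<le> B + C" if "t \<ge> 0" for t
    proof -
      have "\<rho> t \<in> mspace m" "\<sigma> t \<in> mspace m" "\<tau> t \<in> mspace m"
        using rays that by (auto simp: geodesic_ray_def)
      then have "mdist m (\<rho> t) (\<tau> t) \<le> mdist m (\<rho> t) (\<sigma> t) + mdist m (\<sigma> t) (\<tau> t)"
        by (rule mdist_triangle)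
      with B[OF that] C[OF that] show ?thesis by linarith
    qed
    with rays show "(\<rho>, \<tau>) \<in> asymptotic m"
      by (auto simp: asymptotic_def)
  qed
qed

text \<open>
  The compactification \<open>mspace m \<union> boundary m\<close> is a disjoint union, \<open>Inl\<close> marking the points of
  the space and \<open>Inr\<close> those of the boundary.  \<open>cone_nbhd m \<sigma> R \<epsilon>\<close> is the usual basic cone
  neighbourhood of the endpoint of \<open>\<sigma>\<close>: it consists of the points \<open>z\<close> such that the geodesic from
  \<open>\<sigma> 0\<close> to \<open>z\<close> is longer than \<open>R\<close> and at time \<open>R\<close> is \<open>\<epsilon>\<close>-close to \<open>\<sigma>\<close>.  All base points \<open>\<sigma> 0\<close> are
  allowed; in a Hadamard space the topology is the one generated from any single base point.
\<close>

definition cone_nbhd ::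
    "'a metric \<Rightarrow> (real \<Rightarrow> 'a) \<Rightarrow> real \<Rightarrow> real \<Rightarrow> ('a + (real \<Rightarrow> 'a) set) set" where
  "cone_nbhd m \<sigma> R \<epsilon> =
     Inl ` {z \<in> mspace m. R < mdist m (\<sigma> 0) z \<and>
              (\<exists>c. geodesic_segment m c (\<sigma> 0) z \<and> mdist m (c R) (\<sigma> R) < \<epsilon>)} \<union>
     Inr ` {\<eta> \<in> boundary m. \<exists>\<tau>\<in>\<eta>. \<tau> 0 = \<sigma> 0 \<and> mdist m (\<tau> R) (\<sigma> R) < \<epsilon>}"

definition cone_topology :: "'a metric \<Rightarrow> ('a + (real \<Rightarrow> 'a) set) topology" where
  "cone_topology m = topology_generated_by
     ({Inl ` W |W. openin (mtopology_of m) W} \<union>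
      {cone_nbhd m \<sigma> R \<epsilon> |\<sigma> R \<epsilon>. geodesic_ray m \<sigma> \<and> 0 < R \<and> 0 < \<epsilon>})"

definition boundary_topology :: "'a metric \<Rightarrow> (real \<Rightarrow> 'a) set topology" where
  "boundary_topology m = pullback_topology (boundary m) Inr (cone_topology m)"

definition limit_points :: "'a metric \<Rightarrow> 'a set \<Rightarrow> (real \<Rightarrow> 'a) set set" where
  "limit_points m S = {\<xi> \<in> boundary m. Inr \<xi> \<in> cone_topology m closure_of (Inl ` S)}"


section \<open>Isometries\<close>

definition isometry_group :: "'a metric \<Rightarrow> ('a \<Rightarrow> 'a) monoid" where
  "isometry_group m = (BijGroup (mspace m))
     \<lparr>carrier := {f \<in> Bij (mspace m).
        \<forall>x\<in>mspace m. \<forall>y\<in>mspace m. mdist m (f x) (f y) = mdist m x y}\<rparr>"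

text \<open>
  Maps that are independent of representatives are written as images of classes, closed up under
  \<open>asymptotic\<close>: here \<open>f\<close> sends the class of \<open>\<sigma>\<close> to the class of \<open>f \<circ> \<sigma>\<close>.
\<close>

definition boundary_map :: "'a metric \<Rightarrow> ('a \<Rightarrow> 'a) \<Rightarrow> (real \<Rightarrow> 'a) set \<Rightarrow> (real \<Rightarrow> 'a) set" where
  "boundary_map m f \<xi> = asymptotic m `` {f \<circ> \<sigma> |\<sigma>. \<sigma> \<in> \<xi>}"

definition geodesic_line :: "'a metric \<Rightarrow> (real \<Rightarrow> 'a) \<Rightarrow> bool" where
  "geodesic_line m \<sigma> \<longleftrightarrow> range \<sigma> \<subseteq> mspace m \<and> (\<forall>s t. mdist m (\<sigma> s) (\<sigma> t) = \<bar>s - t\<bar>)"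

definition is_axis :: "'a metric \<Rightarrow> ('a \<Rightarrow> 'a) \<Rightarrow> (real \<Rightarrow> 'a) \<Rightarrow> bool" where
  "is_axis m h \<sigma> \<longleftrightarrow> geodesic_line m \<sigma> \<and> (\<exists>l>0. \<forall>t. h (\<sigma> t) = \<sigma> (t + l))"

text \<open>
  The endpoints of the axes of \<open>h\<close>; all axes have the same endpoints, so each of these sets is a
  single asymptote class.
\<close>

definition attracting_point :: "'a metric \<Rightarrow> ('a \<Rightarrow> 'a) \<Rightarrow> (real \<Rightarrow> 'a) set" where
  "attracting_point m h = asymptotic m `` {\<sigma>. is_axis m h \<sigma>}"

definition repelling_point :: "'a metric \<Rightarrow> ('a \<Rightarrow> 'a) \<Rightarrow> (real \<Rightarrow> 'a) set" where
  "repelling_point m h = asymptotic m `` {\<lambda>t. \<sigma> (- t) |\<sigma>. is_axis m h \<sigma>}"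

definition geodesically_convex :: "'a metric \<Rightarrow> 'a set \<Rightarrow> bool" where
  "geodesically_convex m H \<longleftrightarrow>
     (\<forall>x\<in>H. \<forall>y\<in>H. \<forall>c. geodesic_segment m c x y \<longrightarrow> c ` {0..mdist m x y} \<subseteq> H)"

text \<open>The metric on \<^typ>\<open>real \<times> real\<close> is the Euclidean one.\<close>

definition bounds_flat_half_plane :: "'a metric \<Rightarrow> (real \<Rightarrow> 'a) \<Rightarrow> bool" where
  "bounds_flat_half_plane m \<sigma> \<longleftrightarrow>
     (\<exists>H. \<exists>\<phi> :: real \<times> real \<Rightarrow> 'a. closedin (mtopology_of m) H \<and> geodesically_convex m H \<and>
        bij_betw \<phi> ({0..} \<times> UNIV) H \<and>
        (\<forall>u \<in> {0..} \<times> UNIV. \<forall>v \<in> {0..} \<times> UNIV. mdist m (\<phi> u) (\<phi> v) = dist u v) \<and>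
        \<phi> ` ({0} \<times> UNIV) = range \<sigma>)"

definition rank_one :: "'a metric \<Rightarrow> ('a \<Rightarrow> 'a) \<Rightarrow> bool" where
  "rank_one m h \<longleftrightarrow> h \<in> carrier (isometry_group m) \<and>
     (\<exists>\<sigma>. is_axis m h \<sigma> \<and> \<not> bounds_flat_half_plane m \<sigma>)"

definition independent_isometries :: "'a metric \<Rightarrow> ('a \<Rightarrow> 'a) \<Rightarrow> ('a \<Rightarrow> 'a) \<Rightarrow> bool" where
  "independent_isometries m g h \<longleftrightarrow>
     {attracting_point m g, repelling_point m g} \<inter> {attracting_point m h, repelling_point m h} = {}"


section \<open>Products\<close>

text \<open>Points of the product of \<open>X 1, \<dots>, X r\<close> are extensional functions on \<open>{1..r}\<close>.\<close>

definition product_metric :: "nat \<Rightarrow> (nat \<Rightarrow> 'a metric) \<Rightarrow> (nat \<Rightarrow> 'a) metric" where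
  "product_metric r X =
     metric (\<Pi>\<^sub>E i\<in>{1..r}. mspace (X i), \<lambda>x y. sqrt (\<Sum>i=1..r. (mdist (X i) (x i) (y i))\<^sup>2))"

lemma Metric_space_product_metric:
  fixes r :: nat
  shows "Metric_space (\<Pi>\<^sub>E i\<in>{1..r}. mspace (X i))
     (\<lambda>x y. sqrt (\<Sum>i=1..r. (mdist (X i) (x i) (y i))\<^sup>2))"
proof
  fix x y z
  show "0 \<le> sqrt (\<Sum>i=1..r. (mdist (X i) (x i) (y i))\<^sup>2)"
    by (simp add: sum_nonneg)
  show "sqrt (\<Sum>i=1..r. (mdist (X i) (x i) (y i))\<^sup>2) = sqrt (\<Sum>i=1..r. (mdist (X i) (y i) (x i))\<^sup>2)"
    by (simp add: mdist_commute)
  assume x: "x \<in> (\<Pi>\<^sub>E i\<in>{1..r}. mspace (X i))" and y: "y \<in> (\<Pi>\<^sub>E i\<in>{1..r}. mspace (X i))"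
  then have mem: "x i \<in> mspace (X i)" "y i \<in> mspace (X i)" if "i \<in> {1..r}" for i
    using that by (auto simp: PiE_iff)
  have "sqrt (\<Sum>i=1..r. (mdist (X i) (x i) (y i))\<^sup>2) = 0 \<longleftrightarrow> (\<forall>i\<in>{1..r}. x i = y i)"
    unfolding real_sqrt_eq_0_iff by (subst sum_nonneg_eq_0_iff) (auto simp: mem)
  also have "\<dots> \<longleftrightarrow> x = y"
    using x y by (auto intro: PiE_ext)
  finally show "sqrt (\<Sum>i=1..r. (mdist (X i) (x i) (y i))\<^sup>2) = 0 \<longleftrightarrow> x = y" .
  assume z: "z \<in> (\<Pi>\<^sub>E i\<in>{1..r}. mspace (X i))"
  have "sqrt (\<Sum>i=1..r. (mdist (X i) (x i) (z i))\<^sup>2)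
        \<le> sqrt (\<Sum>i=1..r. (mdist (X i) (x i) (y i) + mdist (X i) (y i) (z i))\<^sup>2)"
    using mem z by (intro real_sqrt_le_mono sum_mono power_mono mdist_triangle) (auto simp: PiE_iff)
  also have "\<dots> \<le> sqrt (\<Sum>i=1..r. (mdist (X i) (x i) (y i))\<^sup>2) +
                  sqrt (\<Sum>i=1..r. (mdist (X i) (y i) (z i))\<^sup>2)"
    using L2_set_triangle_ineq by (simp add: L2_set_def)
  finally show "sqrt (\<Sum>i=1..r. (mdist (X i) (x i) (z i))\<^sup>2)
        \<le> sqrt (\<Sum>i=1..r. (mdist (X i) (x i) (y i))\<^sup>2) +
          sqrt (\<Sum>i=1..r. (mdist (X i) (y i) (z i))\<^sup>2)" .
qed

lemma mspace_product_metric [simp]: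
  "mspace (product_metric r X) = (\<Pi>\<^sub>E i\<in>{1..r}. mspace (X i))"
  unfolding product_metric_def by (rule Metric_space.mspace_metric[OF Metric_space_product_metric])

lemma mdist_product_metric [simp]:
  "mdist (product_metric r X) = (\<lambda>x y. sqrt (\<Sum>i=1..r. (mdist (X i) (x i) (y i))\<^sup>2))"
  unfolding product_metric_def by (rule Metric_space.mdist_metric[OF Metric_space_product_metric])

definition product_isometry_group :: "nat \<Rightarrow> (nat \<Rightarrow> 'a metric) \<Rightarrow> (nat \<Rightarrow> 'a \<Rightarrow> 'a) monoid" where
  "product_isometry_group r X = product_group {1..r} (\<lambda>i. isometry_group (X i))"

definition product_map :: "nat \<Rightarrow> (nat \<Rightarrow> 'a \<Rightarrow> 'a) \<Rightarrow> (nat \<Rightarrow> 'a) \<Rightarrow> (nat \<Rightarrow> 'a)" where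
  "product_map r \<gamma> x = (\<lambda>i\<in>{1..r}. \<gamma> i (x i))"

definition properly_discontinuous :: "nat \<Rightarrow> (nat \<Rightarrow> 'a metric) \<Rightarrow> (nat \<Rightarrow> 'a \<Rightarrow> 'a) set \<Rightarrow> bool" where
  "properly_discontinuous r X \<Gamma> \<longleftrightarrow>
     (\<forall>K. compactin (mtopology_of (product_metric r X)) K \<longrightarrow>
          finite {\<gamma> \<in> \<Gamma>. product_map r \<gamma> ` K \<inter> K \<noteq> {}})"

definition regular_axial :: "nat \<Rightarrow> (nat \<Rightarrow> 'a metric) \<Rightarrow> (nat \<Rightarrow> 'a \<Rightarrow> 'a) \<Rightarrow> bool" where
  "regular_axial r X h \<longleftrightarrow> h \<in> carrier (product_isometry_group r X) \<and>
     (\<forall>i\<in>{1..r}. rank_one (X i) (h i))"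

definition independent_regular_axial ::
    "nat \<Rightarrow> (nat \<Rightarrow> 'a metric) \<Rightarrow> (nat \<Rightarrow> 'a \<Rightarrow> 'a) \<Rightarrow> (nat \<Rightarrow> 'a \<Rightarrow> 'a) \<Rightarrow> bool" where
  "independent_regular_axial r X g h \<longleftrightarrow> regular_axial r X g \<and> regular_axial r X h \<and>
     (\<forall>i\<in>{1..r}. independent_isometries (X i) (g i) (h i))"

definition Furstenberg_boundary :: "nat \<Rightarrow> (nat \<Rightarrow> 'a metric) \<Rightarrow> (nat \<Rightarrow> (real \<Rightarrow> 'a) set) topology" where
  "Furstenberg_boundary r X = product_topology (\<lambda>i. boundary_topology (X i)) {1..r}"

definition Furstenberg_map ::
    "nat \<Rightarrow> (nat \<Rightarrow> 'a metric) \<Rightarrow> (nat \<Rightarrow> 'a \<Rightarrow> 'a) \<Rightarrow> (nat \<Rightarrow> (real \<Rightarrow> 'a) set) \<Rightarrow>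
      (nat \<Rightarrow> (real \<Rightarrow> 'a) set)" where
  "Furstenberg_map r X \<gamma> \<zeta> = (\<lambda>i\<in>{1..r}. boundary_map (X i) (\<gamma> i) (\<zeta> i))"

text \<open>
  \<open>\<sigma> t = (\<rho>\<^sub>1 (\<theta>\<^sub>1 t), \<dots>, \<rho>\<^sub>r (\<theta>\<^sub>r t))\<close>.  A component with \<open>\<theta>\<^sub>i = 0\<close> is constant, and nothing more is
  asked of \<open>\<rho>\<^sub>i\<close>, because a factor may fail to contain any ray.
\<close>

definition ray_decomposition ::
    "nat \<Rightarrow> (nat \<Rightarrow> 'a metric) \<Rightarrow> (real \<Rightarrow> nat \<Rightarrow> 'a) \<Rightarrow> (nat \<Rightarrow> real) \<Rightarrow> (nat \<Rightarrow> real \<Rightarrow> 'a) \<Rightarrow> bool" where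
  "ray_decomposition r X \<sigma> \<theta> \<rho> \<longleftrightarrow>
     geodesic_ray (product_metric r X) \<sigma> \<and>
     (\<forall>i\<in>{1..r}. 0 \<le> \<theta> i \<and> (0 < \<theta> i \<longrightarrow> geodesic_ray (X i) (\<rho> i))) \<and>
     (\<Sum>i=1..r. (\<theta> i)\<^sup>2) = 1 \<and>
     (\<forall>t\<ge>0. \<sigma> t = (\<lambda>i\<in>{1..r}. \<rho> i (\<theta> i * t)))"

definition has_slope ::
    "nat \<Rightarrow> (nat \<Rightarrow> 'a metric) \<Rightarrow> (real \<Rightarrow> nat \<Rightarrow> 'a) set \<Rightarrow> (nat \<Rightarrow> real) \<Rightarrow> bool" where
  "has_slope r X \<xi> \<theta> \<longleftrightarrow> (\<exists>\<sigma>\<in>\<xi>. \<exists>\<rho>. ray_decomposition r X \<sigma> \<theta> \<rho>)"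

definition regular_boundary :: "nat \<Rightarrow> (nat \<Rightarrow> 'a metric) \<Rightarrow> (real \<Rightarrow> nat \<Rightarrow> 'a) set set" where
  "regular_boundary r X =
     {\<xi> \<in> boundary (product_metric r X). \<exists>\<theta>. has_slope r X \<xi> \<theta> \<and> (\<forall>i\<in>{1..r}. 0 < \<theta> i)}"

definition Furstenberg_proj ::
    "nat \<Rightarrow> (nat \<Rightarrow> 'a metric) \<Rightarrow> (real \<Rightarrow> nat \<Rightarrow> 'a) set \<Rightarrow> (nat \<Rightarrow> (real \<Rightarrow> 'a) set)" where
  "Furstenberg_proj r X \<xi> =
     (\<lambda>i\<in>{1..r}. asymptotic (X i) `` {\<rho> i |\<sigma> \<theta> \<rho>. \<sigma> \<in> \<xi> \<and> ray_decomposition r X \<sigma> \<theta> \<rho>})"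

definition geometric_limit_set ::
    "nat \<Rightarrow> (nat \<Rightarrow> 'a metric) \<Rightarrow> (nat \<Rightarrow> 'a \<Rightarrow> 'a) set \<Rightarrow> (nat \<Rightarrow> 'a) \<Rightarrow> (real \<Rightarrow> nat \<Rightarrow> 'a) set set" where
  "geometric_limit_set r X \<Gamma> x = limit_points (product_metric r X) ((\<lambda>\<gamma>. product_map r \<gamma> x) ` \<Gamma>)"

definition Furstenberg_limit_set ::
    "nat \<Rightarrow> (nat \<Rightarrow> 'a metric) \<Rightarrow> (nat \<Rightarrow> 'a \<Rightarrow> 'a) set \<Rightarrow> (nat \<Rightarrow> 'a) \<Rightarrow> (nat \<Rightarrow> (real \<Rightarrow> 'a) set) set" where
  "Furstenberg_limit_set r X \<Gamma> x =
     Furstenberg_proj r X ` (geometric_limit_set r X \<Gamma> x \<inter> regular_boundary r X)"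


section \<open>Boundary limit sets\<close>

text \<open>Here \<open>U\<close> is a neighbourhood of \<open>\<xi>\<close> iff \<open>\<xi> \<in> T interior_of U\<close>; it need not be open.\<close>

definition boundary_limit_set :: "'g set \<Rightarrow> ('g \<Rightarrow> 'b \<Rightarrow> 'b) \<Rightarrow> 'b topology \<Rightarrow> 'b set \<Rightarrow> bool" where
  "boundary_limit_set G act T F \<longleftrightarrow>
     F \<subseteq> topspace T \<and> (\<forall>\<gamma>\<in>G. act \<gamma> ` F = F) \<and>
     (\<forall>\<zeta>\<in>topspace T. \<forall>U. openin T U \<and> U \<inter> F \<noteq> {} \<longrightarrow> (\<exists>\<gamma>\<in>G. act \<gamma> \<zeta> \<in> U)) \<and>
     (\<forall>\<zeta>\<in>topspace T. \<forall>\<eta>\<in>topspace T. \<exists>\<xi>\<in>F. \<forall>U. U \<subseteq> topspace T \<and> \<xi> \<in> T interior_of U \<longrightarrow>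
        (\<exists>\<gamma>\<in>G. {act \<gamma> \<zeta>, act \<gamma> \<eta>} \<subseteq> U)) \<and>
     (\<forall>\<zeta>\<in>topspace T. \<exists>V. V \<subseteq> topspace T \<and> \<zeta> \<in> T interior_of V \<and>
        (\<exists>\<xi>\<in>F. \<forall>U. U \<subseteq> topspace T \<and> \<xi> \<in> T interior_of U \<longrightarrow> (\<exists>\<gamma>\<in>G. act \<gamma> ` V \<subseteq> U)))"

end

theory Submission
  imports Defs "HOL-Real_Asymp.Real_Asymp"
begin

text \<open>
  Everything rests on the CN inequality of CAT(0) geometry, which passes to products.  Let \<open>\<sigma>\<close> be an
  axis of a rank one isometry.  The convex functions \<open>t \<mapsto> d z (\<sigma> t)\<close> cannot have nearly constant slopes,
  bounded away from \<open>\<plusminus>1\<close>, on arbitrarily long intervals: after translation along the axis a limit of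
  such points \<open>z\<close> would be a boundary point whose Busemann function is affine along \<open>\<sigma>\<close>, and the rays
  from \<open>\<sigma>\<close> to this point would sweep out a flat half-plane.  So the slope passes from near \<open>-1\<close> to
  near \<open>1\<close> within a bounded interval, uniformly in \<open>z\<close>.  This gives north-south dynamics of rank one
  isometries, and it shows that \<open>\<gamma>\<close> moves the attracting point near a limit of \<open>\<gamma> x\<close> unless the
  backward orbit \<open>\<gamma>\<^sup>-\<^sup>1 x\<close> is near the attracting point.  On the product, a power of the second
  isometry moves any given points off the repelling points of the first one in all factors at once, and
  then a power of the first one contracts to its attracting points.
\<close>

section \<open>The CN inequality\<close>

text \<open>Angles never appear. Their role is taken by slopes of the functions \<open>d z\<close>
  along \<open>\<sigma>\<close>: \<open>geo_CN\<close> is a law of cosines in which a difference of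
  two distances to a far point \<open>z\<close> stands for the cosine. A slope at most
  \<open>- (1 - \<delta>)\<close> over a length R from \<open>\<sigma> 0\<close> puts the geodesic
  to \<open>z\<close>, at time R, within \<open>R * sqrt (2 * \<delta>)\<close> of
  \<open>\<sigma>\<close>; conversely a geodesic that is at least 1 away from
  \<open>\<sigma>\<close> at time R has slope at least \<open>-1 + 1 / (2 * R^2)\<close>. The
  choices of \<open>\<delta>\<close> in the dynamical lemmas start from these estimates. The
  obstacle in the product is that one group element acts on all factors simultaneously, and no
  factor can be corrected alone. Statements true for all large powers combine over finitely many
  factors, which settles the second and third property. For the first property the group element is
  dictated by the limit point, and different factors may fail for it; since all positive powers of
  the second isometry move the attracting points of the first, a counting argument still finds one
  element that works everywhere.\<close>

lemma mdist_self [simp]: "x \<in> mspace m \<Longrightarrow> mdist m x x = 0"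
  by (simp add: mdist_zero)

text \<open>The Bruhat-Tits inequality for all weights, with one \<open>z\<close> serving every
  \<open>p\<close>. It is linear in squared distances and therefore sums over the factors, so that
  factors and product are instances of the same locale. Existence and uniqueness of geodesics and
  convexity of the metric are derived from it.\<close>

locale cat0 =
  fixes m :: "'a metric"
  assumes CN_ex: "\<And>x y \<kappa>. \<lbrakk>x \<in> mspace m; y \<in> mspace m; 0 \<le> \<kappa>; \<kappa> \<le> 1\<rbrakk> \<Longrightarrow>
    \<exists>z\<in>mspace m. \<forall>p\<in>mspace m. (mdist m p z)\<^sup>2 \<le>
      (1 - \<kappa>) * (mdist m p x)\<^sup>2 + \<kappa> * (mdist m p y)\<^sup>2 - \<kappa> * (1 - \<kappa>) * (mdist m x y)\<^sup>2"
begin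

abbreviation "M \<equiv> mspace m"
abbreviation "d \<equiv> mdist m"

text \<open>The point at fraction \<open>\<kappa>\<close> of the geodesic from \<open>x\<close> to
  \<open>y\<close>. Fractions, unlike arc lengths, are the same in all factors of a product.\<close>

definition cmb :: "'a \<Rightarrow> 'a \<Rightarrow> real \<Rightarrow> 'a" where
  "cmb x y \<kappa> = (SOME z. z \<in> M \<and>
     (\<forall>p\<in>M. (d p z)\<^sup>2 \<le> (1 - \<kappa>) * (d p x)\<^sup>2 + \<kappa> * (d p y)\<^sup>2 - \<kappa> * (1 - \<kappa>) * (d x y)\<^sup>2))"

lemma cmb_spec:
  assumes "x \<in> M" "y \<in> M" "0 \<le> \<kappa>" "\<kappa> \<le> 1"
  shows "cmb x y \<kappa> \<in> M \<and>
    (\<forall>p\<in>M. (d p (cmb x y \<kappa>))\<^sup>2 \<le> (1 - \<kappa>) * (d p x)\<^sup>2 + \<kappa> * (d p y)\<^sup>2 - \<kappa> * (1 - \<kappa>) * (d x y)\<^sup>2)"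
proof -
  have "\<exists>z. z \<in> M \<and>
     (\<forall>p\<in>M. (d p z)\<^sup>2 \<le> (1 - \<kappa>) * (d p x)\<^sup>2 + \<kappa> * (d p y)\<^sup>2 - \<kappa> * (1 - \<kappa>) * (d x y)\<^sup>2)"
    using CN_ex[OF assms] by blast
  then show ?thesis
    unfolding cmb_def by (rule someI_ex)
qed

lemma cmb_mem: "x \<in> M \<Longrightarrow> y \<in> M \<Longrightarrow> 0 \<le> \<kappa> \<Longrightarrow> \<kappa> \<le> 1 \<Longrightarrow> cmb x y \<kappa> \<in> M"
  using cmb_spec by blast

lemma CN:
  assumes "x \<in> M" "y \<in> M" "0 \<le> \<kappa>" "\<kappa> \<le> 1" "p \<in> M"
  shows "(d p (cmb x y \<kappa>))\<^sup>2 \<le> (1 - \<kappa>) * (d p x)\<^sup>2 + \<kappa> * (d p y)\<^sup>2 - \<kappa> * (1 - \<kappa>) * (d x y)\<^sup>2"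
  using cmb_spec[OF assms(1-4)] assms(5) by blast

text \<open>CN with \<open>p = x\<close> and with \<open>p = y\<close> gives two upper bounds; they
  add up to \<open>d x y\<close>, so the triangle inequality makes them equalities.\<close>

lemma dist_cmb:
  assumes "x \<in> M" "y \<in> M" "0 \<le> \<kappa>" "\<kappa> \<le> 1"
  shows "d x (cmb x y \<kappa>) = \<kappa> * d x y" "d (cmb x y \<kappa>) y = (1 - \<kappa>) * d x y"
proof -
  let ?z = "cmb x y \<kappa>"
  have z: "?z \<in> M" using cmb_mem[OF assms] .
  have "(d x ?z)\<^sup>2 \<le> (\<kappa> * d x y)\<^sup>2"
    using CN[OF assms assms(1)] assms by (simp add: power2_eq_square algebra_simps)
  then have 1: "d x ?z \<le> \<kappa> * d x y"
    by (rule power2_le_imp_le) (use assms in auto)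
  have "(d y ?z)\<^sup>2 \<le> ((1 - \<kappa>) * d x y)\<^sup>2"
    using CN[OF assms assms(2)] assms mdist_commute[of m y x]
    by (simp add: power2_eq_square algebra_simps)
  then have 2: "d y ?z \<le> (1 - \<kappa>) * d x y"
    by (rule power2_le_imp_le) (use assms in auto)
  have 3: "d x y \<le> d x ?z + d ?z y"
    using mdist_triangle[OF assms(1) z assms(2)] .
  have 4: "(1 - \<kappa>) * d x y = d x y - \<kappa> * d x y" by (simp add: algebra_simps)
  show "d x ?z = \<kappa> * d x y" "d ?z y = (1 - \<kappa>) * d x y"
    using 1 2 3 4 mdist_commute[of m y ?z] by linarith+
qed

text \<open>Inserted into CN at \<open>p\<close> itself, the two bounds make the right-hand side
  vanish.\<close>

lemma cmb_unique:
  assumes "x \<in> M" "y \<in> M" "0 \<le> \<kappa>" "\<kappa> \<le> 1" "p \<in> M"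
    "d x p \<le> \<kappa> * d x y" "d p y \<le> (1 - \<kappa>) * d x y"
  shows "p = cmb x y \<kappa>"
proof -
  have a: "(d p x)\<^sup>2 \<le> (\<kappa> * d x y)\<^sup>2"
    using assms(6) mdist_commute[of m p x] by (intro power_mono) auto
  have b: "(d p y)\<^sup>2 \<le> ((1 - \<kappa>) * d x y)\<^sup>2"
    using assms(7) by (intro power_mono) auto
  have "(d p (cmb x y \<kappa>))\<^sup>2 \<le> (1 - \<kappa>) * (d p x)\<^sup>2 + \<kappa> * (d p y)\<^sup>2 - \<kappa> * (1 - \<kappa>) * (d x y)\<^sup>2"
    using CN assms by blast
  also have "\<dots> \<le> (1 - \<kappa>) * (\<kappa> * d x y)\<^sup>2 + \<kappa> * ((1 - \<kappa>) * d x y)\<^sup>2 - \<kappa> * (1 - \<kappa>) * (d x y)\<^sup>2"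
    using mult_left_mono[OF a, of "1 - \<kappa>"] mult_left_mono[OF b, of \<kappa>] assms by linarith
  also have "\<dots> = 0" by (simp add: power2_eq_square algebra_simps)
  finally show ?thesis
    using assms cmb_mem by auto
qed

lemma cmb_0 [simp]: "x \<in> M \<Longrightarrow> y \<in> M \<Longrightarrow> cmb x y 0 = x"
  by (rule cmb_unique[symmetric]) auto

lemma cmb_1 [simp]: "x \<in> M \<Longrightarrow> y \<in> M \<Longrightarrow> cmb x y 1 = y"
  by (rule cmb_unique[symmetric]) auto

lemma cmb_swap:
  assumes "x \<in> M" "y \<in> M" "0 \<le> \<kappa>" "\<kappa> \<le> 1"
  shows "cmb x y \<kappa> = cmb y x (1 - \<kappa>)"
proof (rule cmb_unique)
  show "cmb x y \<kappa> \<in> M" using cmb_mem assms by blast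
  show "d y (cmb x y \<kappa>) \<le> (1 - \<kappa>) * d y x"
    using dist_cmb(2)[OF assms] by (simp only: mdist_commute[of m y])
  show "d (cmb x y \<kappa>) x \<le> (1 - (1 - \<kappa>)) * d y x"
    using dist_cmb(1)[OF assms] by (simp add: mdist_commute[of m _ x])
qed (use assms in auto)

lemma cmb_cmb:
  assumes "x \<in> M" "y \<in> M" "0 \<le> \<kappa>" "\<kappa> \<le> 1" "0 \<le> \<mu>" "\<mu> \<le> 1"
  shows "cmb x (cmb x y \<kappa>) \<mu> = cmb x y (\<kappa> * \<mu>)"
proof (rule cmb_unique)
  have z: "cmb x y \<kappa> \<in> M" and w: "cmb x (cmb x y \<kappa>) \<mu> \<in> M" using assms by (auto intro!: cmb_mem)
  show "cmb x (cmb x y \<kappa>) \<mu> \<in> M" by fact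
  show "d x (cmb x (cmb x y \<kappa>) \<mu>) \<le> \<kappa> * \<mu> * d x y"
    using assms z by (simp add: dist_cmb)
  have "d (cmb x (cmb x y \<kappa>) \<mu>) y \<le> d (cmb x (cmb x y \<kappa>) \<mu>) (cmb x y \<kappa>) + d (cmb x y \<kappa>) y"
    using mdist_triangle[OF w z assms(2)] .
  also have "\<dots> = (1 - \<kappa> * \<mu>) * d x y"
    using assms z by (simp add: dist_cmb algebra_simps)
  finally show "d (cmb x (cmb x y \<kappa>) \<mu>) y \<le> (1 - \<kappa> * \<mu>) * d x y" .
qed (use assms mult_le_one in auto)

lemma dist_cmb_cmb:
  assumes "x \<in> M" "y \<in> M" "0 \<le> \<kappa>" "\<kappa> \<le> 1" "0 \<le> \<mu>" "\<mu> \<le> 1"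
  shows "d (cmb x y \<kappa>) (cmb x y \<mu>) = \<bar>\<kappa> - \<mu>\<bar> * d x y"
proof -
  have *: "d (cmb x y \<kappa>) (cmb x y \<mu>) = (\<mu> - \<kappa>) * d x y"
    if "0 \<le> \<kappa>" "\<kappa> \<le> \<mu>" "\<mu> \<le> 1" for \<kappa> \<mu>
  proof (cases "\<mu> = 0")
    case False
    with that have [simp]: "0 < \<mu>" "\<kappa> \<le> 1" by auto
    with that have [simp]: "0 \<le> \<kappa> / \<mu>" "\<kappa> / \<mu> \<le> 1" by auto
    have "cmb x (cmb x y \<mu>) (\<kappa> / \<mu>) = cmb x y \<kappa>"
      using that assms by (subst cmb_cmb) auto
    then have "d (cmb x y \<kappa>) (cmb x y \<mu>) = (1 - \<kappa> / \<mu>) * d x (cmb x y \<mu>)"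
      using dist_cmb(2)[of x "cmb x y \<mu>" "\<kappa> / \<mu>"] assms that cmb_mem by auto
    then have "d (cmb x y \<kappa>) (cmb x y \<mu>) = ((1 - \<kappa> / \<mu>) * \<mu>) * d x y"
      using assms that by (simp add: dist_cmb)
    also have "(1 - \<kappa> / \<mu>) * \<mu> = \<mu> - \<kappa>"
      using False by (simp add: left_diff_distrib)
    finally show ?thesis .
  next
    case True
    with that have "\<kappa> = 0" by linarith
    with True show ?thesis using assms by simp
  qed
  show ?thesis
  proof (cases "\<kappa> \<le> \<mu>")
    case True
    then show ?thesis using *[of \<kappa> \<mu>] assms by auto
  next
    case False
    then show ?thesis using *[of \<mu> \<kappa>] assms mdist_commute[of m "cmb x y \<kappa>"] by auto
  qed
qed

text \<open>CN is applied twice, to \<open>?z\<close> seen from \<open>?y\<close> and to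
  \<open>?y\<close> seen from \<open>z\<close>; the squares of \<open>d x y\<close> and
  \<open>d x z\<close> cancel.\<close>

lemma cmb_contract:
  assumes "x \<in> M" "y \<in> M" "z \<in> M" "0 \<le> \<kappa>" "\<kappa> \<le> 1"
  shows "d (cmb x y \<kappa>) (cmb x z \<kappa>) \<le> \<kappa> * d y z"
proof -
  let ?y = "cmb x y \<kappa>" and ?z = "cmb x z \<kappa>"
  have M: "?y \<in> M" "?z \<in> M" using assms by (auto intro!: cmb_mem)
  have 1: "(d ?y ?z)\<^sup>2 \<le> (1 - \<kappa>) * (d ?y x)\<^sup>2 + \<kappa> * (d ?y z)\<^sup>2 - \<kappa> * (1 - \<kappa>) * (d x z)\<^sup>2"
    using CN[of x z \<kappa> ?y] assms M by auto
  have "(d z ?y)\<^sup>2 \<le> (1 - \<kappa>) * (d z x)\<^sup>2 + \<kappa> * (d z y)\<^sup>2 - \<kappa> * (1 - \<kappa>) * (d x y)\<^sup>2"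
    using CN[of x y \<kappa> z] assms by auto
  then have 2: "(d ?y z)\<^sup>2 \<le> (1 - \<kappa>) * (d x z)\<^sup>2 + \<kappa> * (d y z)\<^sup>2 - \<kappa> * (1 - \<kappa>) * (d x y)\<^sup>2"
    by (simp add: mdist_commute)
  have 3: "d ?y x = \<kappa> * d x y"
    using dist_cmb(1)[of x y \<kappa>] assms mdist_commute[of m] by metis
  have "(d ?y ?z)\<^sup>2 \<le> (1 - \<kappa>) * (\<kappa> * d x y)\<^sup>2
      + \<kappa> * ((1 - \<kappa>) * (d x z)\<^sup>2 + \<kappa> * (d y z)\<^sup>2 - \<kappa> * (1 - \<kappa>) * (d x y)\<^sup>2) - \<kappa> * (1 - \<kappa>) * (d x z)\<^sup>2"
    using 1 mult_left_mono[OF 2, of \<kappa>] assms unfolding 3 by linarith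
  also have "\<dots> = (\<kappa> * d y z)\<^sup>2" by (simp add: power2_eq_square algebra_simps)
  finally show ?thesis
    by (rule power2_le_imp_le) (use assms in auto)
qed

text \<open>The quadrangle is cut by the diagonal from \<open>x\<close> to \<open>y'\<close>, and
  each triangle contracts towards one of its vertices.\<close>

lemma cmb_convex:
  assumes "x \<in> M" "y \<in> M" "x' \<in> M" "y' \<in> M" "0 \<le> \<kappa>" "\<kappa> \<le> 1"
  shows "d (cmb x y \<kappa>) (cmb x' y' \<kappa>) \<le> (1 - \<kappa>) * d x x' + \<kappa> * d y y'"
proof -
  have "d (cmb x y \<kappa>) (cmb x' y' \<kappa>) \<le> d (cmb x y \<kappa>) (cmb x y' \<kappa>) + d (cmb x y' \<kappa>) (cmb x' y' \<kappa>)"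
    using assms by (intro mdist_triangle cmb_mem) auto
  moreover have "d (cmb x y \<kappa>) (cmb x y' \<kappa>) \<le> \<kappa> * d y y'"
    using assms by (intro cmb_contract) auto
  moreover have "d (cmb x y' \<kappa>) (cmb x' y' \<kappa>) \<le> (1 - \<kappa>) * d x x'"
    using assms cmb_swap[of x y' \<kappa>] cmb_swap[of x' y' \<kappa>] cmb_contract[of y' x x' "1 - \<kappa>"] by auto
  ultimately show ?thesis by linarith
qed

section \<open>Geodesics parametrized by arc length\<close>

definition geo :: "'a \<Rightarrow> 'a \<Rightarrow> real \<Rightarrow> 'a" where
  "geo x y t = cmb x y (t / d x y)"

lemma frac_bounds: "0 \<le> t \<Longrightarrow> t \<le> d x y \<Longrightarrow> 0 \<le> t / d x y \<and> t / d x y \<le> 1 \<and> t / d x y * d x y = t"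
  by (cases "d x y = 0") (auto simp: divide_simps)

lemma geo_mem: "x \<in> M \<Longrightarrow> y \<in> M \<Longrightarrow> 0 \<le> t \<Longrightarrow> t \<le> d x y \<Longrightarrow> geo x y t \<in> M"
  unfolding geo_def using frac_bounds cmb_mem by blast

lemma geo_0 [simp]: "x \<in> M \<Longrightarrow> y \<in> M \<Longrightarrow> geo x y 0 = x"
  by (simp add: geo_def)

lemma dist_geo:
  assumes "x \<in> M" "y \<in> M" "0 \<le> t" "t \<le> d x y"
  shows "d x (geo x y t) = t" "d (geo x y t) y = d x y - t"
  using dist_cmb[OF assms(1,2), of "t / d x y"] frac_bounds[OF assms(3,4)]
  by (auto simp: geo_def algebra_simps)

lemma geo_unique:
  assumes "x \<in> M" "y \<in> M" "0 \<le> t" "t \<le> d x y" "p \<in> M" "d x p = t" "d p y = d x y - t"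
  shows "p = geo x y t"
  unfolding geo_def
proof (rule cmb_unique)
  note f = frac_bounds[OF assms(3,4)]
  show "d x p \<le> t / d x y * d x y" "d p y \<le> (1 - t / d x y) * d x y"
    using f assms by (auto simp: algebra_simps)
qed (use assms frac_bounds[OF assms(3,4)] in auto)

lemma dist_geo_geo:
  assumes "x \<in> M" "y \<in> M" "0 \<le> s" "s \<le> d x y" "0 \<le> t" "t \<le> d x y"
  shows "d (geo x y s) (geo x y t) = \<bar>s - t\<bar>"
proof -
  have "\<bar>s / d x y - t / d x y\<bar> * d x y = \<bar>(s / d x y - t / d x y) * d x y\<bar>"
    by (simp add: abs_mult)
  also have "\<dots> = \<bar>s - t\<bar>"
    using frac_bounds[OF assms(3,4)] frac_bounds[OF assms(5,6)] by (simp add: algebra_simps)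
  finally show ?thesis
    unfolding geo_def
    using dist_cmb_cmb[OF assms(1,2)] frac_bounds[OF assms(3,4)] frac_bounds[OF assms(5,6)] by simp
qed

lemma geo_geo:
  assumes "x \<in> M" "y \<in> M" "0 \<le> s" "s \<le> t" "t \<le> d x y"
  shows "geo x (geo x y t) s = geo x y s"
proof (rule geo_unique[symmetric])
  show "geo x y s \<in> M" "geo x y t \<in> M" using assms by (auto intro!: geo_mem)
  show "d x (geo x y s) = s" using assms by (simp add: dist_geo)
  show "d (geo x y s) (geo x y t) = d x (geo x y t) - s"
    using assms by (simp add: dist_geo dist_geo_geo)
qed (use assms dist_geo in auto)

lemma geodesic_segment_geo:
  assumes "x \<in> M" "y \<in> M" shows "geodesic_segment m (geo x y) x y"
  unfolding geodesic_segment_def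
proof (intro conjI ballI)
  show "geo x y (d x y) = y"
    by (rule geo_unique[symmetric]) (use assms in auto)
qed (use assms dist_geo_geo geo_mem in auto)

lemma geodesic_segment_eq_geo:
  assumes "geodesic_segment m c x y" "x \<in> M" "y \<in> M" "0 \<le> t" "t \<le> d x y"
  shows "c t = geo x y t"
proof (rule geo_unique)
  have 1: "d (c a) (c b) = \<bar>a - b\<bar>" if "0 \<le> a" "a \<le> d x y" "0 \<le> b" "b \<le> d x y" for a b
    using assms(1) that unfolding geodesic_segment_def by auto
  have 2: "c 0 = x" "c (d x y) = y"
    using assms(1) unfolding geodesic_segment_def by auto
  show "d x (c t) = t" using 1[of 0 t] 2 assms by auto
  show "d (c t) y = d x y - t" using 1[of t "d x y"] 2 assms by auto
  show "c t \<in> M" using assms unfolding geodesic_segment_def by auto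
qed (use assms in auto)

lemma geo_contract:
  assumes "o' \<in> M" "z \<in> M" "w \<in> M" "0 \<le> s" "s \<le> r" "0 < r" "r \<le> d o' z" "r \<le> d o' w"
  shows "d (geo o' z s) (geo o' w s) \<le> s / r * d (geo o' z r) (geo o' w r)"
proof -
  have *: "geo o' u s = cmb o' (geo o' u r) (s / r)" if "u \<in> M" "r \<le> d o' u" for u
  proof -
    have "geo o' u s = geo o' (geo o' u r) s"
      using that assms by (simp add: geo_geo)
    then show ?thesis
      using that assms by (simp add: geo_def[of o' "geo o' u r"] dist_geo)
  qed
  show ?thesis
    unfolding *[OF assms(2,7)] *[OF assms(3,8)]
    using assms by (intro cmb_contract geo_mem) auto
qed

text \<open>The factor 2 pays for cutting the longer geodesic down to the length of the shorter one,
  which moves its end by at most \<open>d z w\<close>.\<close>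

lemma geo_lipschitz:
  assumes "o' \<in> M" "z \<in> M" "w \<in> M" "0 \<le> r" "r \<le> d o' z" "r \<le> d o' w"
  shows "d (geo o' z r) (geo o' w r) \<le> 2 * d z w"
proof -
  have *: "d (geo o' z r) (geo o' w r) \<le> 2 * d z w"
    if "z \<in> M" "w \<in> M" "r \<le> d o' z" "d o' z \<le> d o' w" for z w
  proof (cases "d o' z = 0")
    case True
    with that assms have "r = 0" by simp
    then show ?thesis using that assms by simp
  next
    case False
    define a where "a = d o' z"
    have a: "0 < a" "r \<le> a" using False that by (auto simp: a_def less_le)
    have "d z (geo o' w a) \<le> d z w + d w (geo o' w a)"
      using that assms a by (intro mdist_triangle geo_mem) (auto simp: a_def)
    also have "d w (geo o' w a) = d o' w - a"
      using dist_geo(2)[of o' w a] that assms a by (simp add: a_def mdist_commute)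
    also have "d o' w \<le> d o' z + d z w"
      using that assms by (intro mdist_triangle) auto
    finally have 1: "d z (geo o' w a) \<le> 2 * d z w" by (simp add: a_def)
    have "geo o' z a = z"
      by (rule geo_unique[symmetric]) (use that assms in \<open>auto simp: a_def\<close>)
    then have "d (geo o' z r) (geo o' w r) \<le> r / a * d z (geo o' w a)"
      using geo_contract[of o' z w r a] that assms a by (simp add: a_def)
    also have "\<dots> \<le> 1 * d z (geo o' w a)"
      using a assms by (intro mult_right_mono) auto
    finally show ?thesis using 1 by simp
  qed
  show ?thesis
    using *[of z w] *[of w z] assms mdist_commute[of m z w]
      mdist_commute[of m "geo o' z r" "geo o' w r"] by (cases "d o' z \<le> d o' w") auto
qed

text \<open>At the common fraction \<open>r / a\<close> the two geodesics to \<open>z\<close> are at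
  most \<open>(1 - r / a) * d p q\<close> apart. Passing from fraction \<open>r / a\<close> to
  \<open>r / b\<close> on the second one costs at most \<open>r / a * d p q\<close>, and the sum is
  exactly \<open>d p q\<close>.\<close>

lemma geo_base_change:
  assumes "p \<in> M" "q \<in> M" "z \<in> M" "0 \<le> r" "r \<le> d p z" "r \<le> d q z"
  shows "d (geo p z r) (geo q z r) \<le> d p q"
proof (cases "d p z = 0")
  case True
  with assms have "r = 0" by simp
  then show ?thesis using assms by simp
next
  case False
  define a b where "a = d p z" and "b = d q z"
  have a: "0 < a" "r \<le> a" "r \<le> b" using False assms by (auto simp: a_def b_def less_le)
  have ra: "0 \<le> r / a" "r / a \<le> 1" and rb: "0 \<le> r / b" "r / b \<le> 1" "r / b * b = r"
    using a assms frac_bounds[of r q z] by (auto simp: b_def)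
  have "d (geo p z r) (geo q z r) \<le> d (cmb p z (r / a)) (cmb q z (r / a)) + d (cmb q z (r / a)) (cmb q z (r / b))"
    unfolding geo_def a_def[symmetric] b_def[symmetric]
    using assms ra rb by (intro mdist_triangle cmb_mem) auto
  also have "d (cmb p z (r / a)) (cmb q z (r / a)) \<le> (1 - r / a) * d p q"
    using cmb_convex[of p z q z "r / a"] assms ra by simp
  also have "d (cmb q z (r / a)) (cmb q z (r / b)) = \<bar>(r / a - r / b) * b\<bar>"
    using dist_cmb_cmb[of q z "r / a" "r / b"] assms ra rb by (simp add: b_def abs_mult)
  also have "(r / a - r / b) * b = r / a * (b - a)"
    using a rb(3) by (simp add: left_diff_distrib right_diff_distrib)
  also have "\<bar>r / a * (b - a)\<bar> = r / a * \<bar>b - a\<bar>"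
    using ra(1) by (metis abs_mult abs_of_nonneg)
  finally have 1: "d (geo p z r) (geo q z r) \<le> (1 - r / a) * d p q + r / a * \<bar>b - a\<bar>"
    by simp
  have "\<bar>b - a\<bar> \<le> d p q"
    using mdist_triangle[of p m q z] mdist_triangle[of q m p z] assms mdist_commute[of m p q]
    by (simp add: a_def b_def)
  then have "r / a * \<bar>b - a\<bar> \<le> r / a * d p q"
    using ra(1) by (rule mult_left_mono)
  with 1 show ?thesis by (simp add: left_diff_distrib)
qed

text \<open>A law of cosines with \<open>d q z - d p z\<close> in the place of
  \<open>- d p q\<close> times the cosine of the angle at \<open>p\<close>; it turns distances to a
  far point into closeness of directions. The remainder left by CN, \<open>u / a\<close> times the
  difference of the squares of \<open>e\<close> and \<open>d p q\<close>, is nonpositive by the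
  triangle inequality.\<close>

lemma geo_CN:
  assumes "p \<in> M" "q \<in> M" "z \<in> M" "0 \<le> u" "u \<le> d p z"
  shows "(d (geo p z u) q)\<^sup>2 \<le> (d p q)\<^sup>2 + u\<^sup>2 + 2 * u * (d q z - d p z)"
proof (cases "d p z = 0")
  case True
  with assms have "u = 0" by simp
  then show ?thesis using assms by simp
next
  case False
  define a where "a = d p z"
  define e where "e = d q z - d p z"
  have a: "0 < a" "u \<le> a" using False assms by (auto simp: a_def less_le)
  have e: "\<bar>e\<bar> \<le> d p q"
    using mdist_triangle[of p m q z] mdist_triangle[of q m p z] assms mdist_commute[of m p q]
    by (simp add: e_def)
  then have e2: "e\<^sup>2 \<le> (d p q)\<^sup>2" by (metis abs_le_square_iff abs_of_nonneg mdist_nonneg)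
  have "(d q (geo p z u))\<^sup>2 \<le> (1 - u / a) * (d q p)\<^sup>2 + u / a * (d q z)\<^sup>2 - u / a * (1 - u / a) * a\<^sup>2"
    unfolding geo_def a_def[symmetric] using CN[of p z "u / a" q] assms a by (simp add: a_def)
  also have "d q z = a + e" by (simp add: e_def a_def)
  also have "(1 - u / a) * (d q p)\<^sup>2 + u / a * (a + e)\<^sup>2 - u / a * (1 - u / a) * a\<^sup>2
      = (d q p)\<^sup>2 + u\<^sup>2 + 2 * u * e + u / a * (e\<^sup>2 - (d q p)\<^sup>2)"
    using a by (simp add: field_simps power2_eq_square)
  also have "u / a * (e\<^sup>2 - (d q p)\<^sup>2) \<le> 0"
    using e2 assms a by (intro mult_nonneg_nonpos) (auto simp: mdist_commute)
  finally show ?thesis by (simp add: e_def mdist_commute)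
qed

end

section \<open>From comparison triangles to the CN inequality, and on to products\<close>

lemma comparison_triangle:
  fixes a b c :: real
  assumes "0 \<le> a" "0 \<le> b" "0 \<le> c" "a \<le> b + c" "b \<le> a + c" "c \<le> a + b"
  obtains p q r :: complex where "dist p q = a" "dist q r = b" "dist p r = c"
proof (cases "a = 0")
  case True
  with assms have "b = c" by linarith
  with True assms show ?thesis
    by (intro that[of 0 0 "of_real c"]) (auto simp: dist_norm)
next
  case False
  define u where "u = (a\<^sup>2 + c\<^sup>2 - b\<^sup>2) / (2 * a)"
  have a: "0 < a" using False assms by simp
  have 1: "2 * a * u = a\<^sup>2 + c\<^sup>2 - b\<^sup>2" using a by (simp add: u_def)
  have "(a - c)\<^sup>2 \<le> b\<^sup>2" using assms by (intro abs_le_square_iff[THEN iffD1]) auto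
  then have "2 * a * u \<le> 2 * a * c" unfolding 1 by (simp add: power2_eq_square algebra_simps)
  then have u1: "u \<le> c" using a by simp
  have "b\<^sup>2 \<le> (a + c)\<^sup>2" using assms by (intro power_mono) auto
  then have "2 * a * (- c) \<le> 2 * a * u" unfolding 1 by (simp add: power2_eq_square algebra_simps)
  then have u2: "- c \<le> u" using a by (simp only: mult_le_cancel_left_pos)
  have "u\<^sup>2 \<le> c\<^sup>2" using u1 u2 assms by (intro abs_le_square_iff[THEN iffD1]) auto
  then have v: "(sqrt (c\<^sup>2 - u\<^sup>2))\<^sup>2 = c\<^sup>2 - u\<^sup>2" by simp
  show ?thesis
  proof (rule that[of 0 "of_real a" "Complex u (sqrt (c\<^sup>2 - u\<^sup>2))"])
    show "dist 0 (complex_of_real a) = a" using a by (simp add: dist_norm)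
    show "dist 0 (Complex u (sqrt (c\<^sup>2 - u\<^sup>2))) = c"
      using v assms by (simp add: dist_norm cmod_def)
    have "(a - u)\<^sup>2 + (sqrt (c\<^sup>2 - u\<^sup>2))\<^sup>2 = b\<^sup>2"
      unfolding v using 1 by (simp add: power2_eq_square algebra_simps)
    then show "dist (complex_of_real a) (Complex u (sqrt (c\<^sup>2 - u\<^sup>2))) = b"
      using assms by (simp add: dist_norm cmod_def)
  qed
qed

lemma stewart_complex:
  fixes p q r :: complex
  shows "(dist (p + of_real t * (q - p)) r)\<^sup>2 =
    (1 - t) * (dist p r)\<^sup>2 + t * (dist q r)\<^sup>2 - t * (1 - t) * (dist p q)\<^sup>2"
  unfolding dist_norm cmod_power2 by (simp add: power2_eq_square algebra_simps)

text \<open>A point of the side \<open>[x, y]\<close> is compared with the opposite vertex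
  \<open>p\<close>; Stewart's identity evaluates the corresponding distance in the plane.\<close>

lemma CAT0_imp_cat0:
  assumes "CAT0_space m" shows "cat0 m"
proof
  fix x y \<kappa>
  assume x: "x \<in> mspace m" and y: "y \<in> mspace m" and k: "0 \<le> \<kappa>" "\<kappa> \<le> (1::real)"
  obtain \<alpha> where \<alpha>: "geodesic_segment m \<alpha> x y"
    using assms x y unfolding CAT0_space_def geodesic_space_def by blast
  let ?z = "\<alpha> (\<kappa> * mdist m x y)"
  have range: "\<kappa> * mdist m x y \<in> {0..mdist m x y}"
    using k by (auto simp: mult_left_le_one_le)
  then have z: "?z \<in> mspace m" using \<alpha> unfolding geodesic_segment_def by blast
  have "(mdist m p ?z)\<^sup>2 \<le> (1 - \<kappa>) * (mdist m p x)\<^sup>2 + \<kappa> * (mdist m p y)\<^sup>2 - \<kappa> * (1 - \<kappa>) * (mdist m x y)\<^sup>2"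
    if p: "p \<in> mspace m" for p
  proof -
    obtain \<beta> where \<beta>: "geodesic_segment m \<beta> y p"
      using assms y p unfolding CAT0_space_def geodesic_space_def by blast
    obtain x' y' p' :: complex where tri:
      "dist x' y' = mdist m x y" "dist y' p' = mdist m y p" "dist x' p' = mdist m x p"
      using mdist_triangle[OF x y p] mdist_triangle[OF x p y] mdist_triangle[OF y x p]
      by (rule_tac comparison_triangle[of "mdist m x y" "mdist m y p" "mdist m x p"])
         (auto simp: mdist_commute algebra_simps)
    let ?z' = "x' + of_real \<kappa> * (y' - x')"
    have z': "?z' \<in> closed_segment x' y'"
      unfolding closed_segment_def using k by (auto simp: scaleR_conv_of_real algebra_simps intro!: exI[of _ \<kappa>])
    have d: "dist x' ?z' = \<kappa> * mdist m x y"
      using k tri by (simp add: dist_norm norm_mult norm_minus_commute)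
    have "mdist m (\<alpha> (dist x' ?z')) (\<beta> (dist y' p')) \<le> dist ?z' p'"
      using assms x y p \<alpha> \<beta> tri z' unfolding CAT0_space_def by blast
    moreover have "\<beta> (dist y' p') = p"
      using \<beta> tri unfolding geodesic_segment_def by simp
    ultimately have "mdist m p ?z \<le> dist ?z' p'"
      by (simp add: d mdist_commute)
    then have "(mdist m p ?z)\<^sup>2 \<le> (dist ?z' p')\<^sup>2" by (intro power_mono) auto
    also have "\<dots> = (1 - \<kappa>) * (mdist m p x)\<^sup>2 + \<kappa> * (mdist m p y)\<^sup>2 - \<kappa> * (1 - \<kappa>) * (mdist m x y)\<^sup>2"
      unfolding stewart_complex tri by (simp add: mdist_commute)
    finally show ?thesis .
  qed
  with z show "\<exists>z\<in>mspace m. \<forall>p\<in>mspace m. (mdist m p z)\<^sup>2 \<le>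
      (1 - \<kappa>) * (mdist m p x)\<^sup>2 + \<kappa> * (mdist m p y)\<^sup>2 - \<kappa> * (1 - \<kappa>) * (mdist m x y)\<^sup>2"
    by blast
qed

lemma cat0_product_metric:
  assumes "\<And>i. i \<in> {1..r} \<Longrightarrow> cat0 (X i)"
  shows "cat0 (product_metric r X)"
proof
  fix x y :: "nat \<Rightarrow> 'a" and \<kappa> :: real
  assume x: "x \<in> mspace (product_metric r X)" and y: "y \<in> mspace (product_metric r X)"
    and k: "0 \<le> \<kappa>" "\<kappa> \<le> 1"
  define z where "z = (\<lambda>i\<in>{1..r}. cat0.cmb (X i) (x i) (y i) \<kappa>)"
  have mem: "x i \<in> mspace (X i)" "y i \<in> mspace (X i)" if "i \<in> {1..r}" for i
    using x y that by (auto simp: PiE_iff)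
  have z: "z \<in> mspace (product_metric r X)"
    using cat0.cmb_mem[OF assms] mem k by (auto simp: z_def)
  have "(mdist (product_metric r X) p z)\<^sup>2 \<le> (1 - \<kappa>) * (mdist (product_metric r X) p x)\<^sup>2
      + \<kappa> * (mdist (product_metric r X) p y)\<^sup>2 - \<kappa> * (1 - \<kappa>) * (mdist (product_metric r X) x y)\<^sup>2"
    if p: "p \<in> mspace (product_metric r X)" for p
  proof -
    have "(mdist (product_metric r X) p z)\<^sup>2 = (\<Sum>i=1..r. (mdist (X i) (p i) (z i))\<^sup>2)"
      by (simp add: sum_nonneg)
    also have "\<dots> \<le> (\<Sum>i=1..r. (1 - \<kappa>) * (mdist (X i) (p i) (x i))\<^sup>2
        + \<kappa> * (mdist (X i) (p i) (y i))\<^sup>2 - \<kappa> * (1 - \<kappa>) * (mdist (X i) (x i) (y i))\<^sup>2)"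
    proof (rule sum_mono)
      fix i assume i: "i \<in> {1..r}"
      then have "p i \<in> mspace (X i)" using p by (auto simp: PiE_iff)
      then show "(mdist (X i) (p i) (z i))\<^sup>2 \<le> (1 - \<kappa>) * (mdist (X i) (p i) (x i))\<^sup>2
        + \<kappa> * (mdist (X i) (p i) (y i))\<^sup>2 - \<kappa> * (1 - \<kappa>) * (mdist (X i) (x i) (y i))\<^sup>2"
        using cat0.CN[OF assms[OF i] mem[OF i] k] i by (simp add: z_def)
    qed
    also have "\<dots> = (1 - \<kappa>) * (mdist (product_metric r X) p x)\<^sup>2
      + \<kappa> * (mdist (product_metric r X) p y)\<^sup>2 - \<kappa> * (1 - \<kappa>) * (mdist (product_metric r X) x y)\<^sup>2"
      by (simp add: sum_nonneg sum.distrib sum_subtractf sum_distrib_left)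
    finally show ?thesis .
  qed
  with z show "\<exists>z\<in>mspace (product_metric r X). \<forall>p\<in>mspace (product_metric r X).
     (mdist (product_metric r X) p z)\<^sup>2 \<le> (1 - \<kappa>) * (mdist (product_metric r X) p x)\<^sup>2
      + \<kappa> * (mdist (product_metric r X) p y)\<^sup>2 - \<kappa> * (1 - \<kappa>) * (mdist (product_metric r X) x y)\<^sup>2"
    by blast
qed

section \<open>The Hopf--Rinow theorem\<close>

text \<open>The radii with compact balls form an interval starting at 0. If bounded, it would
  contain its supremum, because nets of slightly smaller balls and completeness suffice for
  compactness, but by local compactness it has no largest element.\<close>

lemma (in cat0) compact_mcball:
  assumes complete: "mcomplete_of m" and loc: "locally_compact_space (mtopology_of m)" and x: "x \<in> M"
  shows "compactin (mtopology_of m) (mcball_of m x r)"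
proof (rule ccontr)
  interpret Metric_space M d by simp
  have top: "mtopology_of m = mtopology" by (simp add: mtopology_of_def)
  have cb: "mcball_of m = mcball" by (simp add: mcball_of_def)
  have compl: "mcomplete" using complete by (simp add: mcomplete_of_def)
  \<comment> \<open>Points of a slightly larger ball are close to the smaller one: move back along
    the geodesic to \<open>x\<close>.\<close>
  have near: "\<exists>w\<in>M. d x w \<le> s \<and> d w z \<le> e" if "z \<in> M" "0 \<le> s" "d x z \<le> s + e" "0 \<le> e" for s e z
  proof (cases "d x z \<le> s")
    case True
    with that show ?thesis by (intro bexI[of _ z]) auto
  next
    case False
    with that x show ?thesis by (intro bexI[of _ "geo x z s"]) (auto simp: dist_geo geo_mem)
  qed
  define S where "S = {s. 0 \<le> s \<and> compactin mtopology (mcball x s)}"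
  assume "\<not> ?thesis"
  then have r: "\<not> compactin mtopology (mcball x r)" by (simp add: top cb)
  have mono: "compactin mtopology (mcball x t)" if "compactin mtopology (mcball x s)" "t \<le> s" for s t
    using that closed_compactin closedin_mcball mcball_subset_concentric by metis
  have lim: "compactin mtopology (mcball x s)" if s: "0 < s" and below: "\<And>t. 0 \<le> t \<Longrightarrow> t < s \<Longrightarrow> compactin mtopology (mcball x t)" for s
  proof -
    have "mtotally_bounded (mcball x s)"
      unfolding mtotally_bounded_def
    proof (intro allI impI)
      fix e :: real assume e: "0 < e"
      define t where "t = max 0 (s - e / 2)"
      have t: "0 \<le> t" "t < s" "s \<le> t + e / 2" using e s by (auto simp: t_def)
      have "mtotally_bounded (mcball x t)"
        using below[OF t(1,2)] by (rule compactin_imp_mtotally_bounded)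
      then obtain K where K: "finite K" "K \<subseteq> mcball x t" "mcball x t \<subseteq> (\<Union>k\<in>K. mball k (e / 2))"
        using e unfolding mtotally_bounded_def by (meson half_gt_zero)
      have "mcball x s \<subseteq> (\<Union>k\<in>K. mball k e)"
      proof
        fix z assume "z \<in> mcball x s"
        then have z: "z \<in> M" "d x z \<le> s" by auto
        then obtain w where w: "w \<in> M" "d x w \<le> t" "d w z \<le> e / 2"
          using near[of z t "e / 2"] t e by auto
        then obtain k where k: "k \<in> K" "w \<in> mball k (e / 2)" using K x by auto
        then have "d k z < e" using w z mdist_triangle[of k m w z] by auto
        with k z show "z \<in> (\<Union>k\<in>K. mball k e)" by auto
      qed
      moreover have "K \<subseteq> mcball x s" using K(2) t by auto
      ultimately show "\<exists>K. finite K \<and> K \<subseteq> mcball x s \<and> mcball x s \<subseteq> (\<Union>k\<in>K. mball k e)"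
        using K(1) by blast
    qed
    then show ?thesis
      using mtotally_bounded_eq_compact_closure_of[OF compl] by (simp add: closure_of_closedin)
  qed
  have ext: "\<exists>e>0. compactin mtopology (mcball x (s + e))" if s: "0 \<le> s" and comp: "compactin mtopology (mcball x s)" for s
  proof -
    have "\<exists>e>0. compactin mtopology (mcball y e)" if "y \<in> M" for y
    proof -
      obtain U K where U: "openin mtopology U" "compactin mtopology K" "y \<in> U" "U \<subseteq> K"
        using loc \<open>y \<in> M\<close> unfolding locally_compact_space_def top by auto
      then obtain e where "0 < e" "mcball y e \<subseteq> U" using openin_mtopology_mcball by blast
      then show ?thesis using U closed_compactin closedin_mcball by (meson order_trans)
    qed
    then obtain e where e: "\<And>y. y \<in> M \<Longrightarrow> 0 < e y" "\<And>y. y \<in> M \<Longrightarrow> compactin mtopology (mcball y (e y))"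
      by metis
    have op: "\<forall>U\<in>(\<lambda>y. mball y (e y / 2)) ` mcball x s. openin mtopology U"
      by simp
    have "mcball x s \<subseteq> \<Union>((\<lambda>y. mball y (e y / 2)) ` mcball x s)"
    proof
      fix y assume "y \<in> mcball x s"
      then show "y \<in> \<Union>((\<lambda>y. mball y (e y / 2)) ` mcball x s)"
        using e(1)[of y] by (intro UN_I[of y]) auto
    qed
    with op comp obtain \<F> where F: "finite \<F>" "\<F> \<subseteq> (\<lambda>y. mball y (e y / 2)) ` mcball x s" "mcball x s \<subseteq> \<Union>\<F>"
      unfolding compactin_def by meson
    obtain Y where Y: "finite Y" "Y \<subseteq> mcball x s" "mcball x s \<subseteq> (\<Union>y\<in>Y. mball y (e y / 2))"
      using finite_subset_image[OF F(1,2)] F(3) by blast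
    \<comment> \<open>The element 1 makes the minimum meaningful without discussing whether
      \<open>Y\<close> is empty.\<close>
    define \<delta> where "\<delta> = Min (insert 1 ((\<lambda>y. e y / 2) ` Y))"
    have YM: "Y \<subseteq> M" using Y(2) by auto
    have "0 < \<delta>"
      using Y(1) YM e(1) by (auto simp: \<delta>_def)
    moreover have "\<delta> \<le> e y / 2" if "y \<in> Y" for y
      unfolding \<delta>_def using Y(1) that by (intro Min_le) auto
    ultimately have \<delta>: "0 < \<delta>" "\<And>y. y \<in> Y \<Longrightarrow> \<delta> \<le> e y / 2"
      by blast+
    have "mcball x (s + \<delta>) \<subseteq> (\<Union>y\<in>Y. mcball y (e y))"
    proof
      fix z assume "z \<in> mcball x (s + \<delta>)"
      then have z: "z \<in> M" "d x z \<le> s + \<delta>" by auto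
      then obtain w where w: "w \<in> M" "d x w \<le> s" "d w z \<le> \<delta>" using near[of z s \<delta>] s \<delta> by auto
      then obtain y where y: "y \<in> Y" "w \<in> mball y (e y / 2)" using Y(3) x by auto
      then have "d y z \<le> e y" using mdist_triangle[of y m w z] w z \<delta>(2)[of y] by auto
      with y z YM show "z \<in> (\<Union>y\<in>Y. mcball y (e y))" by auto
    qed
    moreover have "compactin mtopology (\<Union>y\<in>Y. mcball y (e y))"
      using Y(1) YM e(2) by (intro compactin_Union) auto
    ultimately show ?thesis using \<delta>(1) closed_compactin closedin_mcball by blast
  qed
  have "z = x" if "z \<in> M" "d x z \<le> 0" for z
    using that x nonneg[of x z] zero[of x z] by (metis order_antisym)
  then have "mcball x 0 = {x}" using x by auto
  then have S0: "0 \<in> S" using x by (simp add: S_def)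
  have bdd: "s \<le> r" if "s \<in> S" for s
    using that r mono[of s r] by (force simp: S_def)
  then have bddS: "bdd_above S" by (auto simp: bdd_above_def)
  have below: "compactin mtopology (mcball x t)" if "t < Sup S" for t
    using that S0 less_cSup_iff[OF _ bddS, of t] mono by (force simp: S_def)
  have "0 \<le> Sup S" using S0 bddS by (rule cSup_upper)
  then have "compactin mtopology (mcball x (Sup S))"
    using lim below S0 by (cases "Sup S = 0") (auto simp: S_def)
  then obtain e where "0 < e" "compactin mtopology (mcball x (Sup S + e))"
    using ext \<open>0 \<le> Sup S\<close> by blast
  then have "Sup S + e \<in> S" using \<open>0 \<le> Sup S\<close> by (auto simp: S_def)
  then have "Sup S + e \<le> Sup S" using bddS by (rule cSup_upper)
  with \<open>0 < e\<close> show False by simp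
qed

locale proper_cat0 = cat0 m for m :: "'a metric" +
  assumes compact_mcball_of: "\<And>x r. x \<in> mspace m \<Longrightarrow> compactin (mtopology_of m) (mcball_of m x r)"

lemma proper_cat0I:
  assumes "Hadamard_space m" "locally_compact_space (mtopology_of m)"
  shows "proper_cat0 m"
proof -
  interpret cat0 m using assms CAT0_imp_cat0 by (auto simp: Hadamard_space_def)
  show ?thesis
    by unfold_locales (use assms compact_mcball in \<open>auto simp: Hadamard_space_def\<close>)
qed

text \<open>Tychonoff's theorem plays the role of a diagonal argument: \<open>\<Psi>\<close> is a cluster point of the
  sequence \<open>\<Phi>\<close> for pointwise convergence.\<close>

lemma (in proper_cat0) pointwise_cluster:
  fixes \<Phi> :: "nat \<Rightarrow> 'b \<Rightarrow> 'a"
  assumes c: "c \<in> M" and \<Phi>: "\<And>n j. \<Phi> n j \<in> M" "\<And>n j. d c (\<Phi> n j) \<le> R j"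
  obtains \<Psi> where "\<And>j. \<Psi> j \<in> M"
    "\<And>j p S. p \<in> M \<Longrightarrow> closed S \<Longrightarrow> \<forall>\<^sub>F n in sequentially. d p (\<Phi> n j) \<in> S \<Longrightarrow> d p (\<Psi> j) \<in> S"
    "\<And>j k S. closed S \<Longrightarrow> \<forall>\<^sub>F n in sequentially. d (\<Phi> n j) (\<Phi> n k) \<in> S \<Longrightarrow> d (\<Psi> j) (\<Psi> k) \<in> S"
proof -
  \<comment> \<open>The index type will be \<open>real\<close> or \<open>real \<times> real\<close>,
    hence compactness of an uncountable product; a diagonal subsequence would serve only countably
    many indices.\<close>
  define X where "X = product_topology (\<lambda>j. subtopology (mtopology_of m) (mcball_of m c (R j))) (UNIV :: 'b set)"
  define C where "C n = X closure_of {\<Phi> k |k. n \<le> k}" for n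
  have space: "topspace X = {\<Psi>. \<forall>j. \<Psi> j \<in> M \<and> d c (\<Psi> j) \<le> R j}"
    using c by (auto simp: X_def PiE_iff)
  have "compact_space X"
    using compact_mcball_of[OF c]
    by (auto simp: X_def compact_space_product_topology compact_space_subtopology)
  moreover have "\<And>n. closedin X (C n)" by (simp add: C_def)
  moreover have "C n \<noteq> {}" for n
  proof -
    have "\<Phi> n \<in> topspace X" using \<Phi> by (simp add: space)
    then show ?thesis
      unfolding C_def using closure_of_eq_empty_gen[of X] by (auto simp: disjnt_def)
  qed
  moreover have "decseq C"
    unfolding decseq_def C_def by (intro allI impI closure_of_mono) force
  ultimately have "(\<Inter>n. C n) \<noteq> {}" by (rule compact_space_imp_nest)
  then obtain \<Psi> where \<Psi>: "\<And>n. \<Psi> \<in> C n" by blast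
  have key: "f \<Psi> \<in> S"
    if f: "continuous_map X euclideanreal f" and S: "closed S" "\<forall>\<^sub>F n in sequentially. f (\<Phi> n) \<in> S" for f S
  proof -
    obtain N where N: "\<And>n. N \<le> n \<Longrightarrow> f (\<Phi> n) \<in> S" using S(2) by (auto simp: eventually_sequentially)
    have "C N \<subseteq> {\<Psi> \<in> topspace X. f \<Psi> \<in> S}"
      unfolding C_def
    proof (rule closure_of_minimal)
      show "closedin X {\<Psi> \<in> topspace X. f \<Psi> \<in> S}"
        using f S(1) by (intro closedin_continuous_map_preimage[OF f]) auto
      show "{\<Phi> k |k. N \<le> k} \<subseteq> {\<Psi> \<in> topspace X. f \<Psi> \<in> S}"
        using N \<Phi> by (auto simp: space)
    qed
    with \<Psi> show ?thesis by blast
  qed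
  have proj: "continuous_map X (mtopology_of m) (\<lambda>\<Psi>. \<Psi> j)" for j
    using continuous_map_product_projection[of j UNIV "\<lambda>j. subtopology (mtopology_of m) (mcball_of m c (R j))"]
    by (auto simp: X_def intro: continuous_map_into_fulltopology)
  show ?thesis
  proof
    show "\<Psi> j \<in> M" for j using \<Psi>[of 0] closure_of_subset_topspace[of X] unfolding C_def space by blast
    show "d p (\<Psi> j) \<in> S" if "p \<in> M" "closed S" "\<forall>\<^sub>F n in sequentially. d p (\<Phi> n j) \<in> S" for p j S
      using that by (intro key[of "\<lambda>\<Psi>. d p (\<Psi> j)"] continuous_map_mdist proj) auto
    show "d (\<Psi> j) (\<Psi> k) \<in> S" if "closed S" "\<forall>\<^sub>F n in sequentially. d (\<Phi> n j) (\<Phi> n k) \<in> S" for j k S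
      using that by (intro key[of "\<lambda>\<Psi>. d (\<Psi> j) (\<Psi> k)"] continuous_map_mdist proj) auto
  qed
qed

section \<open>Rays and the boundary\<close>

context cat0
begin

lemma ray_mem: "geodesic_ray m \<sigma> \<Longrightarrow> 0 \<le> t \<Longrightarrow> \<sigma> t \<in> M"
  by (auto simp: geodesic_ray_def)

lemma ray_dist: "geodesic_ray m \<sigma> \<Longrightarrow> 0 \<le> s \<Longrightarrow> 0 \<le> t \<Longrightarrow> d (\<sigma> s) (\<sigma> t) = \<bar>s - t\<bar>"
  by (auto simp: geodesic_ray_def)

lemma ray_geo:
  assumes "geodesic_ray m \<sigma>" "0 \<le> s" "s \<le> t"
  shows "geo (\<sigma> 0) (\<sigma> t) s = \<sigma> s"
  by (rule geo_unique[symmetric]) (use assms in \<open>auto simp: ray_mem ray_dist\<close>)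

lemma ray_cmb:
  assumes "geodesic_ray m \<sigma>" "0 \<le> s" "s \<le> t"
  shows "cmb (\<sigma> 0) (\<sigma> t) (s / t) = \<sigma> s"
  using ray_geo[OF assms] assms by (simp add: geo_def ray_dist)

lemma ray_contract:
  assumes "geodesic_ray m \<sigma>" "geodesic_ray m \<tau>" "\<sigma> 0 = \<tau> 0" "0 \<le> s" "s \<le> t" "0 < t"
  shows "d (\<sigma> s) (\<tau> s) \<le> s / t * d (\<sigma> t) (\<tau> t)"
proof -
  have "t \<le> d (\<sigma> 0) (\<sigma> t)" "t \<le> d (\<sigma> 0) (\<tau> t)"
    using assms(1,2,6) by (simp_all add: assms(3)[symmetric] ray_dist)
      (simp add: assms(3) ray_dist)
  then have "d (geo (\<sigma> 0) (\<sigma> t) s) (geo (\<sigma> 0) (\<tau> t) s)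
      \<le> s / t * d (geo (\<sigma> 0) (\<sigma> t) t) (geo (\<sigma> 0) (\<tau> t) t)"
    using assms by (intro geo_contract) (auto simp: ray_mem)
  then show ?thesis
    using ray_geo[OF assms(1), of s t] ray_geo[OF assms(1), of t t]
      ray_geo[OF assms(2), of s t] ray_geo[OF assms(2), of t t] assms by simp
qed

text \<open>The distance between the rays is convex in \<open>t\<close>, and a bounded convex
  function on a half-line cannot increase.\<close>

lemma asymptotic_dist:
  assumes "(\<sigma>, \<tau>) \<in> asymptotic m" "0 \<le> t"
  shows "d (\<sigma> t) (\<tau> t) \<le> d (\<sigma> 0) (\<tau> 0)"
proof -
  obtain C where r: "geodesic_ray m \<sigma>" "geodesic_ray m \<tau>" and C: "\<And>t. 0 \<le> t \<Longrightarrow> d (\<sigma> t) (\<tau> t) \<le> C"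
    using assms by (auto simp: asymptotic_def)
  show ?thesis
  proof (rule field_le_epsilon)
    fix e :: real assume e: "0 < e"
    \<comment> \<open>Convexity between 0 and \<open>T\<close> gives the far end weight
      \<open>t / T\<close>; for this \<open>T\<close> its share \<open>t / T * C\<close> is at most
      \<open>e\<close>.\<close>
    define T where "T = max (t + 1) (t * C / e)"
    have T: "t < T" "0 < T" "t * C / e \<le> T" using assms by (auto simp: T_def)
    have "d (\<sigma> t) (\<tau> t) \<le> (1 - t / T) * d (\<sigma> 0) (\<tau> 0) + t / T * d (\<sigma> T) (\<tau> T)"
      using cmb_convex[of "\<sigma> 0" "\<sigma> T" "\<tau> 0" "\<tau> T" "t / T"] r assms T
      by (simp add: ray_mem ray_cmb)
    also have "\<dots> \<le> 1 * d (\<sigma> 0) (\<tau> 0) + t / T * C"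
      using T assms C[of T] by (intro add_mono mult_right_mono mult_left_mono) auto
    also have "t / T * C \<le> e"
      using T e by (simp add: field_simps)
    finally show "d (\<sigma> t) (\<tau> t) \<le> d (\<sigma> 0) (\<tau> 0) + e" by simp
  qed
qed

lemma asymptotic_unique:
  assumes "(\<sigma>, \<tau>) \<in> asymptotic m" "\<sigma> 0 = \<tau> 0" "0 \<le> t"
  shows "\<sigma> t = \<tau> t"
proof -
  have r: "geodesic_ray m \<sigma>" "geodesic_ray m \<tau>" using assms by (auto simp: asymptotic_def)
  have "d (\<sigma> t) (\<tau> t) \<le> 0"
    using asymptotic_dist[OF assms(1,3)] assms(2) ray_mem[OF r(2), of 0] by simp
  then have "d (\<sigma> t) (\<tau> t) = 0" using mdist_nonneg[of m "\<sigma> t" "\<tau> t"] by linarith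
  then show ?thesis using ray_mem[OF r(1) assms(3)] ray_mem[OF r(2) assms(3)] by simp
qed

lemma asymptoticI:
  "geodesic_ray m \<sigma> \<Longrightarrow> geodesic_ray m \<tau> \<Longrightarrow> (\<And>t. 0 \<le> t \<Longrightarrow> d (\<sigma> t) (\<tau> t) \<le> C) \<Longrightarrow> (\<sigma>, \<tau>) \<in> asymptotic m"
  by (auto simp: asymptotic_def)

lemma asymptotic_refl: "geodesic_ray m \<sigma> \<Longrightarrow> (\<sigma>, \<sigma>) \<in> asymptotic m"
  using equiv_asymptotic[of m] by (auto simp: equiv_def refl_on_def)

lemma asymptotic_trans: "(\<rho>, \<sigma>) \<in> asymptotic m \<Longrightarrow> (\<sigma>, \<tau>) \<in> asymptotic m \<Longrightarrow> (\<rho>, \<tau>) \<in> asymptotic m"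
  using equiv_asymptotic[of m] by (auto simp: equiv_def elim: transE)

section \<open>Boundary points and neighbourhoods of ends\<close>

definition cls :: "(real \<Rightarrow> 'a) \<Rightarrow> (real \<Rightarrow> 'a) set" where
  "cls \<sigma> = asymptotic m `` {\<sigma>}"

lemma cls_boundary: "geodesic_ray m \<sigma> \<Longrightarrow> cls \<sigma> \<in> boundary m"
  by (auto simp: cls_def boundary_def quotient_def)

lemma mem_cls: "\<tau> \<in> cls \<sigma> \<longleftrightarrow> (\<sigma>, \<tau>) \<in> asymptotic m"
  by (simp add: cls_def)

lemma self_mem_cls: "geodesic_ray m \<sigma> \<Longrightarrow> \<sigma> \<in> cls \<sigma>"
  by (simp add: mem_cls asymptotic_refl)

lemma cls_eqI: "(\<sigma>, \<tau>) \<in> asymptotic m \<Longrightarrow> cls \<sigma> = cls \<tau>"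
  unfolding cls_def by (rule equiv_class_eq[OF equiv_asymptotic])

lemma boundary_mem:
  assumes "\<xi> \<in> boundary m" "\<sigma> \<in> \<xi>"
  shows "geodesic_ray m \<sigma>" "\<xi> = cls \<sigma>"
proof -
  obtain \<tau> where "\<xi> = cls \<tau>"
    using assms(1) by (auto simp: boundary_def quotient_def cls_def)
  then have "(\<tau>, \<sigma>) \<in> asymptotic m" using assms(2) by (simp add: mem_cls)
  then show "geodesic_ray m \<sigma>" "\<xi> = cls \<sigma>"
    using cls_eqI \<open>\<xi> = cls \<tau>\<close> by (auto simp: asymptotic_def)
qed

lemma boundary_cases:
  assumes "\<xi> \<in> boundary m" obtains \<sigma> where "geodesic_ray m \<sigma>" "\<xi> = cls \<sigma>" "\<sigma> \<in> \<xi>"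
proof -
  obtain \<sigma> where "geodesic_ray m \<sigma>" "\<xi> = asymptotic m `` {\<sigma>}"
    using assms unfolding boundary_def quotient_def by blast
  then show ?thesis using that self_mem_cls unfolding cls_def by blast
qed

lemma boundary_asymptotic:
  assumes "\<xi> \<in> boundary m" "\<sigma> \<in> \<xi>" "\<tau> \<in> \<xi>" shows "(\<sigma>, \<tau>) \<in> asymptotic m"
  using boundary_mem[OF assms(1,2)] assms(3) by (simp add: mem_cls)

text \<open>The distance between two points with the same parameter on different rays from one point
  grows at least linearly, so that a fixed tolerance \<open>1\<close> and a radius \<open>R\<close> tending to infinity give a
  neighbourhood basis.\<close>

definition end_nbhd :: "(real \<Rightarrow> 'a) \<Rightarrow> real \<Rightarrow> (real \<Rightarrow> 'a) set set" where
  "end_nbhd \<sigma> R = {\<eta> \<in> boundary m. \<exists>\<tau>\<in>\<eta>. \<tau> 0 = \<sigma> 0 \<and> d (\<tau> R) (\<sigma> R) < 1}"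

text \<open>That a class contains rays from every origin is proved later from compact balls, whereas
  limit sets are studied in the product, treated here as a \<open>cat0\<close> space only. Therefore
  it appears as a condition on \<open>\<eta>\<close>.\<close>

definition nbhd_within :: "(real \<Rightarrow> 'a) \<Rightarrow> real \<Rightarrow> ('a + (real \<Rightarrow> 'a) set) set \<Rightarrow> bool" where
  "nbhd_within \<sigma> R O' \<longleftrightarrow>
    (\<forall>z\<in>M. R < d (\<sigma> 0) z \<and> d (geo (\<sigma> 0) z R) (\<sigma> R) < 1 \<longrightarrow> Inl z \<in> O') \<and>
    (\<forall>\<eta>\<in>end_nbhd \<sigma> R. (\<forall>p\<in>M. \<exists>\<tau>\<in>\<eta>. \<tau> 0 = p) \<longrightarrow> Inr \<eta> \<in> O')"

text \<open>The topology is generated by cones from all origins. The work is to fit a cone from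
  \<open>\<sigma> 0\<close> into a given one from \<open>\<omega> 0\<close>: a change of origin
  moves points of equal parameter by at most the distance \<open>D\<close> of the origins, and
  contraction from a large radius down to \<open>r\<close> makes this error small.\<close>

lemma cone_nbhd_basis:
  assumes "openin (cone_topology m) O'" "Inr \<xi> \<in> O'" and \<xi>: "\<xi> \<in> boundary m" "\<sigma> \<in> \<xi>"
  shows "\<exists>R0>0. \<forall>R\<ge>R0. nbhd_within \<sigma> R O'"
proof -
  have "generate_topology_on ({Inl ` W |W. openin (mtopology_of m) W} \<union>
      {cone_nbhd m \<sigma> R \<epsilon> |\<sigma> R \<epsilon>. geodesic_ray m \<sigma> \<and> 0 < R \<and> 0 < \<epsilon>}) O'"
    using assms(1) unfolding cone_topology_def by (rule openin_topology_generated_by)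
  then show ?thesis using assms(2)
  proof induction
    case (Int a b)
    then obtain A B where AB: "0 < A" "\<And>R. A \<le> R \<Longrightarrow> nbhd_within \<sigma> R a"
      "0 < B" "\<And>R. B \<le> R \<Longrightarrow> nbhd_within \<sigma> R b" by auto
    have "nbhd_within \<sigma> R (a \<inter> b)" if "max A B \<le> R" for R
      using AB(2,4)[of R] that unfolding nbhd_within_def by simp
    then show ?case using AB(1) by (intro exI[of _ "max A B"]) auto
  next
    case (UN K)
    then obtain k where k: "k \<in> K" "Inr \<xi> \<in> k" by blast
    with UN.IH[of k] obtain A where "0 < A" "\<And>R. A \<le> R \<Longrightarrow> nbhd_within \<sigma> R k" by auto
    with k show ?case unfolding nbhd_within_def by (intro exI[of _ A]) blast
  next
    case (Basis s)
    then obtain \<omega> r \<epsilon> where s: "s = cone_nbhd m \<omega> r \<epsilon>" and \<omega>: "geodesic_ray m \<omega>" "0 < r" "0 < \<epsilon>"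
      by blast
    then obtain \<rho> where \<rho>: "\<rho> \<in> \<xi>" "\<rho> 0 = \<omega> 0" "d (\<rho> r) (\<omega> r) < \<epsilon>"
      using Basis(2) by (auto simp: cone_nbhd_def)
    have rays: "geodesic_ray m \<rho>" "geodesic_ray m \<sigma>" using boundary_mem[OF \<xi>(1)] \<rho> \<xi> by auto
    have as: "(\<sigma>, \<rho>) \<in> asymptotic m" using boundary_asymptotic \<xi> \<rho> by blast
    define D where "D = d (\<sigma> 0) (\<omega> 0)"
    define e where "e = \<epsilon> - d (\<rho> r) (\<omega> r)"
    have e: "0 < e" "0 \<le> D" using \<rho> by (auto simp: e_def D_def)
    \<comment> \<open>At parameter \<open>R - D\<close> the error is at most
      \<open>1 + 2 * D\<close>: 1 for the tolerance, \<open>D\<close> for the change of origin and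
      \<open>D\<close> between the rays \<open>\<sigma>\<close> and \<open>\<rho>\<close>. Scaled by
      \<open>r / (R - D)\<close> it drops below \<open>e\<close>.\<close>
    define R0 where "R0 = D + r + r * (1 + 2 * D) / e"
    have q: "0 \<le> r * (1 + 2 * D) / e" using \<omega> e by simp
    have Mr: "\<sigma> t \<in> M" "\<rho> t \<in> M" "\<omega> t \<in> M" if "0 \<le> t" for t
      using that rays \<omega> ray_mem by auto
    \<comment> \<open>\<open>a\<close> lies on the geodesic or ray from \<open>\<omega> 0\<close>, \<open>b\<close> on the one from \<open>\<sigma> 0\<close>, both at distance \<open>R - D\<close>.\<close>
    have key: "d a' (\<omega> r) < \<epsilon>"
      if "a \<in> M" "b \<in> M" "a' \<in> M" "R0 \<le> R" "d a b \<le> D" "d b (\<sigma> (R - D)) < 1" "d a' (\<rho> r) \<le> r / (R - D) * d a (\<rho> (R - D))"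
      for a b a' R
    proof -
      have R: "0 < R - D" "r * (1 + 2 * D) / e < R - D" "0 \<le> R - D"
        using that(4) \<omega> e q unfolding R0_def by linarith+
      have "d a (\<rho> (R - D)) \<le> d a b + d b (\<rho> (R - D))"
        using that R Mr by (intro mdist_triangle) auto
      also have "d b (\<rho> (R - D)) \<le> d b (\<sigma> (R - D)) + d (\<sigma> (R - D)) (\<rho> (R - D))"
        using that R Mr by (intro mdist_triangle) auto
      also have "d (\<sigma> (R - D)) (\<rho> (R - D)) \<le> D"
        using asymptotic_dist[OF as R(3)] \<rho>(2) by (simp add: D_def)
      finally have "d a (\<rho> (R - D)) \<le> 1 + 2 * D" using that by linarith
      then have "r / (R - D) * d a (\<rho> (R - D)) \<le> r / (R - D) * (1 + 2 * D)"
        using \<omega> R by (intro mult_left_mono) auto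
      also have "\<dots> < e" using R e by (simp add: field_simps)
      finally have "d a' (\<rho> r) < e" using that by linarith
      moreover have "d a' (\<omega> r) \<le> d a' (\<rho> r) + d (\<rho> r) (\<omega> r)"
        using that \<omega> Mr by (intro mdist_triangle) auto
      ultimately show ?thesis by (simp add: e_def)
    qed
    have "nbhd_within \<sigma> R s" if R: "R0 \<le> R" for R
      unfolding nbhd_within_def
    proof (intro conjI ballI impI)
      have R': "0 < R - D" "r \<le> R - D" "0 \<le> R - D" "R - D \<le> R" "0 < R"
        using R \<omega> e q unfolding R0_def by linarith+
      {
        fix z assume z: "z \<in> M" "R < d (\<sigma> 0) z \<and> d (geo (\<sigma> 0) z R) (\<sigma> R) < 1"
        have "d (\<sigma> 0) z \<le> D + d (\<omega> 0) z"
          unfolding D_def using z Mr by (intro mdist_triangle) auto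
        then have far: "R - D < d (\<omega> 0) z" using z by linarith
        have "d (geo (\<omega> 0) z r) (\<omega> r) < \<epsilon>"
        proof (rule key[of "geo (\<omega> 0) z (R - D)" "geo (\<sigma> 0) z (R - D)"])
          show "d (geo (\<omega> 0) z (R - D)) (geo (\<sigma> 0) z (R - D)) \<le> D"
          proof -
            have "R - D \<le> d (\<omega> 0) z" "R - D \<le> d (\<sigma> 0) z" using far z e by linarith+
            then have "d (geo (\<omega> 0) z (R - D)) (geo (\<sigma> 0) z (R - D)) \<le> d (\<omega> 0) (\<sigma> 0)"
              using Mr z R' by (intro geo_base_change) auto
            also have "\<dots> = D" by (simp add: D_def mdist_commute)
            finally show ?thesis .
          qed
          have "d (geo (\<sigma> 0) z (R - D)) (\<sigma> (R - D)) \<le> (R - D) / R * d (geo (\<sigma> 0) z R) (\<sigma> R)"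
            using geo_contract[of "\<sigma> 0" z "\<sigma> R" "R - D" R] z R' Mr rays
            by (simp add: ray_geo ray_dist)
          also have "\<dots> \<le> 1 * d (geo (\<sigma> 0) z R) (\<sigma> R)"
            using R' by (intro mult_right_mono) auto
          finally show "d (geo (\<sigma> 0) z (R - D)) (\<sigma> (R - D)) < 1" using z by simp
          have "geo (\<omega> 0) (\<rho> (R - D)) r = \<rho> r" "geo (\<omega> 0) (\<rho> (R - D)) (R - D) = \<rho> (R - D)"
            using ray_geo[OF rays(1), of _ "R - D"] R' \<omega> \<rho>(2) by auto
          then show "d (geo (\<omega> 0) z r) (\<rho> r) \<le> r / (R - D) * d (geo (\<omega> 0) z (R - D)) (\<rho> (R - D))"
            using geo_contract[of "\<omega> 0" z "\<rho> (R - D)" r "R - D"] z far R' Mr rays \<omega> \<rho>(2)[symmetric]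
            by (simp add: ray_dist)
          have "0 \<le> D" "r \<le> d (\<omega> 0) z" "R - D \<le> d (\<omega> 0) z" "R - D \<le> d (\<sigma> 0) z" using far z R' e by linarith+
          then show "geo (\<omega> 0) z (R - D) \<in> M" "geo (\<sigma> 0) z (R - D) \<in> M" "geo (\<omega> 0) z r \<in> M"
            using z(1) R'(3) \<omega>(2) Mr(1,3)[of 0] by (simp_all add: geo_mem)
        qed (rule R)
        moreover have "r < d (\<omega> 0) z" using far R' by linarith
        ultimately show "Inl z \<in> s"
          unfolding s cone_nbhd_def using z(1) Mr(3)[of 0] geodesic_segment_geo[of "\<omega> 0" z]
          by (intro UnI1 imageI CollectI conjI exI[of _ "geo (\<omega> 0) z"]) auto
      next
        fix \<eta> assume "\<eta> \<in> end_nbhd \<sigma> R" and all: "\<forall>p\<in>M. \<exists>\<tau>\<in>\<eta>. \<tau> 0 = p"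
        then obtain \<tau> where \<eta>: "\<eta> \<in> boundary m" and \<tau>: "\<tau> \<in> \<eta>" "\<tau> 0 = \<sigma> 0" "d (\<tau> R) (\<sigma> R) < 1"
          by (auto simp: end_nbhd_def)
        obtain \<tau>' where \<tau>': "\<tau>' \<in> \<eta>" "\<tau>' 0 = \<omega> 0" using all Mr[of 0] by auto
        have rays': "geodesic_ray m \<tau>" "geodesic_ray m \<tau>'" using boundary_mem[OF \<eta>] \<tau> \<tau>' by auto
        have "d (\<tau>' r) (\<omega> r) < \<epsilon>"
        proof (rule key[of "\<tau>' (R - D)" "\<tau> (R - D)"])
          show "d (\<tau>' (R - D)) (\<tau> (R - D)) \<le> D"
            using asymptotic_dist[OF boundary_asymptotic[OF \<eta> \<tau>'(1) \<tau>(1)] R'(3)] \<tau> \<tau>'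
            by (simp add: D_def mdist_commute)
          have "d (\<tau> (R - D)) (\<sigma> (R - D)) \<le> (R - D) / R * d (\<tau> R) (\<sigma> R)"
            using ray_contract[of \<tau> \<sigma> "R - D" R] rays rays' R' \<tau> by simp
          also have "\<dots> \<le> 1 * d (\<tau> R) (\<sigma> R)"
            using R' by (intro mult_right_mono) auto
          finally show "d (\<tau> (R - D)) (\<sigma> (R - D)) < 1" using \<tau> by simp
          show "d (\<tau>' r) (\<rho> r) \<le> r / (R - D) * d (\<tau>' (R - D)) (\<rho> (R - D))"
            using ray_contract[of \<tau>' \<rho> r "R - D"] rays rays' R' \<tau>' \<rho> \<omega> by simp
        qed (use R R' \<omega> ray_mem rays' in auto)
        then show "Inr \<eta> \<in> s"
          unfolding s cone_nbhd_def using \<eta> \<tau>'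
          by (intro UnI2 imageI CollectI conjI bexI[of _ \<tau>']) auto
      }
    qed
    moreover have "0 < R0" unfolding R0_def using q \<omega> e by linarith
    ultimately show ?case by blast
  qed simp
qed

lemma openin_cone_nbhd:
  "geodesic_ray m \<sigma> \<Longrightarrow> 0 < R \<Longrightarrow> 0 < \<epsilon> \<Longrightarrow> openin (cone_topology m) (cone_nbhd m \<sigma> R \<epsilon>)"
  unfolding cone_topology_def by (rule topology_generated_by_Basis) blast

lemma mem_own_cone_nbhd:
  assumes "\<xi> \<in> boundary m" "\<sigma> \<in> \<xi>" "0 < R" "0 < \<epsilon>"
  shows "Inr \<xi> \<in> cone_nbhd m \<sigma> R \<epsilon>"
  using assms boundary_mem[OF assms(1,2)] ray_mem[of \<sigma> R] by (auto simp: cone_nbhd_def intro!: bexI[of _ \<sigma>])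

lemma mem_topspace_cone:
  assumes "\<xi> \<in> boundary m" shows "Inr \<xi> \<in> topspace (cone_topology m)"
proof -
  obtain \<sigma> where "geodesic_ray m \<sigma>" "\<sigma> \<in> \<xi>" using boundary_cases[OF assms] by metis
  then show ?thesis
    using mem_own_cone_nbhd[OF assms, of \<sigma> 1 1] openin_cone_nbhd[of \<sigma> 1 1] openin_subset by fastforce
qed

lemma limit_points_iff:
  assumes "\<xi> \<in> boundary m" "\<sigma> \<in> \<xi>" "S \<subseteq> M"
  shows "\<xi> \<in> limit_points m S \<longleftrightarrow> (\<forall>R>0. \<exists>z\<in>S. R < d (\<sigma> 0) z \<and> d (geo (\<sigma> 0) z R) (\<sigma> R) < 1)"
proof
  have ray: "geodesic_ray m \<sigma>" and o: "\<sigma> 0 \<in> M" using boundary_mem[OF assms(1,2)] ray_mem by auto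
  show "\<forall>R>0. \<exists>z\<in>S. R < d (\<sigma> 0) z \<and> d (geo (\<sigma> 0) z R) (\<sigma> R) < 1" if L: "\<xi> \<in> limit_points m S"
  proof (intro allI impI)
    fix R :: real assume "0 < R"
    then have "Inr \<xi> \<in> cone_nbhd m \<sigma> R 1" "openin (cone_topology m) (cone_nbhd m \<sigma> R 1)"
      using mem_own_cone_nbhd openin_cone_nbhd ray assms by auto
    then obtain z where "z \<in> S" "Inl z \<in> cone_nbhd m \<sigma> R 1"
      using L unfolding limit_points_def in_closure_of by blast
    then obtain c where z: "z \<in> S" "z \<in> M" "R < d (\<sigma> 0) z" and c: "geodesic_segment m c (\<sigma> 0) z" "d (c R) (\<sigma> R) < 1"
      by (auto simp: cone_nbhd_def)
    moreover have "c R = geo (\<sigma> 0) z R"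
      using geodesic_segment_eq_geo[OF c(1) o z(2)] z \<open>0 < R\<close> by simp
    ultimately show "\<exists>z\<in>S. R < d (\<sigma> 0) z \<and> d (geo (\<sigma> 0) z R) (\<sigma> R) < 1" by auto
  qed
  show "\<xi> \<in> limit_points m S" if R: "\<forall>R>0. \<exists>z\<in>S. R < d (\<sigma> 0) z \<and> d (geo (\<sigma> 0) z R) (\<sigma> R) < 1"
    unfolding limit_points_def in_closure_of
  proof (intro CollectI conjI allI impI)
    fix T assume "Inr \<xi> \<in> T \<and> openin (cone_topology m) T"
    then obtain R0 where R0: "0 < R0" "nbhd_within \<sigma> R0 T"
      using cone_nbhd_basis[of T \<xi> \<sigma>] assms by auto
    obtain z where z: "z \<in> S" "R0 < d (\<sigma> 0) z" "d (geo (\<sigma> 0) z R0) (\<sigma> R0) < 1"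
      using R R0(1) by blast
    have "z \<in> M" using z(1) assms(3) by blast
    then have "Inl z \<in> T" using R0(2) z by (simp add: nbhd_within_def)
    with z(1) show "\<exists>y. y \<in> Inl ` S \<and> y \<in> T" by blast
  qed (use assms mem_topspace_cone in auto)
qed

lemma topspace_boundary [simp]: "topspace (boundary_topology m) = boundary m"
  using mem_topspace_cone by (auto simp: boundary_topology_def topspace_pullback_topology)

lemma openin_end_nbhd:
  assumes "geodesic_ray m \<sigma>" "0 < R" shows "openin (boundary_topology m) (end_nbhd \<sigma> R)"
proof -
  have "end_nbhd \<sigma> R = Inr -` cone_nbhd m \<sigma> R 1 \<inter> boundary m"
    by (auto simp: end_nbhd_def cone_nbhd_def image_iff)
  then show ?thesis
    unfolding boundary_topology_def openin_pullback_topology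
    using openin_cone_nbhd[OF assms, of 1] by auto
qed

lemma mem_own_end_nbhd: "\<xi> \<in> boundary m \<Longrightarrow> \<sigma> \<in> \<xi> \<Longrightarrow> 0 < R \<Longrightarrow> \<xi> \<in> end_nbhd \<sigma> R"
  using boundary_mem ray_mem[of \<sigma> R] by (auto simp: end_nbhd_def intro!: bexI[of _ \<sigma>])

end

section \<open>Rays from a prescribed origin; the boundary is Hausdorff\<close>

context proper_cat0
begin

text \<open>The ray is a limit of the geodesics from \<open>p\<close> to \<open>\<sigma> n\<close>;
  \<open>geo_base_change\<close> keeps them within \<open>d p (\<sigma> 0)\<close> of
  \<open>\<sigma>\<close>.\<close>

lemma asymptotic_ray_ex:
  assumes \<sigma>: "geodesic_ray m \<sigma>" and p: "p \<in> M"
  obtains \<tau> where "geodesic_ray m \<tau>" "\<tau> 0 = p" "(\<sigma>, \<tau>) \<in> asymptotic m"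
proof -
  \<comment> \<open>The default \<open>p\<close> keeps the sequence in a ball depending on
    \<open>t\<close> only; for fixed \<open>t \<ge> 0\<close> it occurs for finitely many
    \<open>n\<close>.\<close>
  define \<Phi> where "\<Phi> n t = (if 0 \<le> t \<and> t \<le> d p (\<sigma> (real n)) then geo p (\<sigma> (real n)) t else p)" for n t
  have M: "\<sigma> t \<in> M" if "0 \<le> t" for t using \<sigma> that ray_mem by blast
  obtain \<Psi> where \<Psi>: "\<And>t. \<Psi> t \<in> M"
    "\<And>j p S. p \<in> M \<Longrightarrow> closed S \<Longrightarrow> \<forall>\<^sub>F n in sequentially. d p (\<Phi> n j) \<in> S \<Longrightarrow> d p (\<Psi> j) \<in> S"
    "\<And>j k S. closed S \<Longrightarrow> \<forall>\<^sub>F n in sequentially. d (\<Phi> n j) (\<Phi> n k) \<in> S \<Longrightarrow> d (\<Psi> j) (\<Psi> k) \<in> S"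
  proof (rule pointwise_cluster[of p \<Phi> "\<lambda>t. \<bar>t\<bar>"])
    show "\<Phi> n t \<in> M" "d p (\<Phi> n t) \<le> \<bar>t\<bar>" for n t
      using p M by (auto simp: \<Phi>_def geo_mem dist_geo)
  qed (use p in auto)
  have ev: "\<forall>\<^sub>F n in sequentially. t \<le> d p (\<sigma> (real n)) \<and> t \<le> real n" for t
  proof -
    have "\<forall>\<^sub>F n in sequentially. t + d p (\<sigma> 0) \<le> real n"
      using filterlim_real_sequentially by (auto simp: filterlim_at_top)
    then show ?thesis
    proof eventually_elim
      case (elim n)
      have "real n \<le> d (\<sigma> 0) p + d p (\<sigma> (real n))"
        using mdist_triangle[of "\<sigma> 0" m p "\<sigma> (real n)"] p M \<sigma> by (simp add: ray_dist)
      with elim show ?case using mdist_nonneg[of m p "\<sigma> 0"] mdist_commute[of m p "\<sigma> 0"] by linarith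
    qed
  qed
  have "d (\<Psi> s) (\<Psi> t) \<in> {\<bar>s - t\<bar>}" if "0 \<le> s" "0 \<le> t" for s t
  proof (rule \<Psi>(3))
    show "\<forall>\<^sub>F n in sequentially. d (\<Phi> n s) (\<Phi> n t) \<in> {\<bar>s - t\<bar>}"
      using ev[of s] ev[of t] by eventually_elim (use that p M in \<open>simp add: \<Phi>_def dist_geo_geo\<close>)
  qed simp
  then have ray: "geodesic_ray m \<Psi>" using \<Psi>(1) by (auto simp: geodesic_ray_def)
  have "d p (\<Psi> 0) \<in> {0}"
    by (rule \<Psi>(2)) (use p M in \<open>auto simp: \<Phi>_def\<close>)
  then have "\<Psi> 0 = p" using p \<Psi>(1)[of 0] by auto
  moreover have "d (\<sigma> t) (\<Psi> t) \<in> {..d p (\<sigma> 0)}" if t: "0 \<le> t" for t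
  proof (rule \<Psi>(2))
    show "\<forall>\<^sub>F n in sequentially. d (\<sigma> t) (\<Phi> n t) \<in> {..d p (\<sigma> 0)}"
      using ev[of t]
    proof eventually_elim
      case (elim n)
      then show ?case
        using geo_base_change[of "\<sigma> 0" p "\<sigma> (real n)" t] ray_geo[OF \<sigma> t, of "real n"] t p M \<sigma>
        by (simp add: \<Phi>_def ray_dist mdist_commute[of m p "\<sigma> 0"])
    qed
  qed (use t M in auto)
  ultimately show ?thesis
    using that[of \<Psi>] ray \<sigma> asymptoticI[of \<sigma> \<Psi> "d p (\<sigma> 0)"] by auto
qed

lemma boundary_ray_from:
  assumes "\<xi> \<in> boundary m" "p \<in> M"
  obtains \<tau> where "\<tau> \<in> \<xi>" "\<tau> 0 = p" "geodesic_ray m \<tau>" "\<xi> = cls \<tau>"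
proof -
  obtain \<sigma> where "geodesic_ray m \<sigma>" "\<xi> = cls \<sigma>" using boundary_cases[OF assms(1)] by metis
  then show ?thesis
    using asymptotic_ray_ex[OF _ assms(2), of \<sigma>] that cls_eqI by (metis mem_cls)
qed

lemma end_nbhd_basis:
  assumes "openin (boundary_topology m) U" "\<xi> \<in> U" "\<sigma> \<in> \<xi>"
  obtains R0 where "0 < R0" "\<And>R. R0 \<le> R \<Longrightarrow> end_nbhd \<sigma> R \<subseteq> U"
proof -
  obtain O' where O': "openin (cone_topology m) O'" "U = Inr -` O' \<inter> boundary m"
    using assms(1) unfolding boundary_topology_def openin_pullback_topology by blast
  have all: "\<forall>p\<in>M. \<exists>\<tau>\<in>\<eta>. \<tau> 0 = p" if "\<eta> \<in> boundary m" for \<eta>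
    using boundary_ray_from[OF that] by blast
  have \<xi>: "\<xi> \<in> boundary m" "Inr \<xi> \<in> O'" using assms O' by auto
  obtain R0 where R0: "0 < R0" "\<And>R. R0 \<le> R \<Longrightarrow> nbhd_within \<sigma> R O'"
    using cone_nbhd_basis[OF O'(1) \<xi>(2,1) assms(3)] by auto
  have "end_nbhd \<sigma> R \<subseteq> U" if R: "R0 \<le> R" for R
  proof
    fix \<eta> assume \<eta>: "\<eta> \<in> end_nbhd \<sigma> R"
    then have "\<eta> \<in> boundary m" by (simp add: end_nbhd_def)
    then show "\<eta> \<in> U" using R0(2)[OF R] \<eta> all O'(2) unfolding nbhd_within_def by simp
  qed
  with R0(1) show ?thesis by (rule that)
qed

text \<open>Rays from one origin to distinct ends are somewhere more than 2 apart; a common point of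
  the two neighbourhoods of tolerance 1 at that radius would bring them closer.\<close>

lemma Hausdorff_boundary: "Hausdorff_space (boundary_topology m)"
  unfolding Hausdorff_space_def topspace_boundary
proof (intro allI impI, elim conjE)
  fix \<xi> \<eta> assume \<xi>: "\<xi> \<in> boundary m" and \<eta>: "\<eta> \<in> boundary m" and ne: "\<xi> \<noteq> \<eta>"
  obtain \<sigma> where \<sigma>: "\<sigma> \<in> \<xi>" "geodesic_ray m \<sigma>" "\<xi> = cls \<sigma>" using boundary_cases[OF \<xi>] by metis
  obtain \<tau> where \<tau>: "\<tau> \<in> \<eta>" "\<tau> 0 = \<sigma> 0" "geodesic_ray m \<tau>" "\<eta> = cls \<tau>"
    using boundary_ray_from[OF \<eta>, of "\<sigma> 0"] ray_mem \<sigma> by auto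
  have "\<not> (\<forall>t\<ge>0. d (\<sigma> t) (\<tau> t) \<le> 2)"
    using asymptoticI[OF \<sigma>(2) \<tau>(3)] cls_eqI \<sigma> \<tau> ne by blast
  then obtain R where R: "0 \<le> R" "2 < d (\<sigma> R) (\<tau> R)" by auto
  then have "0 < R" using \<tau>(2) ray_mem[OF \<sigma>(2), of 0] by (cases "R = 0") auto
  have "disjnt (end_nbhd \<sigma> R) (end_nbhd \<tau> R)"
    unfolding disjnt_iff
  proof (intro allI notI, elim conjE)
    fix \<zeta> assume "\<zeta> \<in> end_nbhd \<sigma> R" "\<zeta> \<in> end_nbhd \<tau> R"
    then obtain \<rho> \<rho>' where \<rho>: "\<zeta> \<in> boundary m" "\<rho> \<in> \<zeta>" "\<rho>' \<in> \<zeta>" "\<rho> 0 = \<sigma> 0" "\<rho>' 0 = \<sigma> 0"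
       "d (\<rho> R) (\<sigma> R) < 1" "d (\<rho>' R) (\<tau> R) < 1"
      using \<tau>(2) by (auto simp: end_nbhd_def)
    then have "\<rho> R = \<rho>' R" using asymptotic_unique[OF boundary_asymptotic] R by metis
    moreover have "d (\<sigma> R) (\<tau> R) \<le> d (\<rho> R) (\<sigma> R) + d (\<rho> R) (\<tau> R)"
      using mdist_triangle[of "\<sigma> R" m "\<rho> R" "\<tau> R"] ray_mem R \<sigma> \<tau> boundary_mem[OF \<rho>(1,2)] by (simp add: mdist_commute)
    ultimately show False using \<rho>(6,7) R(2) by simp
  qed
  then show "\<exists>U V. openin (boundary_topology m) U \<and> openin (boundary_topology m) V \<and> \<xi> \<in> U \<and> \<eta> \<in> V \<and> disjnt U V"
    using openin_end_nbhd mem_own_end_nbhd \<open>0 < R\<close> \<sigma> \<tau> \<xi> \<eta> by metis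
qed

end

section \<open>Isometries\<close>

lemma subgroup_isometries:
  "subgroup {f \<in> Bij (mspace m). \<forall>x\<in>mspace m. \<forall>y\<in>mspace m. mdist m (f x) (f y) = mdist m x y} (BijGroup (mspace m))"
    (is "subgroup ?H ?G")
proof (rule group.subgroupI[OF group_BijGroup])
  show "?H \<subseteq> carrier ?G" by (auto simp: BijGroup_def)
  have "(\<lambda>x\<in>mspace m. x) \<in> ?H" using id_Bij by auto
  then show "?H \<noteq> {}" by blast
next
  fix f assume f: "f \<in> ?H"
  then have inv: "inv\<^bsub>?G\<^esub> f = (\<lambda>x\<in>mspace m. inv_into (mspace m) f x)" by (simp add: inv_BijGroup)
  have B: "bij_betw f (mspace m) (mspace m)" using f by (auto simp: Bij_def)
  have "mdist m (inv_into (mspace m) f x) (inv_into (mspace m) f y) = mdist m x y"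
    if "x \<in> mspace m" "y \<in> mspace m" for x y
  proof -
    have fB: "f \<in> Bij (mspace m)" and fd: "\<And>x y. x \<in> mspace m \<Longrightarrow> y \<in> mspace m \<Longrightarrow> mdist m (f x) (f y) = mdist m x y"
      using f by auto
    note mem = Bij_inv_into_mem[OF fB that(1)] Bij_inv_into_mem[OF fB that(2)]
    show ?thesis
      using fd[OF mem] by (simp add: bij_betw_inv_into_right[OF B] that)
  qed
  then show "inv\<^bsub>?G\<^esub> f \<in> ?H" unfolding inv using f by (auto intro: restrict_inv_into_Bij)
next
  fix f g assume "f \<in> ?H" "g \<in> ?H"
  then show "f \<otimes>\<^bsub>?G\<^esub> g \<in> ?H"
    using Bij_imp_funcset[of g "mspace m"] by (auto simp: BijGroup_def compose_Bij compose_eq Pi_iff)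
qed

lemma group_isometry_group: "group (isometry_group m)"
  unfolding isometry_group_def
  by (rule subgroup.subgroup_is_group[OF subgroup_isometries group_BijGroup])

lemma isometry_Bij: "f \<in> carrier (isometry_group m) \<Longrightarrow> f \<in> Bij (mspace m)"
  by (simp add: isometry_group_def)

lemma isometry_mem: "f \<in> carrier (isometry_group m) \<Longrightarrow> x \<in> mspace m \<Longrightarrow> f x \<in> mspace m"
  using Bij_imp_funcset[OF isometry_Bij] by blast

lemma isometry_dist:
  "f \<in> carrier (isometry_group m) \<Longrightarrow> x \<in> mspace m \<Longrightarrow> y \<in> mspace m \<Longrightarrow> mdist m (f x) (f y) = mdist m x y"
  by (simp add: isometry_group_def)

lemma isometry_mult:
  "f \<in> carrier (isometry_group m) \<Longrightarrow> g \<in> carrier (isometry_group m) \<Longrightarrow> x \<in> mspace m \<Longrightarrow>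
    (f \<otimes>\<^bsub>isometry_group m\<^esub> g) x = f (g x)"
  by (simp add: isometry_group_def BijGroup_def compose_eq)

lemma isometry_one: "x \<in> mspace m \<Longrightarrow> \<one>\<^bsub>isometry_group m\<^esub> x = x"
  by (simp add: isometry_group_def BijGroup_def)

lemma isometry_inv:
  assumes "f \<in> carrier (isometry_group m)" "x \<in> mspace m"
  shows "(inv\<^bsub>isometry_group m\<^esub> f) (f x) = x" "f ((inv\<^bsub>isometry_group m\<^esub> f) x) = x"
proof -
  interpret group "isometry_group m" by (rule group_isometry_group)
  note inv = inv_closed[OF assms(1)]
  show "(inv\<^bsub>isometry_group m\<^esub> f) (f x) = x"
    using isometry_mult[OF inv assms(1,2)] isometry_one[OF assms(2)] l_inv[OF assms(1)] by simp
  show "f ((inv\<^bsub>isometry_group m\<^esub> f) x) = x"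
    using isometry_mult[OF assms(1) inv assms(2)] isometry_one[OF assms(2)] r_inv[OF assms(1)] by simp
qed

context cat0
begin

lemma isometry_ray:
  "f \<in> carrier (isometry_group m) \<Longrightarrow> geodesic_ray m \<sigma> \<Longrightarrow> geodesic_ray m (f \<circ> \<sigma>)"
  using isometry_mem isometry_dist by (fastforce simp: geodesic_ray_def image_subset_iff)

lemma isometry_asymptotic:
  assumes "f \<in> carrier (isometry_group m)" "(\<sigma>, \<tau>) \<in> asymptotic m"
  shows "(f \<circ> \<sigma>, f \<circ> \<tau>) \<in> asymptotic m"
proof -
  have r: "geodesic_ray m \<sigma>" "geodesic_ray m \<tau>" using assms(2) by (auto simp: asymptotic_def)
  show ?thesis
    by (rule asymptoticI[where C = "d (\<sigma> 0) (\<tau> 0)"])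
      (use asymptotic_dist[OF assms(2)] isometry_ray[OF assms(1)] r isometry_dist[OF assms(1)] in
        \<open>auto simp: ray_mem\<close>)
qed

lemma isometry_geo:
  assumes f: "f \<in> carrier (isometry_group m)" and "x \<in> M" "y \<in> M" "0 \<le> t" "t \<le> d x y"
  shows "f (geo x y t) = geo (f x) (f y) t"
  by (rule geo_unique) (use assms isometry_dist[OF f] isometry_mem[OF f] in \<open>auto simp: geo_mem dist_geo\<close>)

lemma boundary_map_cls:
  assumes f: "f \<in> carrier (isometry_group m)" and \<sigma>: "geodesic_ray m \<sigma>"
  shows "boundary_map m f (cls \<sigma>) = cls (f \<circ> \<sigma>)"
proof -
  have "boundary_map m f (cls \<sigma>) = (\<Union>\<tau>\<in>cls \<sigma>. cls (f \<circ> \<tau>))"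
    by (auto simp: boundary_map_def cls_def)
  moreover have "cls (f \<circ> \<tau>) = cls (f \<circ> \<sigma>)" if "\<tau> \<in> cls \<sigma>" for \<tau>
    using isometry_asymptotic[OF f] that cls_eqI by (metis mem_cls)
  moreover have "cls \<sigma> \<noteq> {}" using self_mem_cls[OF \<sigma>] by blast
  ultimately show ?thesis by auto
qed

lemma boundary_map_mem:
  assumes "f \<in> carrier (isometry_group m)" "\<xi> \<in> boundary m"
  shows "boundary_map m f \<xi> \<in> boundary m"
  using assms(2) by (rule boundary_cases) (use assms(1) in \<open>auto simp: boundary_map_cls cls_boundary isometry_ray\<close>)

lemma mem_boundary_map:
  assumes f: "f \<in> carrier (isometry_group m)" and \<xi>: "\<xi> \<in> boundary m" "\<sigma> \<in> \<xi>"
  shows "f \<circ> \<sigma> \<in> boundary_map m f \<xi>"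
proof -
  have r: "geodesic_ray m \<sigma>" "\<xi> = cls \<sigma>" using boundary_mem[OF \<xi>] by blast+
  show ?thesis
    unfolding r(2) boundary_map_cls[OF f r(1)] by (rule self_mem_cls[OF isometry_ray[OF f r(1)]])
qed

text \<open>The product of \<open>isometry_group\<close> is a composition restricted to
  \<open>mspace m\<close>, so applied to a ray it agrees with plain composition for nonnegative
  parameters, but not necessarily elsewhere.\<close>

lemma cls_cong:
  assumes "geodesic_ray m \<sigma>" "\<And>t. 0 \<le> t \<Longrightarrow> \<sigma> t = \<tau> t"
  shows "cls \<sigma> = cls \<tau>"
proof (rule cls_eqI, rule asymptoticI)
  show "geodesic_ray m \<tau>" using assms unfolding geodesic_ray_def by (auto simp: image_subset_iff)
  show "d (\<sigma> t) (\<tau> t) \<le> 0" if "0 \<le> t" for t using assms(2)[OF that] ray_mem[OF assms(1) that] by simp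
qed fact

lemma boundary_map_mult:
  assumes f: "f \<in> carrier (isometry_group m)" and g: "g \<in> carrier (isometry_group m)" and \<xi>: "\<xi> \<in> boundary m"
  shows "boundary_map m (f \<otimes>\<^bsub>isometry_group m\<^esub> g) \<xi> = boundary_map m f (boundary_map m g \<xi>)"
proof -
  interpret group "isometry_group m" by (rule group_isometry_group)
  obtain \<sigma> where \<sigma>: "geodesic_ray m \<sigma>" "\<xi> = cls \<sigma>" using boundary_cases[OF \<xi>] by metis
  have "cls ((f \<otimes>\<^bsub>isometry_group m\<^esub> g) \<circ> \<sigma>) = cls (f \<circ> (g \<circ> \<sigma>))"
    by (rule cls_cong) (use f g \<sigma> in \<open>auto simp: isometry_mult ray_mem intro!: isometry_ray\<close>)
  then show ?thesis using \<sigma> f g by (simp add: boundary_map_cls isometry_ray)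
qed

lemma boundary_map_one:
  assumes "\<xi> \<in> boundary m" shows "boundary_map m \<one>\<^bsub>isometry_group m\<^esub> \<xi> = \<xi>"
proof -
  interpret group "isometry_group m" by (rule group_isometry_group)
  obtain \<sigma> where \<sigma>: "geodesic_ray m \<sigma>" "\<xi> = cls \<sigma>" using boundary_cases[OF assms] by metis
  have "cls (\<one>\<^bsub>isometry_group m\<^esub> \<circ> \<sigma>) = cls \<sigma>"
    by (rule cls_cong[symmetric]) (use \<sigma> in \<open>auto simp: isometry_one ray_mem\<close>)
  then show ?thesis using \<sigma> by (simp add: boundary_map_cls)
qed

end

lemma (in proper_cat0) continuous_boundary_map:
  assumes f: "f \<in> carrier (isometry_group m)"
  shows "continuous_map (boundary_topology m) (boundary_topology m) (boundary_map m f)"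
  unfolding continuous_map_def topspace_boundary
proof (intro conjI allI impI)
  show "boundary_map m f \<in> boundary m \<rightarrow> boundary m" using boundary_map_mem[OF f] by blast
  fix U assume U: "openin (boundary_topology m) U"
  show "openin (boundary_topology m) {\<xi> \<in> boundary m. boundary_map m f \<xi> \<in> U}"
  proof (subst openin_subopen, intro ballI)
    fix \<xi> assume "\<xi> \<in> {\<xi> \<in> boundary m. boundary_map m f \<xi> \<in> U}"
    then have \<xi>: "\<xi> \<in> boundary m" "boundary_map m f \<xi> \<in> U" by auto
    obtain \<sigma> where \<sigma>: "geodesic_ray m \<sigma>" "\<sigma> \<in> \<xi>" using boundary_cases[OF \<xi>(1)] by metis
    obtain R where R: "0 < R" "\<And>R'. R \<le> R' \<Longrightarrow> end_nbhd (f \<circ> \<sigma>) R' \<subseteq> U"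
      using end_nbhd_basis[OF U \<xi>(2) mem_boundary_map[OF f \<xi>(1) \<sigma>(2)]] by metis
    have "boundary_map m f \<eta> \<in> U" if \<eta>: "\<eta> \<in> end_nbhd \<sigma> R" for \<eta>
    proof -
      obtain \<tau> where \<tau>: "\<eta> \<in> boundary m" "\<tau> \<in> \<eta>" "\<tau> 0 = \<sigma> 0" "d (\<tau> R) (\<sigma> R) < 1"
        using \<eta> by (auto simp: end_nbhd_def)
      have "\<tau> R \<in> M" "\<sigma> R \<in> M" using boundary_mem[OF \<tau>(1,2)] \<sigma> R(1) ray_mem by auto
      then have "boundary_map m f \<eta> \<in> end_nbhd (f \<circ> \<sigma>) R"
        using mem_boundary_map[OF f \<tau>(1,2)] \<tau> boundary_map_mem[OF f] isometry_dist[OF f]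
        by (auto simp: end_nbhd_def intro!: bexI[of _ "f \<circ> \<tau>"])
      then show ?thesis using R(2)[of R] by auto
    qed
    then show "\<exists>T. openin (boundary_topology m) T \<and> \<xi> \<in> T \<and> T \<subseteq> {\<xi> \<in> boundary m. boundary_map m f \<xi> \<in> U}"
      using openin_end_nbhd[OF \<sigma>(1) R(1)] mem_own_end_nbhd[OF \<xi>(1) \<sigma>(2) R(1)]
      by (intro exI[of _ "end_nbhd \<sigma> R"]) (auto simp: end_nbhd_def)
  qed
qed

section \<open>Flat half-planes\<close>

context cat0
begin

lemma line_mem: "geodesic_line m \<sigma> \<Longrightarrow> \<sigma> t \<in> M"
  by (auto simp: geodesic_line_def)

lemma line_dist: "geodesic_line m \<sigma> \<Longrightarrow> d (\<sigma> s) (\<sigma> t) = \<bar>s - t\<bar>"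
  by (auto simp: geodesic_line_def)

lemma line_cmb:
  assumes \<sigma>: "geodesic_line m \<sigma>" and \<kappa>: "0 \<le> \<kappa>" "\<kappa> \<le> 1"
  shows "cmb (\<sigma> a) (\<sigma> b) \<kappa> = \<sigma> ((1 - \<kappa>) * a + \<kappa> * b)"
proof (rule cmb_unique[symmetric])
  have "a - ((1 - \<kappa>) * a + \<kappa> * b) = \<kappa> * (a - b)" "(1 - \<kappa>) * a + \<kappa> * b - b = (1 - \<kappa>) * (a - b)"
    by (simp_all add: algebra_simps)
  then show "d (\<sigma> a) (\<sigma> ((1 - \<kappa>) * a + \<kappa> * b)) \<le> \<kappa> * d (\<sigma> a) (\<sigma> b)"
    "d (\<sigma> ((1 - \<kappa>) * a + \<kappa> * b)) (\<sigma> b) \<le> (1 - \<kappa>) * d (\<sigma> a) (\<sigma> b)"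
    using \<kappa> by (simp_all add: line_dist[OF \<sigma>] abs_mult)
qed (use \<kappa> line_mem[OF \<sigma>] in auto)

lemma line_CN:
  assumes "geodesic_line m \<sigma>" "0 \<le> \<kappa>" "\<kappa> \<le> 1" "p \<in> M"
  shows "(d p (\<sigma> ((1 - \<kappa>) * a + \<kappa> * b)))\<^sup>2
    \<le> (1 - \<kappa>) * (d p (\<sigma> a))\<^sup>2 + \<kappa> * (d p (\<sigma> b))\<^sup>2 - \<kappa> * (1 - \<kappa>) * (a - b)\<^sup>2"
  using CN[of "\<sigma> a" "\<sigma> b" \<kappa> p] assms by (simp add: line_cmb line_mem line_dist)

lemma cmb_self: "x \<in> M \<Longrightarrow> 0 \<le> \<kappa> \<Longrightarrow> \<kappa> \<le> 1 \<Longrightarrow> cmb x x \<kappa> = x"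
  by (rule cmb_unique[symmetric]) auto

lemma line_dist_convex:
  assumes \<sigma>: "geodesic_line m \<sigma>" and z: "z \<in> M"
  shows "convex_on UNIV (\<lambda>t. d z (\<sigma> t))"
proof (rule convex_onI)
  fix \<kappa> a b :: real assume \<kappa>: "0 < \<kappa>" "\<kappa> < 1"
  then show "d z (\<sigma> ((1 - \<kappa>) *\<^sub>R a + \<kappa> *\<^sub>R b)) \<le> (1 - \<kappa>) * d z (\<sigma> a) + \<kappa> * d z (\<sigma> b)"
    using cmb_convex[of z z "\<sigma> a" "\<sigma> b" \<kappa>] z \<sigma> by (simp add: line_cmb line_mem cmb_self)
qed simp

text \<open>The half-plane is complete, so a sequence converging in the image pulls back to a
  convergent one.\<close>

lemma half_plane_closed:
  fixes \<phi> :: "real \<times> real \<Rightarrow> 'a"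
  assumes mem: "\<And>u. u \<in> {0..} \<times> UNIV \<Longrightarrow> \<phi> u \<in> M"
    and iso: "\<And>u v. u \<in> {0..} \<times> UNIV \<Longrightarrow> v \<in> {0..} \<times> UNIV \<Longrightarrow> d (\<phi> u) (\<phi> v) = dist u v"
  shows "closedin (mtopology_of m) (\<phi> ` ({0..} \<times> UNIV))"
proof -
  interpret Metric_space M d by simp
  let ?S = "{0..} \<times> UNIV :: (real \<times> real) set"
  have top: "mtopology_of m = mtopology" by (simp add: mtopology_of_def)
  show ?thesis
    unfolding top metric_closedin_iff_sequentially_closed
  proof (intro conjI allI impI)
    show "\<phi> ` ?S \<subseteq> M" using mem by blast
    fix x y assume "range x \<subseteq> \<phi> ` ?S \<and> limitin mtopology x y sequentially"
    then have x: "range x \<subseteq> \<phi> ` ?S" and lim: "limitin mtopology x y sequentially" by auto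
    have "x n \<in> \<phi> ` ?S" for n using x by (meson rangeI subsetD)
    then have "\<forall>n. \<exists>u. u \<in> ?S \<and> x n = \<phi> u" by (meson imageE)
    then obtain u where u: "\<And>n. u n \<in> ?S" "\<And>n. x n = \<phi> (u n)" by metis
    have "range x \<subseteq> M" using mem[OF u(1)] unfolding image_subset_iff u(2) by simp
    then have "MCauchy x" using convergent_imp_MCauchy[OF _ lim] by blast
    then have "Cauchy u"
      unfolding MCauchy_def Cauchy_def u(2) using iso u(1) by auto
    then obtain v where v: "u \<longlonglongrightarrow> v" using Cauchy_convergent convergent_def by blast
    have vS: "v \<in> ?S"
      by (rule closed_sequentially[OF _ u(1) v]) (intro closed_Times closed_atLeast closed_UNIV)
    have lim': "limitin mtopology x (\<phi> v) sequentially"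
      unfolding limitin_metric
    proof (intro conjI allI impI)
      fix e :: real assume "0 < e"
      with v have "\<forall>\<^sub>F n in sequentially. dist (u n) v < e" by (simp add: tendsto_iff)
      then show "\<forall>\<^sub>F n in sequentially. x n \<in> M \<and> d (x n) (\<phi> v) < e"
        by eventually_elim (use u mem iso vS in auto)
    qed (use mem vS in auto)
    have "y = \<phi> v" using limitin_metric_unique[OF lim lim'] by simp
    with vS show "y \<in> \<phi> ` ?S" by blast
  qed
qed

text \<open>Straight segments of the half-plane map to geodesics, and geodesics in \<open>m\<close>
  are unique.\<close>

lemma half_plane_convex:
  fixes \<phi> :: "real \<times> real \<Rightarrow> 'a"
  assumes mem: "\<And>u. u \<in> {0..} \<times> UNIV \<Longrightarrow> \<phi> u \<in> M"
    and iso: "\<And>u v. u \<in> {0..} \<times> UNIV \<Longrightarrow> v \<in> {0..} \<times> UNIV \<Longrightarrow> d (\<phi> u) (\<phi> v) = dist u v"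
  shows "geodesically_convex m (\<phi> ` ({0..} \<times> UNIV))"
  unfolding geodesically_convex_def
proof (intro ballI allI impI)
  let ?S = "{0..} \<times> UNIV :: (real \<times> real) set"
  fix x y c assume "x \<in> \<phi> ` ?S" "y \<in> \<phi> ` ?S" and c: "geodesic_segment m c x y"
  then obtain u v where u: "u \<in> ?S" "x = \<phi> u" and v: "v \<in> ?S" "y = \<phi> v" by blast
  have xy: "x \<in> M" "y \<in> M" "d x y = dist u v" using u v mem iso by auto
  show "c ` {0..d x y} \<subseteq> \<phi> ` ?S"
  proof (intro image_subsetI)
    fix t assume t: "t \<in> {0..d x y}"
    note f = frac_bounds[of t x y]
    define \<kappa> where "\<kappa> = t / d x y"
    have \<kappa>: "0 \<le> \<kappa>" "\<kappa> \<le> 1" "\<kappa> * dist u v = t" using f t xy by (auto simp: \<kappa>_def)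
    define w where "w = (1 - \<kappa>) *\<^sub>R u + \<kappa> *\<^sub>R v"
    have "convex ?S" by (intro convex_Times convex_UNIV convex_real_interval)
    then have w: "w \<in> ?S" unfolding w_def using u v \<kappa> by (intro convexD) auto
    have "u - w = \<kappa> *\<^sub>R (u - v)" "w - v = (1 - \<kappa>) *\<^sub>R (u - v)"
      by (simp_all add: w_def algebra_simps)
    then have "dist u w = \<kappa> * dist u v" "dist w v = (1 - \<kappa>) * dist u v"
      using \<kappa> by (simp_all add: dist_norm)
    then have "\<phi> w = geo x y t"
      using u v w xy t \<kappa> mem iso by (intro geo_unique) (auto simp: left_diff_distrib)
    moreover have "c t = geo x y t" using geodesic_segment_eq_geo[OF c xy(1,2)] t by auto
    ultimately show "c t \<in> \<phi> ` ?S" using w by (metis imageI)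
  qed
qed

lemma bounds_flat_half_planeI:
  fixes \<phi> :: "real \<times> real \<Rightarrow> 'a"
  assumes mem: "\<And>u. u \<in> {0..} \<times> UNIV \<Longrightarrow> \<phi> u \<in> M"
    and iso: "\<And>u v. u \<in> {0..} \<times> UNIV \<Longrightarrow> v \<in> {0..} \<times> UNIV \<Longrightarrow> d (\<phi> u) (\<phi> v) = dist u v"
    and edge: "\<And>t. \<phi> (0, t) = \<sigma> t"
  shows "bounds_flat_half_plane m \<sigma>"
  unfolding bounds_flat_half_plane_def
proof (intro exI[of _ "\<phi> ` ({0..} \<times> UNIV)"] exI[of _ \<phi>] conjI ballI)
  have "inj_on \<phi> ({0..} \<times> UNIV)"
  proof (rule inj_onI)
    fix u v assume "u \<in> {0..} \<times> (UNIV :: real set)" "v \<in> {0..} \<times> (UNIV :: real set)" "\<phi> u = \<phi> v"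
    then show "u = v" using iso[of u v] mem[of v] by simp
  qed
  then show "bij_betw \<phi> ({0..} \<times> UNIV) (\<phi> ` ({0..} \<times> UNIV))" by (rule inj_on_imp_bij_betw)
  show "\<phi> ` ({0} \<times> UNIV) = range \<sigma>" using edge by (auto simp: image_iff)
qed (use half_plane_closed half_plane_convex mem iso in auto)

text \<open>\<open>\<Phi> t\<close> is the ray from \<open>\<sigma> t\<close> to a fixed boundary point whose Busemann function is affine with
  slope \<open>\<beta>\<close> along \<open>\<sigma>\<close>; \<open>(t, u)\<close> are oblique coordinates of the half-plane it sweeps out.\<close>

lemma affine_Busemann_half_plane:
  fixes \<Phi> :: "real \<Rightarrow> real \<Rightarrow> 'a"
  assumes line: "geodesic_line m \<sigma>" and \<beta>: "\<bar>\<beta>\<bar> < 1"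
    and mem: "\<And>t u. 0 \<le> u \<Longrightarrow> \<Phi> t u \<in> M"
    and ray: "\<And>t u v. 0 \<le> u \<Longrightarrow> 0 \<le> v \<Longrightarrow> d (\<Phi> t u) (\<Phi> t v) = \<bar>u - v\<bar>"
    and start: "\<And>t. \<Phi> t 0 = \<sigma> t"
    and upper: "\<And>t u s. 0 \<le> u \<Longrightarrow> (d (\<Phi> t u) (\<sigma> s))\<^sup>2 \<le> (s - t)\<^sup>2 + 2 * u * \<beta> * (s - t) + u\<^sup>2"
    and level: "\<And>t u s. 0 \<le> u \<Longrightarrow> d (\<Phi> t u) (\<Phi> s u) \<le> \<bar>t - s\<bar>"
  shows "bounds_flat_half_plane m \<sigma>"
proof -
  have \<sigma>: "\<sigma> t \<in> M" for t using line line_mem by blast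
  \<comment> \<open>The left side minus \<open>s\<^sup>2\<close> is convex in \<open>s\<close> and lies below an affine function which it touches at \<open>t\<close>.\<close>
  have E1: "(d (\<Phi> t u) (\<sigma> s))\<^sup>2 = (s - t)\<^sup>2 + 2 * u * \<beta> * (s - t) + u\<^sup>2" if u: "0 \<le> u" for t u s
  proof -
    have "(d (\<Phi> t u) (\<sigma> ((1 - 1/2) * s + 1/2 * (2 * t - s))))\<^sup>2 \<le> (1 - 1/2) * (d (\<Phi> t u) (\<sigma> s))\<^sup>2
        + 1/2 * (d (\<Phi> t u) (\<sigma> (2 * t - s)))\<^sup>2 - 1/2 * (1 - 1/2) * (s - (2 * t - s))\<^sup>2"
      using line u mem by (intro line_CN) auto
    moreover have "(1 - 1/2) * s + 1/2 * (2 * t - s) = t" by (simp add: field_simps)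
    moreover have "d (\<Phi> t u) (\<sigma> t) = u" using ray[OF u, of 0 t] start u by simp
    ultimately have "u\<^sup>2 \<le> 1/2 * (d (\<Phi> t u) (\<sigma> s))\<^sup>2 + 1/2 * (d (\<Phi> t u) (\<sigma> (2 * t - s)))\<^sup>2 - (s - t)\<^sup>2"
      by (simp add: power2_eq_square algebra_simps)
    moreover have "(d (\<Phi> t u) (\<sigma> (2 * t - s)))\<^sup>2 \<le> (s - t)\<^sup>2 - 2 * u * \<beta> * (s - t) + u\<^sup>2"
      using upper[OF u, of t "2 * t - s"] by (simp add: power2_commute[of s t] algebra_simps)
    ultimately show ?thesis using upper[OF u, of t s] by linarith
  qed
  have E2: "d (\<Phi> t u) (\<Phi> s u) = \<bar>t - s\<bar>" if u: "0 \<le> u" for t u s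
  proof -
    \<comment> \<open>This supplies the bound opposite to \<open>level\<close>: as \<open>x\<close>
      tends to infinity, the distances from \<open>\<Phi> t u\<close> and \<open>\<Phi> s u\<close>
      to \<open>\<sigma> (x + s)\<close> differ by almost \<open>s - t\<close>.\<close>
    have *: "s - t \<le> d (\<Phi> t u) (\<Phi> s u)" if "t < s" for s t
    proof -
      define q where "q x = sqrt (x\<^sup>2 + 2 * u * \<beta> * x + u\<^sup>2)" for x
      have q: "d (\<Phi> t u) (\<sigma> r) = q (r - t)" for t r
        using E1[OF u, of t r] unfolding q_def by (metis abs_of_nonneg mdist_nonneg real_sqrt_abs mult.commute mult.left_commute)
      \<comment> \<open>The limit is stated in the form in which \<open>real_asymp\<close> computes
        it; it equals \<open>s - t\<close>.\<close>
      have "((\<lambda>x. sqrt ((x + (s - t))\<^sup>2 + 2 * u * \<beta> * (x + (s - t)) + u\<^sup>2)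
          - sqrt (x\<^sup>2 + 2 * u * \<beta> * x + u\<^sup>2)) \<longlongrightarrow> (s * 2 - t * 2 + 2 * u * \<beta>) / 2 - u * \<beta>) at_top"
        by real_asymp
      also have "(s * 2 - t * 2 + 2 * u * \<beta>) / 2 - u * \<beta> = s - t" by (simp add: field_simps)
      finally have lim: "((\<lambda>x. q (x + (s - t)) - q x) \<longlongrightarrow> s - t) at_top" by (simp add: q_def)
      have "q (x + (s - t)) - q x \<le> d (\<Phi> t u) (\<Phi> s u)" for x
        using mdist_triangle[OF mem[OF u, of t] mem[OF u, of s] \<sigma>[of "x + s"]] unfolding q
        by (simp add: algebra_simps)
      then show ?thesis
        using tendsto_upperbound[OF lim] by (simp add: always_eventually)
    qed
    show ?thesis
      using *[of t s] *[of s t] level[OF u, of t s] mdist_commute[of m "\<Phi> t u" "\<Phi> s u"]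
      by (cases t s rule: linorder_cases) (auto simp: mem u)
  qed
  have E3: "(d (\<Phi> s v) (\<Phi> t u))\<^sup>2 = (t - s)\<^sup>2 - 2 * \<beta> * (t - s) * (u - v) + (u - v)\<^sup>2"
    if uv: "0 \<le> v" "v < u" for s t u v
  proof -
    define e where "e = (t - s)\<^sup>2 - 2 * \<beta> * (t - s) * (u - v) + (u - v)\<^sup>2"
    have u: "0 \<le> u" "0 < u - v" using uv by auto
    \<comment> \<open>CN on the ray from \<open>\<sigma> s\<close> through \<open>\<Phi> s v\<close>
      to \<open>\<Phi> s u\<close>, seen from \<open>\<Phi> t u\<close>, gives the upper bound;
      \<open>E1\<close> at the point \<open>p\<close> below gives the lower one.\<close>
    have vs: "\<Phi> s v = cmb (\<sigma> s) (\<Phi> s u) (v / u)"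
      using uv mem \<sigma> ray[of 0 v s] ray[of 0 u s] ray[of v u s] start
      by (intro cmb_unique) (auto simp: left_diff_distrib)
    have "(d (\<Phi> t u) (\<Phi> s v))\<^sup>2 \<le> (1 - v / u) * (d (\<Phi> t u) (\<sigma> s))\<^sup>2 + v / u * (d (\<Phi> t u) (\<Phi> s u))\<^sup>2
        - v / u * (1 - v / u) * (d (\<sigma> s) (\<Phi> s u))\<^sup>2"
      unfolding vs using uv mem \<sigma> by (intro CN) auto
    also have "\<dots> = (1 - v / u) * ((s - t)\<^sup>2 + 2 * u * \<beta> * (s - t) + u\<^sup>2) + v / u * (t - s)\<^sup>2
        - v / u * (1 - v / u) * u\<^sup>2"
      using u ray[of 0 u s] start by (simp add: E1 E2)
    also have "\<dots> = e"
      using uv by (simp add: e_def field_simps power2_eq_square)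
    finally have 1: "(d (\<Phi> s v) (\<Phi> t u))\<^sup>2 \<le> e" by (simp add: mdist_commute)
    then have e0: "0 \<le> e" using zero_le_power2 order_trans by blast
    \<comment> \<open>the point where the Euclidean line through \<open>\<Phi> s v\<close> and \<open>\<Phi> t u\<close> meets \<open>\<sigma>\<close>\<close>
    define p where "p = s - v * (t - s) / (u - v)"
    have pt: "p - t = - (u * (t - s) / (u - v))" "p - s = - (v * (t - s) / (u - v))"
      using u by (simp_all add: p_def field_simps)
    have aux: "(a / k)\<^sup>2 * (w\<^sup>2 - 2 * \<beta> * w * k + k\<^sup>2) = (- (a * w / k))\<^sup>2 + 2 * a * \<beta> * (- (a * w / k)) + a\<^sup>2"
      if "k \<noteq> 0" for a k w :: real
      using that by (simp add: field_simps power2_eq_square)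
    have "(d (\<Phi> t u) (\<sigma> p))\<^sup>2 = (u / (u - v))\<^sup>2 * e" "(d (\<Phi> s v) (\<sigma> p))\<^sup>2 = (v / (u - v))\<^sup>2 * e"
      unfolding E1[OF u(1)] E1[OF uv(1)] pt e_def using u(2) by (simp_all only: aux)
    then have "(d (\<Phi> t u) (\<sigma> p))\<^sup>2 = (u / (u - v) * sqrt e)\<^sup>2" "(d (\<Phi> s v) (\<sigma> p))\<^sup>2 = (v / (u - v) * sqrt e)\<^sup>2"
      using e0 by (simp_all only: power_mult_distrib real_sqrt_pow2)
    then have P: "d (\<Phi> t u) (\<sigma> p) = u / (u - v) * sqrt e" "d (\<Phi> s v) (\<sigma> p) = v / (u - v) * sqrt e"
      using uv e0 by (auto simp: power2_eq_iff_nonneg)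
    have "d (\<Phi> t u) (\<sigma> p) \<le> d (\<Phi> t u) (\<Phi> s v) + d (\<Phi> s v) (\<sigma> p)"
      using uv mem \<sigma> by (intro mdist_triangle) auto
    then have "(u / (u - v) - v / (u - v)) * sqrt e \<le> d (\<Phi> s v) (\<Phi> t u)"
      unfolding P by (simp add: mdist_commute left_diff_distrib)
    moreover have "u / (u - v) - v / (u - v) = 1" using u by (simp add: diff_divide_distrib[symmetric])
    ultimately have "(sqrt e)\<^sup>2 \<le> (d (\<Phi> s v) (\<Phi> t u))\<^sup>2" using e0 by (intro power_mono) auto
    with 1 e0 show ?thesis by (simp add: e_def)
  qed
  have E4: "(d (\<Phi> s v) (\<Phi> t u))\<^sup>2 = (t - s)\<^sup>2 - 2 * \<beta> * (t - s) * (u - v) + (u - v)\<^sup>2"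
    if uv: "0 \<le> v" "0 \<le> u" for s t u v
  proof (cases u v rule: linorder_cases)
    case less
    then show ?thesis
      using E3[of u v t s] uv by (simp add: mdist_commute power2_eq_square algebra_simps)
  next
    case equal
    then show ?thesis using E2[of u s t] uv by (simp add: power2_commute)
  next
    case greater
    then show ?thesis using E3 uv by blast
  qed
  define c where "c = sqrt (1 - \<beta>\<^sup>2)"
  have "\<beta>\<^sup>2 < 1" using \<beta> by (simp add: abs_square_less_1)
  then have c: "0 < c" "c\<^sup>2 = 1 - \<beta>\<^sup>2" by (auto simp: c_def)
  \<comment> \<open>In orthogonal coordinates \<open>\<Phi> t u\<close> is the point
    \<open>(c * u, t - \<beta> * u)\<close>; \<open>\<phi>\<close> inverts this change of
    coordinates.\<close>
  define \<phi> where "\<phi> w = \<Phi> (snd w + \<beta> * (fst w / c)) (fst w / c)" for w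
  show ?thesis
  proof (rule bounds_flat_half_planeI[of \<phi>])
    show "\<phi> w \<in> M" if "w \<in> {0..} \<times> UNIV" for w
      using that c mem by (auto simp: \<phi>_def)
    show "\<phi> (0, t) = \<sigma> t" for t by (simp add: \<phi>_def start)
    fix w w' :: "real \<times> real" assume w: "w \<in> {0..} \<times> UNIV" "w' \<in> {0..} \<times> UNIV"
    obtain a b a' b' where ab: "w = (a, b)" "w' = (a', b')" by fastforce
    have nn: "0 \<le> a / c" "0 \<le> a' / c" using w ab c by auto
    define x where "x = a' / c - a / c"
    define y where "y = b' - b"
    have cx: "c * x = a' - a" using c by (simp add: x_def right_diff_distrib)
    have "(d (\<phi> w) (\<phi> w'))\<^sup>2 = (y + \<beta> * x)\<^sup>2 - 2 * \<beta> * (y + \<beta> * x) * x + x\<^sup>2"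
      using E4[OF nn, of "b + \<beta> * (a / c)" "b' + \<beta> * (a' / c)"]
      by (simp add: \<phi>_def ab x_def y_def algebra_simps)
    also have "\<dots> = y\<^sup>2 + c\<^sup>2 * x\<^sup>2" unfolding c(2) by (simp add: power2_eq_square algebra_simps)
    also have "c\<^sup>2 * x\<^sup>2 = (a' - a)\<^sup>2" using cx by (simp add: power_mult_distrib[symmetric])
    also have "y\<^sup>2 + (a' - a)\<^sup>2 = (dist w w')\<^sup>2"
      by (simp add: ab y_def dist_Pair_Pair dist_real_def power2_commute)
    finally show "d (\<phi> w) (\<phi> w') = dist w w'" by (simp add: power2_eq_iff_nonneg)
  qed
qed

end

section \<open>Distance functions along a rank one axis\<close>

text \<open>Both slopes are compared with that of the chord over \<open>[a, e]\<close>.\<close>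

lemma convex_slope_mono:
  fixes f :: "real \<Rightarrow> real"
  assumes f: "convex_on UNIV f" and "a < b" "c < e" "a \<le> c" "b \<le> e"
  shows "(f b - f a) / (b - a) \<le> (f e - f c) / (e - c)"
proof -
  have slope: "(f x - f y) / (x - y) = (f y - f x) / (y - x)" for x y
    by (cases "x = y") (simp_all add: field_simps)
  have "(f b - f a) / (b - a) \<le> (f e - f a) / (e - a)"
    using convex_on_slope_le(1)[OF f, of a e b] assms by (cases "b = e") (auto simp: slope[of a])
  also have "\<dots> \<le> (f e - f c) / (e - c)"
    using convex_on_slope_le(2)[OF f, of a e c] assms
    by (cases "a = c") (auto simp: slope[of a] slope[of c])
  finally show ?thesis .
qed

text \<open>\<open>T n\<close> stands for the n-th power of the isometry. Taking the powers as a
  given family keeps group arithmetic out of the estimates.\<close>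

locale rank_one_axis = proper_cat0 m for m :: "'a metric" +
  fixes \<sigma> :: "real \<Rightarrow> 'a" and l :: real and T :: "int \<Rightarrow> 'a \<Rightarrow> 'a"
  assumes line: "geodesic_line m \<sigma>" and l_pos: "0 < l"
    and T_isometry: "T n \<in> carrier (isometry_group m)"
    and T_inv: "x \<in> mspace m \<Longrightarrow> T (- n) (T n x) = x"
    and T_axis: "T n (\<sigma> t) = \<sigma> (t + of_int n * l)"
    and no_half_plane: "\<not> bounds_flat_half_plane m \<sigma>"
begin

lemmas T_mem = isometry_mem[OF T_isometry]
  and T_dist = isometry_dist[OF T_isometry]

lemma axis_mem [simp]: "\<sigma> t \<in> M"
  using line line_mem by blast

lemma axis_dist: "d (\<sigma> s) (\<sigma> t) = \<bar>s - t\<bar>"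
  using line line_dist by blast

lemma dist_T:
  assumes "z \<in> M" shows "d (T n z) (\<sigma> t) = d z (\<sigma> (t - of_int n * l))"
proof -
  have "T n (\<sigma> (t - of_int n * l)) = \<sigma> t" by (simp add: T_axis)
  then show ?thesis using T_dist[OF assms axis_mem, of n "t - of_int n * l"] by simp
qed

lemma axis_convex: "z \<in> M \<Longrightarrow> convex_on UNIV (\<lambda>t. d z (\<sigma> t))"
  using line_dist_convex[OF line] .

lemma dist_axis_Lipschitz: "z \<in> M \<Longrightarrow> \<bar>d z (\<sigma> s) - d z (\<sigma> t)\<bar> \<le> \<bar>s - t\<bar>"
  using mdist_triangle[of z m "\<sigma> t" "\<sigma> s"] mdist_triangle[of z m "\<sigma> s" "\<sigma> t"]
    axis_dist[of t s] axis_dist[of s t] by auto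

text \<open>A cluster point of the geodesics from \<open>\<sigma> t\<close> to \<open>z n\<close>
  supplies the rays required by \<open>affine_Busemann_half_plane\<close>:
  \<open>geo_base_change\<close> yields the bound \<open>level\<close>, and \<open>geo_CN\<close>
  combined with the limit of the slopes yields \<open>upper\<close>.\<close>

lemma asymptotically_affine_contradiction:
  fixes z :: "nat \<Rightarrow> 'a"
  assumes z: "\<And>n. z n \<in> M" and \<beta>: "\<bar>\<beta>\<bar> < 1"
    and far: "\<And>K t. \<forall>\<^sub>F n in sequentially. K \<le> d (z n) (\<sigma> t)"
    and slope: "\<And>s t. (\<lambda>n. d (z n) (\<sigma> s) - d (z n) (\<sigma> t)) \<longlonglongrightarrow> \<beta> * (s - t)"
  shows False
proof -
  define \<Phi> where "\<Phi> n = (\<lambda>(t, u). if 0 \<le> u \<and> u \<le> d (\<sigma> t) (z n) then geo (\<sigma> t) (z n) u else \<sigma> t)" for n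
  obtain \<Psi> where \<Psi>: "\<And>j. \<Psi> j \<in> M"
    "\<And>j p S. p \<in> M \<Longrightarrow> closed S \<Longrightarrow> \<forall>\<^sub>F n in sequentially. d p (\<Phi> n j) \<in> S \<Longrightarrow> d p (\<Psi> j) \<in> S"
    "\<And>j k S. closed S \<Longrightarrow> \<forall>\<^sub>F n in sequentially. d (\<Phi> n j) (\<Phi> n k) \<in> S \<Longrightarrow> d (\<Psi> j) (\<Psi> k) \<in> S"
  proof (rule pointwise_cluster[of "\<sigma> 0" \<Phi> "\<lambda>(t, u). \<bar>t\<bar> + \<bar>u\<bar>"])
    show M: "\<Phi> n j \<in> M" for n j
      using z by (auto simp: \<Phi>_def geo_mem split: prod.split)
    show "d (\<sigma> 0) (\<Phi> n j) \<le> (case j of (t, u) \<Rightarrow> \<bar>t\<bar> + \<bar>u\<bar>)" for n j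
    proof -
      obtain t u where j: "j = (t, u)" by fastforce
      have "d (\<sigma> 0) (\<Phi> n j) \<le> d (\<sigma> 0) (\<sigma> t) + d (\<sigma> t) (\<Phi> n j)"
        using M by (intro mdist_triangle) auto
      moreover have "d (\<sigma> t) (\<Phi> n j) \<le> \<bar>u\<bar>"
        using z by (simp add: \<Phi>_def j dist_geo)
      ultimately show ?thesis by (simp add: j axis_dist)
    qed
  qed auto
  have far': "\<forall>\<^sub>F n in sequentially. u \<le> d (\<sigma> t) (z n)" for u t
    using far[of u t] by (simp add: mdist_commute)
  have "bounds_flat_half_plane m \<sigma>"
  proof (rule affine_Busemann_half_plane[OF line \<beta>, of "\<lambda>t u. \<Psi> (t, u)"])
    show "\<Psi> (t, u) \<in> M" for t u by (rule \<Psi>(1))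
    show "d (\<Psi> (t, u)) (\<Psi> (t, v)) = \<bar>u - v\<bar>" if "0 \<le> u" "0 \<le> v" for t u v
    proof -
      have "d (\<Psi> (t, u)) (\<Psi> (t, v)) \<in> {\<bar>u - v\<bar>}"
      proof (rule \<Psi>(3))
        show "\<forall>\<^sub>F n in sequentially. d (\<Phi> n (t, u)) (\<Phi> n (t, v)) \<in> {\<bar>u - v\<bar>}"
          using far'[of u t] far'[of v t]
          by eventually_elim (use that z in \<open>simp add: \<Phi>_def dist_geo_geo\<close>)
      qed simp
      then show ?thesis by simp
    qed
    show "\<Psi> (t, 0) = \<sigma> t" for t
    proof -
      have "d (\<sigma> t) (\<Psi> (t, 0)) \<in> {0}"
        by (rule \<Psi>(2)) (use z in \<open>auto simp: \<Phi>_def\<close>)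
      then show ?thesis using \<Psi>(1)[of "(t, 0)"] by simp
    qed
    show "d (\<Psi> (t, u)) (\<Psi> (s, u)) \<le> \<bar>t - s\<bar>" if "0 \<le> u" for t u s
    proof -
      have "d (\<Psi> (t, u)) (\<Psi> (s, u)) \<in> {..\<bar>t - s\<bar>}"
      proof (rule \<Psi>(3))
        show "\<forall>\<^sub>F n in sequentially. d (\<Phi> n (t, u)) (\<Phi> n (s, u)) \<in> {..\<bar>t - s\<bar>}"
          using far'[of u t] far'[of u s]
        proof eventually_elim
          case (elim n)
          then show ?case
            using geo_base_change[of "\<sigma> t" "\<sigma> s" "z n" u] z that by (simp add: \<Phi>_def axis_dist)
        qed
      qed simp
      then show ?thesis by simp
    qed
    show "(d (\<Psi> (t, u)) (\<sigma> s))\<^sup>2 \<le> (s - t)\<^sup>2 + 2 * u * \<beta> * (s - t) + u\<^sup>2" if u: "0 \<le> u" for t u s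
    proof (rule field_le_epsilon)
      fix e :: real assume e: "0 < e"
      define C where "C = (s - t)\<^sup>2 + 2 * u * \<beta> * (s - t) + u\<^sup>2 + e"
      have "d (\<sigma> s) (\<Psi> (t, u)) \<in> {x. x\<^sup>2 \<le> C}"
      proof (rule \<Psi>(2))
        show "closed {x::real. x\<^sup>2 \<le> C}" by (intro closed_Collect_le continuous_intros)
        \<comment> \<open>The slope error enters multiplied by \<open>2 * u\<close>; the extra 1
          covers \<open>u = 0\<close>.\<close>
        have "0 < e / (2 * u + 1)" using e u by simp
        then have "\<forall>\<^sub>F n in sequentially. d (z n) (\<sigma> s) - d (z n) (\<sigma> t) < \<beta> * (s - t) + e / (2 * u + 1)"
          using order_tendstoD(2)[OF slope[of s t]] by simp
        then show "\<forall>\<^sub>F n in sequentially. d (\<sigma> s) (\<Phi> n (t, u)) \<in> {x. x\<^sup>2 \<le> C}"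
          using far'[of u t]
        proof eventually_elim
          case (elim n)
          have "(d (geo (\<sigma> t) (z n) u) (\<sigma> s))\<^sup>2 \<le> (d (\<sigma> t) (\<sigma> s))\<^sup>2 + u\<^sup>2 + 2 * u * (d (\<sigma> s) (z n) - d (\<sigma> t) (z n))"
            using elim u z by (intro geo_CN) auto
          also have "2 * u * (d (\<sigma> s) (z n) - d (\<sigma> t) (z n)) \<le> 2 * u * (\<beta> * (s - t) + e / (2 * u + 1))"
            using elim u by (intro mult_left_mono) (auto simp: mdist_commute)
          also have "\<dots> \<le> 2 * u * \<beta> * (s - t) + e"
            using u e by (simp add: field_simps)
          finally have "(d (geo (\<sigma> t) (z n) u) (\<sigma> s))\<^sup>2 \<le> C"
            by (simp add: C_def axis_dist power2_commute[of s t])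
          then show ?case using elim u by (simp add: \<Phi>_def mdist_commute)
        qed
      qed simp
      then show "(d (\<Psi> (t, u)) (\<sigma> s))\<^sup>2 \<le> (s - t)\<^sup>2 + 2 * u * \<beta> * (s - t) + u\<^sup>2 + e"
        by (simp add: C_def mdist_commute)
    qed
  qed
  with no_half_plane show False by contradiction
qed

text \<open>A convex function cannot have all its slopes bounded away from \<open>\<plusminus>1\<close> on longer and longer
  intervals unless they become almost constant on some of them; translating those to the origin
  produces the situation excluded by the previous lemma.\<close>

lemma almost_affine_block:
  fixes n :: nat
  assumes z: "z \<in> M" and n: "0 < n"
    and left: "- (1 - \<delta>) * l \<le> d z (\<sigma> l) - d z (\<sigma> 0)"
    and right: "d z (\<sigma> (of_nat (2 * n * n + 1) * l)) - d z (\<sigma> (of_nat (2 * n * n) * l)) \<le> (1 - \<delta>) * l"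
    and \<delta>: "0 < \<delta>"
  obtains w b where "w \<in> M" "\<bar>b\<bar> \<le> 1 - \<delta>"
    "\<And>s t. - (of_nat n - 1) * l \<le> s \<Longrightarrow> s < t \<Longrightarrow> t \<le> (of_nat n - 1) * l \<Longrightarrow>
       b \<le> (d w (\<sigma> t) - d w (\<sigma> s)) / (t - s) \<and> (d w (\<sigma> t) - d w (\<sigma> s)) / (t - s) \<le> b + 2 / n"
proof -
  define f where "f t = d z (\<sigma> t)" for t
  have conv: "convex_on UNIV f" unfolding f_def using axis_convex[OF z] .
  \<comment> \<open>\<open>p 0\<close> to \<open>p n\<close> start \<open>n + 1\<close> windows of
    length \<open>l\<close> at spacing \<open>2 * n * l\<close>, with slopes \<open>g j\<close>. The
    \<open>n\<close> increments of \<open>g\<close> add up to less than 2, so one of them is at most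
    \<open>2 / n\<close>.\<close>
  define p where "p j = of_nat (2 * n * j) * l" for j :: nat
  define g where "g j = (f (p j + l) - f (p j)) / l" for j
  have slope: "(f t - f s) / (t - s) \<le> (f t' - f s') / (t' - s')"
    if "s < t" "s' < t'" "s \<le> s'" "t \<le> t'" for s t s' t'
    using convex_slope_mono[OF conv that] .
  have g_mono: "g i \<le> g j" if "i \<le> j" for i j
    using slope[of "p i" "p i + l" "p j" "p j + l"] that l_pos by (simp add: g_def p_def mult_left_mono)
  have p: "p 0 = 0" "p n = of_nat (2 * n * n) * l" "p n + l = of_nat (2 * n * n + 1) * l"
    by (simp_all add: p_def algebra_simps)
  have "f (p n + l) = d z (\<sigma> (of_nat (2 * n * n + 1) * l))" by (simp only: p(3) f_def)
  moreover have "f (p n) = d z (\<sigma> (of_nat (2 * n * n) * l))" by (simp only: p(2) f_def)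
  ultimately have "f (p n + l) - f (p n) \<le> (1 - \<delta>) * l" using right by linarith
  then have g_n: "g n \<le> 1 - \<delta>" using l_pos unfolding g_def by (simp add: divide_le_eq)
  have g_0: "- (1 - \<delta>) \<le> g 0" using left l_pos unfolding g_def p(1) f_def by (simp add: le_divide_eq)
  have "\<exists>i<n. g (Suc i) - g i \<le> 2 / n"
  proof (rule ccontr)
    assume "\<not> ?thesis"
    then have "(\<Sum>i<n. 2 / n) < (\<Sum>i<n. g (Suc i) - g i)"
      using n by (intro sum_strict_mono) auto
    moreover have "(\<Sum>i<n. g (Suc i) - g i) = g n - g 0" by (rule sum_lessThan_telescope)
    ultimately show False using g_n g_0 n \<delta> by simp
  qed
  then obtain i where i: "i < n" "g (Suc i) - g i \<le> 2 / n" by blast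
  \<comment> \<open>The midpoint between \<open>p i\<close> and \<open>p (Suc i)\<close> in units of
    \<open>l\<close>. It is translated to 0; between the two windows all slopes lie between
    \<open>g i\<close> and \<open>g (Suc i)\<close>.\<close>
  define c :: int where "c = int (2 * n * i + n)"
  have pc: "p i = of_int c * l - n * l" "p (Suc i) = of_int c * l + n * l"
    by (simp_all add: p_def c_def algebra_simps)
  show ?thesis
  proof (rule that[of "T (- c) z" "g i"])
    show "T (- c) z \<in> M" using z T_mem by blast
    show "\<bar>g i\<bar> \<le> 1 - \<delta>" using g_mono[of 0 i] g_mono[of i n] g_n g_0 i by auto
    fix s t assume st: "- (of_nat n - 1) * l \<le> s" "s < t" "t \<le> (of_nat n - 1) * l"
    have st': "l - n * l \<le> s" "t \<le> n * l - l" using st by (simp_all add: algebra_simps)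
    have f: "d (T (- c) z) (\<sigma> t) = f (t + of_int c * l)" for t using dist_T[OF z] by (simp add: f_def)
    have "g i \<le> (f (t + of_int c * l) - f (s + of_int c * l)) / (t - s)"
      using slope[of "p i" "p i + l" "s + of_int c * l" "t + of_int c * l"] st st' l_pos pc
      by (simp add: g_def)
    moreover have "(f (t + of_int c * l) - f (s + of_int c * l)) / (t - s) \<le> g (Suc i)"
      using slope[of "s + of_int c * l" "t + of_int c * l" "p (Suc i)" "p (Suc i) + l"] st st' l_pos pc
      by (simp add: g_def)
    ultimately show "g i \<le> (d (T (- c) z) (\<sigma> t) - d (T (- c) z) (\<sigma> s)) / (t - s) \<and>
      (d (T (- c) z) (\<sigma> t) - d (T (- c) z) (\<sigma> s)) / (t - s) \<le> g i + 2 / n"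
      unfolding f using i(2) by linarith
  qed
qed

text \<open>By compactness: otherwise the failure at \<open>N = 2 * (n + 1)^2\<close> yields for
  every \<open>n\<close> an almost affine block on \<open>[- n * l, n * l]\<close>, and a
  subsequence with convergent slopes \<open>b\<close> is the situation excluded above.\<close>

lemma slope_transition_at_0:
  assumes \<delta>: "0 < \<delta>"
  shows "\<exists>N::nat. \<forall>z\<in>M. - (1 - \<delta>) * l \<le> d z (\<sigma> l) - d z (\<sigma> 0) \<longrightarrow>
    (1 - \<delta>) * l < d z (\<sigma> (of_nat (N + 1) * l)) - d z (\<sigma> (of_nat N * l))"
proof (rule ccontr)
  assume neg: "\<not> ?thesis"
  have "\<exists>w b. w \<in> M \<and> \<bar>b\<bar> \<le> 1 - \<delta> \<and> (\<forall>s t. - of_nat n * l \<le> s \<longrightarrow> s < t \<longrightarrow> t \<le> of_nat n * l \<longrightarrow>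
       b \<le> (d w (\<sigma> t) - d w (\<sigma> s)) / (t - s) \<and> (d w (\<sigma> t) - d w (\<sigma> s)) / (t - s) \<le> b + 2 / Suc n)" for n :: nat
  proof -
    obtain z where z: "z \<in> M" "- (1 - \<delta>) * l \<le> d z (\<sigma> l) - d z (\<sigma> 0)"
      "d z (\<sigma> (of_nat (2 * Suc n * Suc n + 1) * l)) - d z (\<sigma> (of_nat (2 * Suc n * Suc n) * l)) \<le> (1 - \<delta>) * l"
      using neg by (meson not_less)
    show ?thesis
      by (rule almost_affine_block[OF z(1) zero_less_Suc z(2,3) \<delta>]) (simp, blast)
  qed
  then obtain w b where w: "\<And>n. w n \<in> M" and b: "\<And>n. \<bar>b n\<bar> \<le> 1 - \<delta>"
    and sl: "\<And>n s t. - of_nat n * l \<le> s \<Longrightarrow> s < t \<Longrightarrow> t \<le> of_nat n * l \<Longrightarrow>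
       b n \<le> (d (w n) (\<sigma> t) - d (w n) (\<sigma> s)) / (t - s) \<and>
       (d (w n) (\<sigma> t) - d (w n) (\<sigma> s)) / (t - s) \<le> b n + 2 / Suc n"
    by metis
  have "b n \<in> {- (1 - \<delta>)..1 - \<delta>}" for n using b[of n] by (simp add: abs_le_iff)
  then obtain \<beta> r where \<beta>: "\<beta> \<in> {- (1 - \<delta>)..1 - \<delta>}" and r: "strict_mono r" and lim: "(b \<circ> r) \<longlonglongrightarrow> \<beta>"
    using compact_Icc[of "- (1 - \<delta>)" "1 - \<delta>"] unfolding compact_eq_seq_compact_metric seq_compact_def by blast
  have r_ge: "n \<le> r n" for n using r by (rule seq_suble)
  have big: "\<forall>\<^sub>F n in sequentially. K \<le> of_nat (r n) * l" for K
  proof -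
    have "\<forall>\<^sub>F n in sequentially. K / l \<le> real n"
      using filterlim_real_sequentially by (auto simp: filterlim_at_top)
    then show ?thesis
    proof eventually_elim
      case (elim n)
      then have "K / l \<le> real (r n)" using r_ge[of n] by linarith
      then show ?case using l_pos by (simp add: field_simps)
    qed
  qed
  have lim_upper: "(\<lambda>n. b (r n) + 2 / Suc (r n)) \<longlonglongrightarrow> \<beta>"
  proof -
    have "(\<lambda>n. 2 / real (Suc n)) \<longlonglongrightarrow> 0" by real_asymp
    then have "(\<lambda>n. 2 / real (Suc (r n))) \<longlonglongrightarrow> 0"
      using LIMSEQ_subseq_LIMSEQ[OF _ r] by (simp add: o_def)
    with lim show ?thesis using tendsto_add[of "\<lambda>n. b (r n)" \<beta>] by (force simp: o_def)
  qed
  have slope_lt: "(\<lambda>n. d (w (r n)) (\<sigma> t) - d (w (r n)) (\<sigma> s)) \<longlonglongrightarrow> \<beta> * (t - s)" if st: "s < t" for s t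
  proof -
    have ev: "\<forall>\<^sub>F n in sequentially. b (r n) \<le> (d (w (r n)) (\<sigma> t) - d (w (r n)) (\<sigma> s)) / (t - s) \<and>
       (d (w (r n)) (\<sigma> t) - d (w (r n)) (\<sigma> s)) / (t - s) \<le> b (r n) + 2 / Suc (r n)"
      using big[of "- s"] big[of t] by eventually_elim (use st sl in simp)
    have "(\<lambda>n. (d (w (r n)) (\<sigma> t) - d (w (r n)) (\<sigma> s)) / (t - s)) \<longlonglongrightarrow> \<beta>"
    proof (rule tendsto_sandwich)
      show "(\<lambda>n. b (r n)) \<longlonglongrightarrow> \<beta>" using lim by (simp add: o_def)
    qed (use ev lim_upper in \<open>auto elim: eventually_mono\<close>)
    then have "(\<lambda>n. (d (w (r n)) (\<sigma> t) - d (w (r n)) (\<sigma> s)) / (t - s) * (t - s)) \<longlonglongrightarrow> \<beta> * (t - s)"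
      by (intro tendsto_mult tendsto_const)
    then show ?thesis using st by simp
  qed
  \<comment> \<open>A point near \<open>\<sigma> 0\<close> would see slopes near 1 on a long piece
    of the axis. Quantitatively, the slope on \<open>[0, L]\<close> is at most
    \<open>1 - \<delta> + 2 / Suc (r n)\<close>, and the triangle inequality for
    \<open>\<sigma> 0\<close>, \<open>w (r n)\<close> and \<open>\<sigma> L\<close> gives
    \<open>\<delta> * L - 2 * l \<le> 2 * d (w (r n)) (\<sigma> 0)\<close>.\<close>
  have far0: "\<forall>\<^sub>F n in sequentially. K \<le> d (w (r n)) (\<sigma> 0)" for K
  proof -
    have "\<forall>\<^sub>F n in sequentially. 0 < r n"
      using eventually_gt_at_top[of 0]
    proof eventually_elim
      case (elim n)
      then show ?case using r_ge[of n] by linarith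
    qed
    then show ?thesis using big[of "(2 * K + 2 * l) / \<delta>"]
    proof eventually_elim
      case (elim n)
      define L where "L = of_nat (r n) * l"
      have L: "0 < L" "2 * K + 2 * l \<le> \<delta> * L" using elim l_pos \<delta> by (simp_all add: L_def field_simps)
      have "2 / Suc (r n) * L \<le> 2 * l" using l_pos by (simp add: L_def field_simps)
      moreover have "(d (w (r n)) (\<sigma> L) - d (w (r n)) (\<sigma> 0)) / (L - 0) \<le> b (r n) + 2 / Suc (r n)"
        using sl[of "r n" 0 L] L by (simp add: L_def)
      then have "d (w (r n)) (\<sigma> L) - d (w (r n)) (\<sigma> 0) \<le> b (r n) * L + 2 / Suc (r n) * L"
        using L(1) by (simp add: divide_le_eq distrib_right)
      moreover have "b (r n) * L \<le> (1 - \<delta>) * L" using b[of "r n"] L(1) by (intro mult_right_mono) auto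
      moreover have "L \<le> d (w (r n)) (\<sigma> 0) + d (w (r n)) (\<sigma> L)"
        using mdist_triangle[of "\<sigma> 0" m "w (r n)" "\<sigma> L"] w L(1) by (simp add: axis_dist mdist_commute)
      moreover have "(1 - \<delta>) * L = L - \<delta> * L" by (simp add: left_diff_distrib)
      ultimately show ?case using L(2) by linarith
    qed
  qed
  show False
  proof (rule asymptotically_affine_contradiction[of "\<lambda>n. w (r n)" \<beta>])
    show "\<bar>\<beta>\<bar> < 1" using \<beta> \<delta> by auto
    show "\<forall>\<^sub>F n in sequentially. K \<le> d (w (r n)) (\<sigma> t)" for K t
      using far0[of "K + \<bar>t\<bar>"]
    proof eventually_elim
      case (elim n)
      then show ?case using dist_axis_Lipschitz[OF w, of "r n" 0 t] by simp
    qed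
    show "(\<lambda>n. d (w (r n)) (\<sigma> s) - d (w (r n)) (\<sigma> t)) \<longlonglongrightarrow> \<beta> * (s - t)" for s t
    proof (cases s t rule: linorder_cases)
      case less
      then show ?thesis using tendsto_minus[OF slope_lt[OF less]] by (simp add: algebra_simps)
    qed (use slope_lt in simp_all)
  qed (use w in simp)
qed

lemma slope_transition:
  assumes \<delta>: "0 < \<delta>"
  obtains L where "0 < L"
    "\<And>z a b s t. z \<in> M \<Longrightarrow> a < b \<Longrightarrow> b + L \<le> s \<Longrightarrow> s < t \<Longrightarrow>
      - (1 - \<delta>) * (b - a) \<le> d z (\<sigma> b) - d z (\<sigma> a) \<Longrightarrow> (1 - \<delta>) * (t - s) < d z (\<sigma> t) - d z (\<sigma> s)"
proof -
  obtain N :: nat where N: "\<And>z. z \<in> M \<Longrightarrow> - (1 - \<delta>) * l \<le> d z (\<sigma> l) - d z (\<sigma> 0) \<Longrightarrow>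
    (1 - \<delta>) * l < d z (\<sigma> (of_nat (N + 1) * l)) - d z (\<sigma> (of_nat N * l))"
    using slope_transition_at_0[OF \<delta>] by blast
  \<comment> \<open>Of the \<open>N + 2\<close> periods one rounds \<open>b\<close> up to a multiple
    of \<open>l\<close>, \<open>N\<close> form the gap, and one is the window in which the slope is
    known to be large.\<close>
  have "(1 - \<delta>) * (t - s) < d z (\<sigma> t) - d z (\<sigma> s)"
    if z: "z \<in> M" and ab: "a < b" and bs: "b + (N + 2) * l \<le> s" and st: "s < t"
      and sl: "- (1 - \<delta>) * (b - a) \<le> d z (\<sigma> b) - d z (\<sigma> a)" for z a b s t
  proof -
    define f where "f t = d z (\<sigma> t)" for t
    have conv: "convex_on UNIV f" unfolding f_def using axis_convex[OF z] .
    define j where "j = \<lceil>b / l\<rceil>"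
    have "b / l \<le> of_int j" "of_int j < b / l + 1" unfolding j_def by linarith+
    then have j: "b \<le> of_int j * l" "of_int j * l < b + l"
      using l_pos by (simp_all add: field_simps)
    have f: "d (T (- j) z) (\<sigma> t) = f (t + of_int j * l)" for t using dist_T[OF z] by (simp add: f_def)
    have "- (1 - \<delta>) \<le> (f b - f a) / (b - a)" using sl ab by (simp add: le_divide_eq f_def)
    also have "\<dots> \<le> (f (l + of_int j * l) - f (of_int j * l)) / (l + of_int j * l - of_int j * l)"
      by (rule convex_slope_mono[OF conv]) (use ab j l_pos in linarith)+
    finally have "- (1 - \<delta>) * l \<le> d (T (- j) z) (\<sigma> l) - d (T (- j) z) (\<sigma> 0)"
      using l_pos by (simp add: f le_divide_eq)
    then have "(1 - \<delta>) * l < f (of_nat (N + 1) * l + of_int j * l) - f (of_nat N * l + of_int j * l)"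
      using N[OF T_mem[OF z], of "- j"] by (simp only: f)
    then have 1: "1 - \<delta> < (f (of_nat (N + 1) * l + of_int j * l) - f (of_nat N * l + of_int j * l)) / l"
      using l_pos by (simp add: less_divide_eq)
    have len: "(of_nat (N + 1) * l + of_int j * l) - (of_nat N * l + of_int j * l) = l"
      by (simp add: algebra_simps)
    have "(f (of_nat (N + 1) * l + of_int j * l) - f (of_nat N * l + of_int j * l))
        / ((of_nat (N + 1) * l + of_int j * l) - (of_nat N * l + of_int j * l)) \<le> (f t - f s) / (t - s)"
    proof (rule convex_slope_mono[OF conv])
      have "of_nat (N + 1) * l + of_int j * l \<le> s" using j bs by (simp add: algebra_simps)
      then show "of_nat N * l + of_int j * l \<le> s" "of_nat (N + 1) * l + of_int j * l \<le> t"
        using st l_pos by (simp_all add: algebra_simps)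
    qed (use l_pos st in \<open>simp_all add: algebra_simps\<close>)
    then have "1 - \<delta> < (f t - f s) / (t - s)" using 1 unfolding len by linarith
    then show ?thesis using st by (simp add: less_divide_eq f_def)
  qed
  moreover have "0 < (N + 2) * l" using l_pos by simp
  ultimately show ?thesis using that by blast
qed

end

section \<open>Dynamics of rank one isometries\<close>

context cat0
begin

lemma geo_end: "x \<in> M \<Longrightarrow> y \<in> M \<Longrightarrow> geo x y (d x y) = y"
  using geodesic_segment_geo[of x y] by (simp add: geodesic_segment_def)

text \<open>A point within \<open>Y\<close> of a far point of the ray is seen from the origin close
  to the ray: for fixed \<open>R\<close> and \<open>Y\<close> the bound tends to 0 as
  \<open>u\<close> grows. Its factor 2 is that of \<open>geo_lipschitz\<close>.\<close>

lemma geo_near_ray: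
  assumes \<tau>: "geodesic_ray m \<tau>" and z: "z \<in> M" and Y: "d (\<tau> u) z \<le> Y" and R: "0 \<le> R" "R \<le> u - Y" "0 < u - Y"
  shows "d (geo (\<tau> 0) z R) (\<tau> R) \<le> R / (u - Y) * (2 * Y)" "u - Y \<le> d (\<tau> 0) z"
proof -
  have "0 \<le> Y" using Y mdist_nonneg[of m "\<tau> u" z] by linarith
  then have u: "0 \<le> u" "u - Y \<le> u" using R by linarith+
  then have M: "\<tau> 0 \<in> M" "\<tau> u \<in> M" "d (\<tau> 0) (\<tau> u) = u" using \<tau> by (auto simp: ray_mem ray_dist)
  have "d (\<tau> 0) (\<tau> u) \<le> d (\<tau> 0) z + d z (\<tau> u)" using M z by (intro mdist_triangle) auto
  then show far: "u - Y \<le> d (\<tau> 0) z" using Y M by (simp add: mdist_commute)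
  have "d (geo (\<tau> 0) z R) (\<tau> R) = d (geo (\<tau> 0) z R) (geo (\<tau> 0) (\<tau> u) R)"
    using ray_geo[OF \<tau>, of R u] R u by simp
  also have "\<dots> \<le> R / (u - Y) * d (geo (\<tau> 0) z (u - Y)) (geo (\<tau> 0) (\<tau> u) (u - Y))"
    using M z R far u by (intro geo_contract) auto
  also have "\<dots> \<le> R / (u - Y) * (2 * d z (\<tau> u))"
    using M z R far u by (intro mult_left_mono geo_lipschitz) auto
  also have "\<dots> \<le> R / (u - Y) * (2 * Y)"
    using Y R by (intro mult_left_mono) (auto simp: mdist_commute)
  finally show "d (geo (\<tau> 0) z R) (\<tau> R) \<le> R / (u - Y) * (2 * Y)" .
qed

end

text \<open>The ray \<open>\<tau>\<close> from \<open>\<sigma> 0\<close> to the moved end diverges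
  from \<open>\<sigma>\<close>. If both \<open>w\<close> and \<open>k w\<close> were seen near
  \<open>\<sigma>\<close> at radius \<open>R\<close>, the chain \<open>\<tau> R\<close>,
  \<open>k (\<sigma> R)\<close>, \<open>k\<close> of the geodesic to \<open>w\<close>, the geodesic
  to \<open>k w\<close>, \<open>\<sigma> R\<close> would have length less than
  \<open>2 + 2 * D\<close>: two tolerances and two displacements of the origin.\<close>

lemma (in proper_cat0) moved_end_separates:
  assumes \<sigma>: "geodesic_ray m \<sigma>" and k: "k \<in> carrier (isometry_group m)"
    and ne: "boundary_map m k (cls \<sigma>) \<noteq> cls \<sigma>"
  shows "\<exists>R1>0. \<forall>R\<ge>R1. \<forall>w\<in>M. R \<le> d (\<sigma> 0) w \<longrightarrow> R \<le> d (\<sigma> 0) (k w) \<longrightarrow>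
    d (geo (\<sigma> 0) w R) (\<sigma> R) < 1 \<longrightarrow> 1 \<le> d (geo (\<sigma> 0) (k w) R) (\<sigma> R)"
proof -
  have M: "\<sigma> t \<in> M" "k (\<sigma> t) \<in> M" if "0 \<le> t" for t using ray_mem[OF \<sigma> that] isometry_mem[OF k] by auto
  obtain \<tau> where \<tau>: "geodesic_ray m \<tau>" "\<tau> 0 = \<sigma> 0" "(k \<circ> \<sigma>, \<tau>) \<in> asymptotic m"
    using asymptotic_ray_ex[OF isometry_ray[OF k \<sigma>], of "\<sigma> 0"] M by auto
  define D where "D = d (k (\<sigma> 0)) (\<sigma> 0)"
  have "cls \<tau> \<noteq> cls \<sigma>"
    using ne cls_eqI[OF \<tau>(3)] boundary_map_cls[OF k \<sigma>] by simp
  then have "\<not> (\<forall>t\<ge>0. d (\<tau> t) (\<sigma> t) \<le> 2 + 2 * D)"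
    using asymptoticI[OF \<tau>(1) \<sigma>] cls_eqI by blast
  then obtain R1 where R1: "0 \<le> R1" "2 + 2 * D < d (\<tau> R1) (\<sigma> R1)" by auto
  have "0 \<le> D" by (simp add: D_def)
  then have "R1 \<noteq> 0" using R1(2) \<tau>(2) M(1)[of 0] by auto
  with R1(1) have "0 < R1" by simp
  moreover have "1 \<le> d (geo (\<sigma> 0) (k w) R) (\<sigma> R)"
    if R: "R1 \<le> R" and w: "w \<in> M" and far: "R \<le> d (\<sigma> 0) w" "R \<le> d (\<sigma> 0) (k w)" and near: "d (geo (\<sigma> 0) w R) (\<sigma> R) < 1" for R w
  proof (rule ccontr)
    assume "\<not> ?thesis"
    then have near': "d (geo (\<sigma> 0) (k w) R) (\<sigma> R) < 1" by simp
    have R0: "0 < R" using R \<open>0 < R1\<close> by simp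
    have kw: "k w \<in> M" "d (k (\<sigma> 0)) (k w) = d (\<sigma> 0) w"
      using isometry_mem[OF k w] isometry_dist[OF k M(1)[of 0] w] by auto
    have g: "geo (\<sigma> 0) w R \<in> M" "geo (\<sigma> 0) (k w) R \<in> M" "geo (k (\<sigma> 0)) (k w) R \<in> M" "\<tau> R \<in> M"
      using R0 far kw w M[of 0] ray_mem[OF \<tau>(1), of R] by (auto intro!: geo_mem)
    have "geo (k (\<sigma> 0)) (k w) R = k (geo (\<sigma> 0) w R)"
      using isometry_geo[OF k M(1)[of 0] w] R0 far by simp
    then have 1: "d (geo (k (\<sigma> 0)) (k w) R) (k (\<sigma> R)) < 1"
      using near isometry_dist[OF k g(1) M(1)[of R]] R0 by simp
    have 2: "d (geo (\<sigma> 0) (k w) R) (geo (k (\<sigma> 0)) (k w) R) \<le> D"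
      using geo_base_change[of "\<sigma> 0" "k (\<sigma> 0)" "k w" R] M[of 0] kw R0 far
      by (simp add: D_def mdist_commute)
    have 3: "d (k (\<sigma> R)) (\<tau> R) \<le> D"
      using asymptotic_dist[OF \<tau>(3), of R] R0 \<tau>(2) by (simp add: D_def)
    have "d (\<tau> R1) (\<sigma> R1) \<le> R1 / R * d (\<tau> R) (\<sigma> R)"
      using R R0 \<open>0 < R1\<close> \<tau> \<sigma> by (intro ray_contract) auto
    also have "\<dots> \<le> 1 * d (\<tau> R) (\<sigma> R)"
      using R R0 by (intro mult_right_mono) auto
    finally have 4: "2 + 2 * D < d (\<tau> R) (\<sigma> R)" using R1(2) by simp
    have "d (\<tau> R) (\<sigma> R) \<le> d (\<tau> R) (k (\<sigma> R)) + d (k (\<sigma> R)) (\<sigma> R)"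
      using M[of R] R0 g by (intro mdist_triangle) auto
    moreover have "d (k (\<sigma> R)) (\<sigma> R) \<le> d (k (\<sigma> R)) (geo (k (\<sigma> 0)) (k w) R) + d (geo (k (\<sigma> 0)) (k w) R) (\<sigma> R)"
      using M[of R] R0 g by (intro mdist_triangle) auto
    moreover have "d (geo (k (\<sigma> 0)) (k w) R) (\<sigma> R)
        \<le> d (geo (k (\<sigma> 0)) (k w) R) (geo (\<sigma> 0) (k w) R) + d (geo (\<sigma> 0) (k w) R) (\<sigma> R)"
      using M[of R] R0 g by (intro mdist_triangle) auto
    ultimately show False
      using 1 2 3 4 near' mdist_commute[of m "\<tau> R" "k (\<sigma> R)"]
        mdist_commute[of m "k (\<sigma> R)" "geo (k (\<sigma> 0)) (k w) R"]
        mdist_commute[of m "geo (\<sigma> 0) (k w) R" "geo (k (\<sigma> 0)) (k w) R"] by linarith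
  qed
  ultimately show ?thesis by blast
qed

context rank_one_axis
begin

lemma axis_ray: "geodesic_ray m \<sigma>" "geodesic_ray m (\<lambda>t. \<sigma> (- t))"
  by (auto simp: geodesic_ray_def axis_dist)

text \<open>\<open>geo_CN\<close> with both lengths equal to \<open>R\<close> bounds 1 by
  \<open>2 * R\<close> times the amount by which \<open>d z (\<sigma> s) - d z (\<sigma> 0)\<close>
  exceeds \<open>- R\<close>.\<close>

lemma away_slope:
  assumes z: "z \<in> M" and R: "0 < R" "R \<le> d (\<sigma> 0) z" "\<bar>s\<bar> = R" and away: "1 \<le> d (geo (\<sigma> 0) z R) (\<sigma> s)"
  shows "- (1 - 1 / (2 * R\<^sup>2)) * R \<le> d z (\<sigma> s) - d z (\<sigma> 0)"
proof -
  have "1\<^sup>2 \<le> (d (geo (\<sigma> 0) z R) (\<sigma> s))\<^sup>2" using away by (intro power_mono) auto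
  also have "\<dots> \<le> (d (\<sigma> 0) (\<sigma> s))\<^sup>2 + R\<^sup>2 + 2 * R * (d (\<sigma> s) z - d (\<sigma> 0) z)"
    using z R by (intro geo_CN) auto
  also have "\<dots> = 2 * R * (R + (d z (\<sigma> s) - d z (\<sigma> 0)))"
    using R by (simp add: axis_dist mdist_commute power2_eq_square algebra_simps)
  finally have "1 / (2 * R) \<le> R + (d z (\<sigma> s) - d z (\<sigma> 0))" using R by (simp add: field_simps)
  moreover have "(1 - 1 / (2 * R\<^sup>2)) * R = R - 1 / (2 * R)" using R by (simp add: field_simps power2_eq_square)
  ultimately show ?thesis by linarith
qed

text \<open>Let \<open>z\<close> be far out on the ray from \<open>\<sigma> 0\<close> to
  \<open>\<eta>\<close>. As \<open>\<eta>\<close> is away from the repelling end, the slope of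
  \<open>d z\<close> on \<open>[- R, 0]\<close> is at most \<open>1 - \<delta>\<close>; by
  \<open>slope_transition\<close> the slope at distance \<open>L\<close> further back is already
  below \<open>- (1 - \<delta>)\<close>. The power of \<open>T\<close> shifts that stretch to
  \<open>[0, R']\<close>, where \<open>geo_CN\<close> turns it into closeness to
  \<open>\<sigma> R'\<close>.\<close>

lemma north_south:
  assumes R: "0 < R" "0 < R'"
  obtains N :: nat where "\<And>n \<eta>. N \<le> n \<Longrightarrow> \<eta> \<in> boundary m \<Longrightarrow> \<eta> \<notin> end_nbhd (\<lambda>t. \<sigma> (- t)) R \<Longrightarrow>
    boundary_map m (T (int n)) \<eta> \<in> end_nbhd \<sigma> R'"
proof -
  \<comment> \<open>The first bound is the slope gap supplied by \<open>away_slope\<close>; the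
    second makes \<open>sqrt (2 * \<delta>) * R'\<close> at most 1/2.\<close>
  define \<delta> where "\<delta> = min (1 / (2 * R\<^sup>2)) (1 / (8 * R'\<^sup>2))"
  have \<delta>: "0 < \<delta>" "\<delta> \<le> 1 / (2 * R\<^sup>2)" "\<delta> \<le> 1 / (8 * R'\<^sup>2)" using R by (auto simp: \<delta>_def)
  have \<delta>': "2 * R'\<^sup>2 * \<delta> \<le> (1 / 2)\<^sup>2" using \<delta>(3) R by (simp add: field_simps)
  obtain L where L: "0 < L" "\<And>z a b s t. z \<in> M \<Longrightarrow> a < b \<Longrightarrow> b + L \<le> s \<Longrightarrow> s < t \<Longrightarrow>
      - (1 - \<delta>) * (b - a) \<le> d z (\<sigma> b) - d z (\<sigma> a) \<Longrightarrow> (1 - \<delta>) * (t - s) < d z (\<sigma> t) - d z (\<sigma> s)"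
    using slope_transition[OF \<delta>(1)] by metis
  have "boundary_map m (T (int n)) \<eta> \<in> end_nbhd \<sigma> R'"
    if n: "nat \<lceil>(R + L + R') / l\<rceil> \<le> n" and \<eta>: "\<eta> \<in> boundary m" and out: "\<eta> \<notin> end_nbhd (\<lambda>t. \<sigma> (- t)) R" for n \<eta>
  proof -
    define D where "D = of_nat n * l"
    have "(R + L + R') / l \<le> of_nat n" using n by linarith
    then have D: "R + L + R' \<le> D" using l_pos by (simp add: D_def field_simps)
    then have D0: "0 \<le> D" using R L by linarith
    obtain \<tau> where \<tau>: "\<tau> \<in> \<eta>" "\<tau> 0 = \<sigma> 0" "geodesic_ray m \<tau>" "\<eta> = cls \<tau>"
      using boundary_ray_from[OF \<eta>, of "\<sigma> 0"] by auto
    have away: "1 \<le> d (\<tau> R) (\<sigma> (- R))"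
      using out \<eta> \<tau> by (force simp: end_nbhd_def)
    have \<eta>': "boundary_map m (T (int n)) \<eta> \<in> boundary m" using boundary_map_mem[OF T_isometry \<eta>] .
    then obtain \<tau>' where \<tau>': "\<tau>' \<in> boundary_map m (T (int n)) \<eta>" "\<tau>' 0 = \<sigma> 0" "geodesic_ray m \<tau>'"
      using boundary_ray_from[OF \<eta>', of "\<sigma> 0"] by auto
    have as: "(\<tau>', T (int n) \<circ> \<tau>) \<in> asymptotic m"
      using boundary_asymptotic[OF \<eta>' \<tau>'(1) mem_boundary_map[OF T_isometry \<eta> \<tau>(1)]] .
    \<comment> \<open>The power of \<open>T\<close> moves the origin of the ray by \<open>D\<close>;
      going \<open>r\<close> beyond \<open>D\<close> leaves an error of at most 1/4 at
      \<open>R'\<close>.\<close>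
    define r where "r = R + R' + 8 * R' * D"
    define u where "u = r + D"
    have "0 \<le> 8 * R' * D" using R D0 by simp
    then have r: "0 < r" "R' \<le> r" "R \<le> r" "8 * R' * D \<le> r" using R unfolding r_def by linarith+
    then have u: "R \<le> u" "0 \<le> u" "u - D = r" using R D0 by (auto simp: u_def)
    define z where "z = \<tau> u"
    define w where "w = T (int n) z"
    have z: "z \<in> M" "w \<in> M" "d (\<sigma> 0) z = u"
      using \<tau>(3) u ray_mem T_mem ray_dist[OF \<tau>(3), of 0 u] \<tau>(2) by (auto simp: z_def w_def)
    have "geo (\<sigma> 0) z R = \<tau> R" using ray_geo[OF \<tau>(3), of R u] R u \<tau>(2) by (simp add: z_def)
    then have "- (1 - 1 / (2 * R\<^sup>2)) * R \<le> d z (\<sigma> (- R)) - d z (\<sigma> 0)"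
      using away_slope[OF z(1) R(1), of "- R"] away R z u by simp
    moreover have "(1 - 1 / (2 * R\<^sup>2)) * R \<le> (1 - \<delta>) * R" using \<delta> R by (intro mult_right_mono) auto
    ultimately have incr: "d z (\<sigma> 0) - d z (\<sigma> (- R)) \<le> (1 - \<delta>) * R" by linarith
    have "\<not> - (1 - \<delta>) * ((R' - D) - (- D)) \<le> d z (\<sigma> (R' - D)) - d z (\<sigma> (- D))"
      using L(2)[OF z(1), of "- D" "R' - D" "- R" 0] R D incr by auto
    then have drop: "d z (\<sigma> (R' - D)) - d z (\<sigma> (- D)) \<le> - (1 - \<delta>) * R'" by simp
    have fw: "d w (\<sigma> t) = d z (\<sigma> (t - D))" for t using dist_T[OF z(1), of "int n" t] by (simp add: w_def D_def)
    have close: "d (\<tau>' u) w \<le> D"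
      using asymptotic_dist[OF as u(2)] \<tau>' \<tau> by (simp add: w_def z_def T_axis axis_dist D0 D_def[symmetric])
    have "R' / (u - D) * (2 * D) \<le> 1 / 4"
      unfolding u(3) using r R by (simp add: field_simps)
    moreover have "0 \<le> R'" "R' \<le> u - D" "0 < u - D" using r R u by auto
    note near = geo_near_ray[OF \<tau>'(3) z(2) close this]
    ultimately have 1: "d (geo (\<sigma> 0) w R') (\<tau>' R') \<le> 1 / 4" and far: "r \<le> d (\<sigma> 0) w"
      using near unfolding \<tau>'(2) u(3) by linarith+
    have R'w: "R' \<le> d (\<sigma> 0) w" using far r by linarith
    have "(d (geo (\<sigma> 0) w R') (\<sigma> R'))\<^sup>2 \<le> (d (\<sigma> 0) (\<sigma> R'))\<^sup>2 + R'\<^sup>2 + 2 * R' * (d (\<sigma> R') w - d (\<sigma> 0) w)"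
      using z R R'w by (intro geo_CN) auto
    also have "2 * R' * (d (\<sigma> R') w - d (\<sigma> 0) w) \<le> 2 * R' * (- (1 - \<delta>) * R')"
      using drop fw[of R'] fw[of 0] R mdist_commute[of m w] by (intro mult_left_mono) auto
    finally have "(d (geo (\<sigma> 0) w R') (\<sigma> R'))\<^sup>2 \<le> 2 * R'\<^sup>2 * \<delta>"
      by (simp add: axis_dist power2_eq_square algebra_simps)
    also note \<delta>'
    finally have 2: "d (geo (\<sigma> 0) w R') (\<sigma> R') \<le> 1 / 2" by (rule power2_le_imp_le) simp
    have "d (\<tau>' R') (\<sigma> R') \<le> d (\<tau>' R') (geo (\<sigma> 0) w R') + d (geo (\<sigma> 0) w R') (\<sigma> R')"
      using z R R'w ray_mem[OF \<tau>'(3), of R'] by (intro mdist_triangle geo_mem) auto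
    then have "d (\<tau>' R') (\<sigma> R') < 1"
      using 1 2 mdist_commute[of m "\<tau>' R'" "geo (\<sigma> 0) w R'"] by linarith
    then show ?thesis using \<eta>' \<tau>' by (auto simp: end_nbhd_def)
  qed
  then show ?thesis using that by blast
qed

text \<open>If \<open>y\<close> is not near the end of the axis, then seen from \<open>y\<close> the axis runs almost straight away
  behind \<open>\<sigma> 0\<close>: the angle at \<open>\<sigma> 0\<close> is almost \<open>\<pi>\<close>.\<close>

lemma axis_end_behind:
  assumes pos: "0 < Rw" "0 < R0" "0 \<le> e0"
  obtains r0 where "0 < r0"
    "\<And>y c \<rho> \<tau>. y \<in> M \<Longrightarrow> c \<in> M \<Longrightarrow> geodesic_ray m \<rho> \<Longrightarrow> \<rho> 0 = y \<Longrightarrow> d (\<sigma> 0) c \<le> e0 \<Longrightarrow>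
      r0 \<le> d y c \<Longrightarrow> d (geo y c r0) (\<rho> r0) \<le> 2 \<Longrightarrow>
      Rw \<le> d (\<sigma> 0) y \<Longrightarrow> 1 \<le> d (geo (\<sigma> 0) y Rw) (\<sigma> Rw) \<Longrightarrow>
      \<tau> 0 = y \<Longrightarrow> (\<sigma>, \<tau>) \<in> asymptotic m \<Longrightarrow> d (\<tau> R0) (\<rho> R0) < 1"
proof -
  \<comment> \<open>The first bound is the slope gap of \<open>away_slope\<close>, the second gives
    \<open>q * R0 \<le> 1/2\<close> for the relative error \<open>q\<close> found in
    \<open>key\<close>, and the third keeps \<open>1 - \<delta>\<close> positive.\<close>
  define \<delta> where "\<delta> = min (1 / (2 * Rw\<^sup>2)) (min (1 / (64 * R0\<^sup>2)) (1 / 2))"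
  have \<delta>: "0 < \<delta>" "\<delta> \<le> 1 / (2 * Rw\<^sup>2)" "\<delta> \<le> 1 / (64 * R0\<^sup>2)" "\<delta> \<le> 1 / 2" using pos by (auto simp: \<delta>_def)
  obtain L where L: "0 < L" "\<And>z a b s t. z \<in> M \<Longrightarrow> a < b \<Longrightarrow> b + L \<le> s \<Longrightarrow> s < t \<Longrightarrow>
      - (1 - \<delta>) * (b - a) \<le> d z (\<sigma> b) - d z (\<sigma> a) \<Longrightarrow> (1 - \<delta>) * (t - s) < d z (\<sigma> t) - d z (\<sigma> s)"
    using slope_transition[OF \<delta>(1)] by metis
  define q where "q = sqrt (8 * \<delta>)"
  have q: "0 \<le> q" "q\<^sup>2 = 8 * \<delta>" using \<delta> by (auto simp: q_def)
  have "(q * R0)\<^sup>2 \<le> (1 / 2)\<^sup>2"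
    using \<delta>(3) pos by (simp add: power_mult_distrib q(2) field_simps)
  then have qR0: "q * R0 \<le> 1 / 2" by (rule power2_le_imp_le) simp
  define t0 where "t0 = Rw + L"
  define e where "e = e0 + t0"
  \<comment> \<open>Directions are compared at radius \<open>R\<close> with error
    \<open>q * R + 2 * e + 2\<close> and then contracted to \<open>R0\<close>; the last summand
    makes the share of \<open>2 * e + 2\<close> at most 1/4.\<close>
  define R where "R = R0 + 1 + 8 * (e + 1) * R0"
  define r0 where "r0 = e + R"
  have t0: "0 < t0" using pos L by (simp add: t0_def)
  have e: "0 < e" using t0 pos by (simp add: e_def)
  then have eR: "0 \<le> 8 * (e + 1) * R0" using pos by simp
  have R: "R0 \<le> R" "1 \<le> R" "8 * (e + 1) * R0 \<le> R" "0 < R" using eR pos by (simp_all add: R_def)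
  have r0: "R \<le> r0" "0 < r0" "r0 - e = R" using e R by (simp_all add: r0_def)
  have "d (\<tau> R0) (\<rho> R0) < 1"
    if y: "y \<in> M" and c: "c \<in> M" and \<rho>: "geodesic_ray m \<rho>" "\<rho> 0 = y" and ec: "d (\<sigma> 0) c \<le> e0"
      and far: "r0 \<le> d y c" and near: "d (geo y c r0) (\<rho> r0) \<le> 2"
      and out: "Rw \<le> d (\<sigma> 0) y" "1 \<le> d (geo (\<sigma> 0) y Rw) (\<sigma> Rw)"
      and \<tau>: "\<tau> 0 = y" "(\<sigma>, \<tau>) \<in> asymptotic m" for y c \<rho> \<tau>
  proof -
    have \<tau>ray: "geodesic_ray m \<tau>" using \<tau> by (auto simp: asymptotic_def)
    define f where "f t = d y (\<sigma> t)" for t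
    have "- (1 - 1 / (2 * Rw\<^sup>2)) * Rw \<le> f Rw - f 0"
      unfolding f_def using away_slope[OF y pos(1) out(1)] pos out by simp
    moreover have "(1 - 1 / (2 * Rw\<^sup>2)) * Rw \<le> (1 - \<delta>) * Rw" using \<delta> pos by (intro mult_right_mono) auto
    ultimately have "- (1 - \<delta>) * Rw \<le> f Rw - f 0" by linarith
    then have "- (1 - \<delta>) * (Rw - 0) \<le> f Rw - f 0" by (simp only: diff_zero)
    then have slope: "(1 - \<delta>) * (t - s) < f t - f s" if "t0 \<le> s" "s < t" for s t
      using L(2)[OF y pos(1), of s t] that by (simp add: f_def t0_def)
    define D where "D = f t0"
    have "d (\<sigma> t0) c \<le> d (\<sigma> t0) (\<sigma> 0) + d (\<sigma> 0) c" using c by (intro mdist_triangle) auto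
    then have ce: "d (\<sigma> t0) c \<le> e" using ec t0 by (simp add: e_def axis_dist)
    have "d y c \<le> d y (\<sigma> t0) + d (\<sigma> t0) c" using c y by (intro mdist_triangle) auto
    then have D: "R \<le> D" using far ce r0 by (simp add: D_def f_def)
    then have D1: "1 \<le> D" using R by linarith
    have key: "d (geo y (\<sigma> (t0 + s)) D) (\<sigma> t0) \<le> q * D" "D \<le> f (t0 + s)" if s: "1 \<le> s" for s
    proof -
      define F where "F = f (t0 + s)"
      have F0: "0 \<le> F" by (simp add: F_def f_def)
      have "(1 - \<delta>) * s < F - D" using slope[of t0 "t0 + s"] s by (simp add: F_def D_def)
      moreover have "0 \<le> (1 - \<delta>) * s" using s \<delta> by simp
      ultimately show DF: "D \<le> f (t0 + s)" unfolding F_def by linarith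
      \<comment> \<open>The slope bound alone would leave a defect \<open>D + s - F\<close> of order
        \<open>\<delta> * s\<close>. By CN the square of \<open>f t\<close> minus the square of
        \<open>t\<close> is convex, so the unit step after \<open>t0\<close> controls the whole step
        and bounds the defect by \<open>4 * \<delta> * D\<close>, uniformly in
        \<open>s\<close>.\<close>
      have "D + (1 - \<delta>) \<le> f (t0 + 1)" using slope[of t0 "t0 + 1"] by (simp add: D_def)
      then have "(D + (1 - \<delta>))\<^sup>2 \<le> (f (t0 + 1))\<^sup>2" using D1 \<delta> by (intro power_mono) auto
      also have "(f (t0 + 1))\<^sup>2 \<le> (1 - 1 / s) * D\<^sup>2 + 1 / s * F\<^sup>2 - 1 / s * (1 - 1 / s) * s\<^sup>2"
      proof -
        have eq: "(1 - 1 / s) * t0 + 1 / s * (t0 + s) = t0 + 1" using s by (simp add: field_simps)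
        show ?thesis
          using line_CN[OF line, of "1 / s" y t0 "t0 + s"] s y unfolding eq by (simp add: f_def D_def F_def)
      qed
      finally have "s * (D + (1 - \<delta>))\<^sup>2 \<le> s * ((1 - 1 / s) * D\<^sup>2 + 1 / s * F\<^sup>2 - 1 / s * (1 - 1 / s) * s\<^sup>2)"
        using s by (intro mult_left_mono) auto
      also have "\<dots> = (s - 1) * D\<^sup>2 + F\<^sup>2 - (s - 1) * s"
        using s by (simp add: field_simps power2_eq_square)
      finally have "D\<^sup>2 + s\<^sup>2 + 2 * D * s * (1 - \<delta>) - s * (2 * \<delta>) + s * \<delta>\<^sup>2 \<le> F\<^sup>2"
        by (simp add: power2_eq_square algebra_simps)
      moreover have "0 \<le> s * \<delta>\<^sup>2" using s by simp
      moreover have "s * (2 * \<delta>) * 1 \<le> s * (2 * \<delta>) * D" using s \<delta> D1 by (intro mult_left_mono) auto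
      ultimately have "(D + s - F) * (D + s + F) \<le> 4 * \<delta> * D * s"
        by (simp add: power2_eq_square algebra_simps)
      moreover have FDs: "F \<le> D + s"
        using dist_axis_Lipschitz[OF y, of "t0 + s" t0] s by (simp add: F_def D_def f_def)
      then have "(D + s - F) * s \<le> (D + s - F) * (D + s + F)"
        using D1 F0 by (intro mult_left_mono) auto
      ultimately have "(D + s - F) * s \<le> (4 * \<delta> * D) * s" by linarith
      then have G: "D + s - F \<le> 4 * \<delta> * D" using s by simp
      have "(d (geo y (\<sigma> (t0 + s)) D) (\<sigma> t0))\<^sup>2
          \<le> (d y (\<sigma> t0))\<^sup>2 + D\<^sup>2 + 2 * D * (d (\<sigma> t0) (\<sigma> (t0 + s)) - d y (\<sigma> (t0 + s)))"
        using y D1 DF by (intro geo_CN) (auto simp: f_def)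
      also have "\<dots> = 2 * D * (D + s - F)"
        using s by (simp add: axis_dist D_def F_def f_def power2_eq_square algebra_simps)
      also have "\<dots> \<le> 2 * D * (4 * \<delta> * D)" using G D1 by (intro mult_left_mono) auto
      also have "\<dots> = (q * D)\<^sup>2" unfolding power_mult_distrib q(2) by (simp add: power2_eq_square)
      finally show "d (geo y (\<sigma> (t0 + s)) D) (\<sigma> t0) \<le> q * D"
        by (rule power2_le_imp_le) (use q D1 in auto)
    qed
    define Y where "Y = d y (\<sigma> 0)"
    \<comment> \<open>So far out that \<open>\<tau>\<close> and the geodesic from \<open>y\<close>
      to \<open>\<sigma> u\<close> differ by at most 1/8 at \<open>R0\<close>. The errors 1/8, 1/2
      and 1/4 together stay below 1.\<close>
    define u where "u = t0 + 1 + Y + R0 + 16 * R0 * Y"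
    have Y0: "0 \<le> Y" by (simp add: Y_def)
    then have RY: "0 \<le> 16 * R0 * Y" using pos by simp
    define s where "s = u - t0"
    define z where "z = \<sigma> u"
    have u: "0 \<le> u" "1 \<le> s" "u = t0 + s" "R0 \<le> u - Y" "16 * R0 * Y \<le> u - Y" "0 < u - Y"
      using Y0 RY pos t0 unfolding u_def s_def by linarith+
    have zM: "z \<in> M" "Y = d (\<sigma> 0) y" by (simp_all add: z_def Y_def mdist_commute)
    have "d (\<tau> u) z \<le> Y"
      using asymptotic_dist[OF \<tau>(2) u(1)] \<tau>(1) by (simp add: z_def Y_def mdist_commute)
    then have "d (geo (\<tau> 0) z R0) (\<tau> R0) \<le> R0 / (u - Y) * (2 * Y)"
      using zM u pos by (intro geo_near_ray[OF \<tau>ray]) auto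
    also have "\<dots> \<le> 1 / 8" using u by (simp add: field_simps)
    finally have n1: "d (geo y z R0) (\<tau> R0) \<le> 1 / 8" by (simp add: \<tau>)
    have Dz: "D \<le> d y z" and kz: "d (geo y z D) (\<sigma> t0) \<le> q * D"
      using key[OF u(2)] u(3) by (simp_all add: z_def f_def)
    have ot: "d y (\<sigma> t0) = D" "geo y (\<sigma> t0) D = \<sigma> t0" using geo_end[OF y, of "\<sigma> t0"] by (simp_all add: D_def f_def)
    have "d (geo y z R) (geo y (\<sigma> t0) R) \<le> R / D * d (geo y z D) (geo y (\<sigma> t0) D)"
      using y zM R D D1 Dz ot by (intro geo_contract) auto
    also have "\<dots> \<le> R / D * (q * D)"
      unfolding ot(2) using kz R D1 by (intro mult_left_mono) auto
    also have "\<dots> = q * R" using D1 by simp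
    finally have a1: "d (geo y z R) (geo y (\<sigma> t0) R) \<le> q * R" .
    have Rc: "R \<le> d y c" using far r0 by linarith
    have "d (geo y (\<sigma> t0) R) (geo y c R) \<le> 2 * d (\<sigma> t0) c"
      using y c R D ot Rc by (intro geo_lipschitz) auto
    then have a2: "d (geo y (\<sigma> t0) R) (geo y c R) \<le> 2 * e" using ce by linarith
    have \<rho>M: "\<rho> t \<in> M" "d y (\<rho> t) = t" if "0 \<le> t" for t
      using that \<rho> ray_mem ray_dist[OF \<rho>(1), of 0 t] by auto
    have rg: "geo y (\<rho> t) s = \<rho> s" if "0 \<le> s" "s \<le> t" for s t
      using ray_geo[OF \<rho>(1) that] \<rho>(2) by simp
    have "d (geo y c R) (geo y (\<rho> r0) R) \<le> R / r0 * d (geo y c r0) (geo y (\<rho> r0) r0)"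
      using y c R r0 far \<rho>M[of r0] by (intro geo_contract) auto
    also have "\<dots> \<le> 1 * 2"
      using near rg[of r0 r0] R r0 by (intro mult_mono) auto
    finally have a3: "d (geo y c R) (\<rho> R) \<le> 2" using rg[of R r0] R r0 by simp
    have mem: "geo y z R \<in> M" "geo y (\<sigma> t0) R \<in> M" "geo y c R \<in> M" "\<rho> R \<in> M" "geo y z R0 \<in> M" "\<tau> R0 \<in> M" "\<rho> R0 \<in> M"
      using y zM c R D Dz ot Rc \<rho>M pos ray_mem[OF \<tau>ray] by (auto intro!: geo_mem)
    have "d (geo y z R) (\<rho> R) \<le> q * R + 2 * e + 2"
      using a1 a2 a3 mdist_triangle[OF mem(1,2,4)] mdist_triangle[OF mem(2,3,4)] by linarith
    then have "R0 / R * d (geo y z R) (geo y (\<rho> R) R) \<le> R0 / R * (q * R + 2 * e + 2)"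
      using rg[of R R] R pos by (intro mult_left_mono) auto
    moreover have "d (geo y z R0) (geo y (\<rho> R) R0) \<le> R0 / R * d (geo y z R) (geo y (\<rho> R) R)"
      using y zM R D Dz pos \<rho>M[of R] by (intro geo_contract) auto
    moreover have "R0 / R * (q * R + 2 * e + 2) = q * R0 + (2 * e + 2) * R0 / R"
      using R by (simp add: field_simps)
    moreover have "(2 * e + 2) * R0 / R \<le> 1 / 4" using R by (simp add: field_simps)
    ultimately have "d (geo y z R0) (geo y (\<rho> R) R0) \<le> 1 / 2 + 1 / 4" using qR0 by linarith
    then have n2: "d (geo y z R0) (\<rho> R0) \<le> 1 / 2 + 1 / 4" using rg[of R0 R] R pos by simp
    have "d (\<tau> R0) (\<rho> R0) \<le> d (\<tau> R0) (geo y z R0) + d (geo y z R0) (\<rho> R0)"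
      using mem by (intro mdist_triangle) auto
    then show ?thesis using n1 n2 mdist_commute[of m "\<tau> R0" "geo y z R0"] by linarith
  qed
  with r0(2) show ?thesis by (rule that)
qed

end

section \<open>Endpoints and north-south dynamics of a rank one isometry\<close>

context cat0
begin

lemma line_rays:
  assumes "geodesic_line m \<sigma>"
  shows "geodesic_ray m \<sigma>" "geodesic_ray m (\<lambda>t. \<sigma> (- t))"
  using assms by (auto simp: geodesic_ray_def geodesic_line_def)

lemma isometry_pow_inv:
  assumes h: "h \<in> carrier (isometry_group m)" and x: "x \<in> M"
  shows "(h [^]\<^bsub>isometry_group m\<^esub> (- n :: int)) ((h [^]\<^bsub>isometry_group m\<^esub> n) x) = x"
proof -
  interpret group "isometry_group m" by (rule group_isometry_group)
  show ?thesis using isometry_inv(1)[OF int_pow_closed[OF h] x] h by (simp add: int_pow_neg)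
qed

lemma isometry_pow_line:
  assumes h: "h \<in> carrier (isometry_group m)" and line: "geodesic_line m \<sigma>" and shift: "\<And>t. h (\<sigma> t) = \<sigma> (t + l)"
  shows "(h [^]\<^bsub>isometry_group m\<^esub> (n :: int)) (\<sigma> t) = \<sigma> (t + of_int n * l)"
proof -
  interpret group "isometry_group m" by (rule group_isometry_group)
  have nat: "(h [^]\<^bsub>isometry_group m\<^esub> (k :: nat)) (\<sigma> t) = \<sigma> (t + of_nat k * l)" for k t
  proof (induction k arbitrary: t)
    case 0
    then show ?case using line_mem[OF line] by (simp add: isometry_one)
  next
    case (Suc k)
    have "(h [^]\<^bsub>isometry_group m\<^esub> Suc k) (\<sigma> t) = (h [^]\<^bsub>isometry_group m\<^esub> k) (h (\<sigma> t))"
      using h line_mem[OF line] by (simp add: isometry_mult)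
    then show ?case by (simp add: shift Suc algebra_simps)
  qed
  show ?thesis
  proof (cases n)
    case (nonneg k)
    then show ?thesis using nat by (simp add: int_pow_int)
  next
    case (neg k)
    define k' where "k' = Suc k"
    have n: "n = - int k'" using neg by (simp add: k'_def)
    have "(h [^]\<^bsub>isometry_group m\<^esub> (int k')) (\<sigma> (t + of_int n * l)) = \<sigma> t"
      using nat[of k' "t + of_int n * l"] by (simp add: n int_pow_int)
    then show ?thesis
      using isometry_pow_inv[OF h line_mem[OF line, of "t + of_int n * l"], of "int k'"] by (simp add: n)
  qed
qed

text \<open>\<open>h\<close> preserves the distance between corresponding points of its axes, so
  \<open>n\<close> periods cannot drift apart: \<open>n * \<bar>l - l'\<bar>\<close> stays below
  \<open>2 * D\<close>. With equal translation lengths the distance of \<open>\<sigma> t\<close> and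
  \<open>\<tau> t\<close> is periodic in \<open>t\<close>.\<close>

lemma axes_parallel:
  assumes h: "h \<in> carrier (isometry_group m)" and ax: "is_axis m h \<sigma>" "is_axis m h \<tau>"
  shows "\<exists>C. \<forall>t. d (\<sigma> t) (\<tau> t) \<le> C"
proof -
  interpret group "isometry_group m" by (rule group_isometry_group)
  obtain l l' where l: "geodesic_line m \<sigma>" "0 < l" "\<And>t. h (\<sigma> t) = \<sigma> (t + l)"
    and l': "geodesic_line m \<tau>" "0 < l'" "\<And>t. h (\<tau> t) = \<tau> (t + l')"
    using ax unfolding is_axis_def by blast
  have M: "\<sigma> t \<in> M" "\<tau> t \<in> M" for t using l l' line_mem by auto
  define D where "D = d (\<sigma> 0) (\<tau> 0)"
  have pow: "d (\<sigma> (s + of_int n * l)) (\<tau> (t + of_int n * l')) = d (\<sigma> s) (\<tau> t)" for n :: int and s t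
    using isometry_dist[OF int_pow_closed[OF h] M(1) M(2), of n s t]
    by (simp add: isometry_pow_line[OF h l(1,3)] isometry_pow_line[OF h l'(1,3)])
  have "real n * \<bar>l - l'\<bar> \<le> 2 * D" for n :: nat
  proof -
    define a b where "a = real n * l" and "b = real n * l'"
    have ab: "d (\<sigma> a) (\<tau> b) = D" using pow[of 0 "int n" 0] by (simp add: a_def b_def D_def)
    have nn: "0 \<le> a" "0 \<le> b" using l l' by (auto simp: a_def b_def)
    have "d (\<sigma> 0) (\<sigma> a) = a" "d (\<tau> 0) (\<tau> b) = b"
      using l l' nn by (simp_all add: line_dist)
    then have "\<bar>a - b\<bar> \<le> 2 * D"
      using mdist_triangle[OF M(1)[of 0] M(2)[of 0] M(1)[of a]] mdist_triangle[OF M(2)[of 0] M(2)[of b] M(1)[of a]]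
        mdist_triangle[OF M(2)[of 0] M(1)[of 0] M(2)[of b]] mdist_triangle[OF M(1)[of 0] M(1)[of a] M(2)[of b]]
        ab mdist_commute[of m "\<sigma> a" "\<tau> b"] mdist_commute[of m "\<sigma> 0" "\<tau> 0"] unfolding D_def by linarith
    moreover have "a - b = real n * (l - l')" by (simp add: a_def b_def algebra_simps)
    ultimately show ?thesis by (simp add: abs_mult)
  qed
  then have "l = l'"
    using reals_Archimedean3[of "\<bar>l - l'\<bar>"] by (metis linorder_not_less zero_less_abs_iff eq_iff_diff_eq_0)
  have "d (\<sigma> t) (\<tau> t) \<le> 2 * l + D" for t
  proof -
    define n where "n = \<lfloor>t / l\<rfloor>"
    define s where "s = t - of_int n * l"
    have "of_int n \<le> t / l" "t / l < of_int n + 1" unfolding n_def by linarith+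
    then have s: "0 \<le> s" "s < l" using l(2) by (simp_all add: s_def field_simps)
    have "d (\<sigma> t) (\<tau> t) = d (\<sigma> s) (\<tau> s)" using pow[of s n s] \<open>l = l'\<close> by (simp add: s_def)
    also have "\<dots> \<le> d (\<sigma> s) (\<sigma> 0) + d (\<sigma> 0) (\<tau> s)" using M by (intro mdist_triangle) auto
    also have "d (\<sigma> 0) (\<tau> s) \<le> D + d (\<tau> 0) (\<tau> s)" unfolding D_def using M by (intro mdist_triangle) auto
    also have "d (\<sigma> s) (\<sigma> 0) = s" using l s by (simp add: line_dist)
    also have "d (\<tau> 0) (\<tau> s) = s" using l' s by (simp add: line_dist)
    finally show ?thesis using s by simp
  qed
  then show ?thesis by blast
qed

text \<open>The two endpoints are defined as unions over all axes; these are parallel, so any one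
  axis gives the whole class.\<close>

lemma attracting_repelling_cls:
  assumes h: "h \<in> carrier (isometry_group m)" and ax: "is_axis m h \<sigma>"
  shows "attracting_point m h = cls \<sigma>" "repelling_point m h = cls (\<lambda>t. \<sigma> (- t))"
proof -
  have lines: "geodesic_line m \<tau>" if "is_axis m h \<tau>" for \<tau> using that by (simp add: is_axis_def)
  have asy: "(\<sigma>, \<tau>) \<in> asymptotic m" "(\<lambda>t. \<sigma> (- t), \<lambda>t. \<tau> (- t)) \<in> asymptotic m" if \<tau>: "is_axis m h \<tau>" for \<tau>
  proof -
    obtain C where "\<And>t. d (\<sigma> t) (\<tau> t) \<le> C" using axes_parallel[OF h ax \<tau>] by blast
    then show "(\<sigma>, \<tau>) \<in> asymptotic m" "(\<lambda>t. \<sigma> (- t), \<lambda>t. \<tau> (- t)) \<in> asymptotic m"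
      using line_rays[OF lines[OF ax]] line_rays[OF lines[OF \<tau>]] by (auto intro!: asymptoticI)
  qed
  have eq: "cls \<tau> = cls \<sigma>" "cls (\<lambda>t. \<tau> (- t)) = cls (\<lambda>t. \<sigma> (- t))" if "is_axis m h \<tau>" for \<tau>
    using cls_eqI[OF asy(1)[OF that]] cls_eqI[OF asy(2)[OF that]] by simp_all
  have "attracting_point m h = (\<Union>\<tau>\<in>{\<tau>. is_axis m h \<tau>}. cls \<tau>)"
    by (auto simp: attracting_point_def cls_def)
  also have "\<dots> = (\<Union>\<tau>\<in>{\<tau>. is_axis m h \<tau>}. cls \<sigma>)"
  proof (rule SUP_cong[OF refl])
    show "cls \<tau> = cls \<sigma>" if "\<tau> \<in> {\<tau>. is_axis m h \<tau>}" for \<tau> using that by (intro eq(1)) simp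
  qed
  also have "\<dots> = cls \<sigma>" using ax by auto
  finally show "attracting_point m h = cls \<sigma>" .
  have "repelling_point m h = (\<Union>\<tau>\<in>{\<tau>. is_axis m h \<tau>}. cls (\<lambda>t. \<tau> (- t)))"
    by (auto simp: repelling_point_def cls_def)
  also have "\<dots> = (\<Union>\<tau>\<in>{\<tau>. is_axis m h \<tau>}. cls (\<lambda>t. \<sigma> (- t)))"
  proof (rule SUP_cong[OF refl])
    show "cls (\<lambda>t. \<tau> (- t)) = cls (\<lambda>t. \<sigma> (- t))" if "\<tau> \<in> {\<tau>. is_axis m h \<tau>}" for \<tau> using that by (intro eq(2)) simp
  qed
  also have "\<dots> = cls (\<lambda>t. \<sigma> (- t))" using ax by auto
  finally show "repelling_point m h = cls (\<lambda>t. \<sigma> (- t))" .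
qed

end

context proper_cat0
begin

lemma rank_one_axis_ex:
  assumes "rank_one m h"
  obtains \<sigma> l where "rank_one_axis m \<sigma> l (\<lambda>n. h [^]\<^bsub>isometry_group m\<^esub> n)"
    "attracting_point m h = cls \<sigma>" "repelling_point m h = cls (\<lambda>t. \<sigma> (- t))" "\<And>t. h (\<sigma> t) = \<sigma> (t + l)"
proof -
  interpret group "isometry_group m" by (rule group_isometry_group)
  obtain \<sigma> where h: "h \<in> carrier (isometry_group m)" and ax: "is_axis m h \<sigma>" and nf: "\<not> bounds_flat_half_plane m \<sigma>"
    using assms unfolding rank_one_def by blast
  obtain l where l: "geodesic_line m \<sigma>" "0 < l" "\<And>t. h (\<sigma> t) = \<sigma> (t + l)"
    using ax unfolding is_axis_def by blast
  have "rank_one_axis m \<sigma> l (\<lambda>n. h [^]\<^bsub>isometry_group m\<^esub> n)"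
    by unfold_locales (use h l nf isometry_pow_inv[OF h] isometry_pow_line[OF h l(1,3)] in auto)
  then show ?thesis using that attracting_repelling_cls[OF h ax] l(3) by blast
qed

lemma rank_one_fixed_points:
  assumes "rank_one m h"
  shows "attracting_point m h \<in> boundary m" "repelling_point m h \<in> boundary m"
    "boundary_map m h (attracting_point m h) = attracting_point m h"
    "boundary_map m h (repelling_point m h) = repelling_point m h"
proof -
  have h: "h \<in> carrier (isometry_group m)" using assms by (simp add: rank_one_def)
  obtain \<sigma> l where ax: "rank_one_axis m \<sigma> l (\<lambda>n. h [^]\<^bsub>isometry_group m\<^esub> n)"
    and pts: "attracting_point m h = cls \<sigma>" "repelling_point m h = cls (\<lambda>t. \<sigma> (- t))"
    and shift: "\<And>t. h (\<sigma> t) = \<sigma> (t + l)"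
    using rank_one_axis_ex[OF assms] by metis
  interpret rank_one_axis m \<sigma> l "\<lambda>n. h [^]\<^bsub>isometry_group m\<^esub> n" by (rule ax)
  show "attracting_point m h \<in> boundary m" "repelling_point m h \<in> boundary m"
    unfolding pts using axis_ray by (auto intro: cls_boundary)
  have "(h \<circ> \<sigma>, \<sigma>) \<in> asymptotic m"
    by (rule asymptoticI[where C = l]) (use axis_ray isometry_ray[OF h] l_pos in \<open>auto simp: shift axis_dist\<close>)
  then show "boundary_map m h (attracting_point m h) = attracting_point m h"
    unfolding pts using boundary_map_cls[OF h axis_ray(1)] cls_eqI by simp
  have "(h \<circ> (\<lambda>t. \<sigma> (- t)), \<lambda>t. \<sigma> (- t)) \<in> asymptotic m"
    by (rule asymptoticI[where C = l]) (use axis_ray isometry_ray[OF h] l_pos in \<open>auto simp: shift axis_dist\<close>)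
  then show "boundary_map m h (repelling_point m h) = repelling_point m h"
    unfolding pts using boundary_map_cls[OF h axis_ray(2)] cls_eqI by simp
qed

lemma rank_one_north_south:
  assumes h: "rank_one m h"
    and U: "openin (boundary_topology m) U" "repelling_point m h \<in> U"
    and V: "openin (boundary_topology m) V" "attracting_point m h \<in> V"
  shows "\<forall>\<^sub>F n in sequentially. \<forall>\<eta>\<in>boundary m - U. boundary_map m (h [^]\<^bsub>isometry_group m\<^esub> (n::nat)) \<eta> \<in> V"
proof -
  obtain \<sigma> l where ax: "rank_one_axis m \<sigma> l (\<lambda>n. h [^]\<^bsub>isometry_group m\<^esub> n)"
    and pts: "attracting_point m h = cls \<sigma>" "repelling_point m h = cls (\<lambda>t. \<sigma> (- t))"
    using rank_one_axis_ex[OF h] by metis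
  interpret rank_one_axis m \<sigma> l "\<lambda>n. h [^]\<^bsub>isometry_group m\<^esub> n" by (rule ax)
  obtain R where R: "0 < R" "\<And>R'. R \<le> R' \<Longrightarrow> end_nbhd (\<lambda>t. \<sigma> (- t)) R' \<subseteq> U"
    using end_nbhd_basis[OF U self_mem_cls[OF axis_ray(2), folded pts]] by metis
  obtain R' where R': "0 < R'" "\<And>R''. R' \<le> R'' \<Longrightarrow> end_nbhd \<sigma> R'' \<subseteq> V"
    using end_nbhd_basis[OF V self_mem_cls[OF axis_ray(1), folded pts]] by metis
  obtain N :: nat where N: "\<And>n \<eta>. N \<le> n \<Longrightarrow> \<eta> \<in> boundary m \<Longrightarrow> \<eta> \<notin> end_nbhd (\<lambda>t. \<sigma> (- t)) R \<Longrightarrow>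
      boundary_map m (h [^]\<^bsub>isometry_group m\<^esub> (int n)) \<eta> \<in> end_nbhd \<sigma> R'"
    using north_south[OF R(1) R'(1)] by metis
  have "boundary_map m (h [^]\<^bsub>isometry_group m\<^esub> n) \<eta> \<in> V" if "N \<le> n" "\<eta> \<in> boundary m - U" for n \<eta>
    using N[OF that(1), of \<eta>] that R(2)[of R] R'(2)[of R'] by (auto simp: int_pow_int)
  then show ?thesis unfolding eventually_sequentially by blast
qed

lemma openin_minus_point:
  assumes "a \<in> boundary m" shows "openin (boundary_topology m) (boundary m - {a})"
  using Hausdorff_boundary assms
  by (metis closedin_Hausdorff_sing_eq openin_diff openin_topspace topspace_boundary)

lemma boundary_map_pow_fixed:
  assumes h: "h \<in> carrier (isometry_group m)" and a: "a \<in> boundary m" "boundary_map m h a = a"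
  shows "boundary_map m (h [^]\<^bsub>isometry_group m\<^esub> (n::nat)) a = a"
proof -
  interpret group "isometry_group m" by (rule group_isometry_group)
  show ?thesis by (induction n) (use h a in \<open>auto simp: boundary_map_one boundary_map_mult\<close>)
qed

text \<open>A point fixed by a positive power is fixed by arbitrarily high powers. North-south
  dynamics forbids this: taken with the complement of \<open>a\<close> as neighbourhood of both
  ends, it says that all high powers move \<open>a\<close>.\<close>

lemma rank_one_moves:
  assumes h: "rank_one m h" and a: "a \<in> boundary m" "a \<noteq> attracting_point m h" "a \<noteq> repelling_point m h" and n: "0 < n"
  shows "boundary_map m (h [^]\<^bsub>isometry_group m\<^esub> (n::nat)) a \<noteq> a"
proof
  interpret group "isometry_group m" by (rule group_isometry_group)
  assume same: "boundary_map m (h [^]\<^bsub>isometry_group m\<^esub> n) a = a"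
  have hc: "h \<in> carrier (isometry_group m)" using h by (simp add: rank_one_def)
  have "\<forall>\<^sub>F k in sequentially. \<forall>\<eta>\<in>boundary m - (boundary m - {a}).
      boundary_map m (h [^]\<^bsub>isometry_group m\<^esub> (k::nat)) \<eta> \<in> boundary m - {a}"
    using rank_one_fixed_points[OF h] openin_minus_point[OF a(1)] a by (intro rank_one_north_south[OF h]) auto
  then obtain N where N: "\<And>k. N \<le> k \<Longrightarrow> boundary_map m (h [^]\<^bsub>isometry_group m\<^esub> (k::nat)) a \<noteq> a"
    using a(1) unfolding eventually_sequentially by auto
  have "boundary_map m (h [^]\<^bsub>isometry_group m\<^esub> (n * N)) a = a"
    using boundary_map_pow_fixed[OF nat_pow_closed[OF hc] a(1) same, of N] hc by (simp add: nat_pow_pow)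
  moreover have "N \<le> n * N" using n by simp
  ultimately show False using N by blast
qed

end

text \<open>Moving everything by the inverse of \<open>\<phi>\<close> puts the axis back in place
  and turns \<open>p\<close> into the point \<open>y\<close> of
  \<open>axis_end_behind\<close>.\<close>

lemma (in rank_one_axis) axis_end_behind_translate:
  assumes pos: "0 < Rw" "0 < R0" "0 \<le> e0"
  obtains r0 where "0 < r0"
    "\<And>\<phi> p x \<rho>. \<phi> \<in> carrier (isometry_group m) \<Longrightarrow> p \<in> M \<Longrightarrow> x \<in> M \<Longrightarrow> geodesic_ray m \<rho> \<Longrightarrow> \<rho> 0 = p \<Longrightarrow>
      d (\<phi> (\<sigma> 0)) x \<le> e0 \<Longrightarrow> r0 \<le> d p x \<Longrightarrow> d (geo p x r0) (\<rho> r0) \<le> 2 \<Longrightarrow>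
      Rw \<le> d (\<phi> (\<sigma> 0)) p \<Longrightarrow> 1 \<le> d (geo (\<sigma> 0) ((inv\<^bsub>isometry_group m\<^esub> \<phi>) p) Rw) (\<sigma> Rw) \<Longrightarrow>
      boundary_map m \<phi> (cls \<sigma>) \<in> end_nbhd \<rho> R0"
proof -
  interpret group "isometry_group m" by (rule group_isometry_group)
  obtain r0 where r0: "0 < r0"
    "\<And>y c \<rho> \<tau>. y \<in> M \<Longrightarrow> c \<in> M \<Longrightarrow> geodesic_ray m \<rho> \<Longrightarrow> \<rho> 0 = y \<Longrightarrow> d (\<sigma> 0) c \<le> e0 \<Longrightarrow>
      r0 \<le> d y c \<Longrightarrow> d (geo y c r0) (\<rho> r0) \<le> 2 \<Longrightarrow>
      Rw \<le> d (\<sigma> 0) y \<Longrightarrow> 1 \<le> d (geo (\<sigma> 0) y Rw) (\<sigma> Rw) \<Longrightarrow>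
      \<tau> 0 = y \<Longrightarrow> (\<sigma>, \<tau>) \<in> asymptotic m \<Longrightarrow> d (\<tau> R0) (\<rho> R0) < 1"
    using axis_end_behind[OF pos] by blast
  have "boundary_map m \<phi> (cls \<sigma>) \<in> end_nbhd \<rho> R0"
    if \<phi>: "\<phi> \<in> carrier (isometry_group m)" and p: "p \<in> M" and x: "x \<in> M" and \<rho>: "geodesic_ray m \<rho>" "\<rho> 0 = p"
      and near: "d (\<phi> (\<sigma> 0)) x \<le> e0" and far: "r0 \<le> d p x" and dir: "d (geo p x r0) (\<rho> r0) \<le> 2"
      and out: "Rw \<le> d (\<phi> (\<sigma> 0)) p" "1 \<le> d (geo (\<sigma> 0) ((inv\<^bsub>isometry_group m\<^esub> \<phi>) p) Rw) (\<sigma> Rw)"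
    for \<phi> p x \<rho>
  proof -
    define \<psi> where "\<psi> = inv\<^bsub>isometry_group m\<^esub> \<phi>"
    have \<psi>: "\<psi> \<in> carrier (isometry_group m)" using \<phi> by (simp add: \<psi>_def)
    have inv: "\<psi> (\<phi> z) = z" "\<phi> (\<psi> z) = z" if "z \<in> M" for z using isometry_inv[OF \<phi> that] by (simp_all add: \<psi>_def)
    have mem: "\<psi> z \<in> M" "\<phi> z \<in> M" if "z \<in> M" for z using isometry_mem[OF \<psi> that] isometry_mem[OF \<phi> that] by simp_all
    have dist: "d (\<psi> z) (\<psi> w) = d z w" if "z \<in> M" "w \<in> M" for z w using isometry_dist[OF \<psi> that] .
    have o: "d (\<sigma> 0) (\<psi> z) = d (\<phi> (\<sigma> 0)) z" if "z \<in> M" for z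
      using dist[of "\<phi> (\<sigma> 0)" z] that mem inv by simp
    obtain \<tau> where \<tau>: "\<tau> \<in> cls \<sigma>" "\<tau> 0 = \<psi> p" "geodesic_ray m \<tau>"
      using boundary_ray_from[OF cls_boundary[OF axis_ray(1)], of "\<psi> p"] mem p by metis
    have "d (\<tau> R0) ((\<psi> \<circ> \<rho>) R0) < 1"
    proof (rule r0(2)[of "\<psi> p" "\<psi> x"])
      have "geo (\<psi> p) (\<psi> x) r0 = \<psi> (geo p x r0)"
        using isometry_geo[OF \<psi> p x] far r0(1) by simp
      then show "d (geo (\<psi> p) (\<psi> x) r0) ((\<psi> \<circ> \<rho>) r0) \<le> 2"
        using dist[of "geo p x r0" "\<rho> r0"] dir p x far r0(1) ray_mem[OF \<rho>(1), of r0] by (simp add: geo_mem)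
      show "geodesic_ray m (\<psi> \<circ> \<rho>)" by (rule isometry_ray[OF \<psi> \<rho>(1)])
    qed (use mem p x \<rho> near far out \<tau> o dist isometry_ray[OF \<psi>] in \<open>auto simp: \<psi>_def mem_cls\<close>)
    moreover have "\<tau> R0 \<in> M" "\<rho> R0 \<in> M" using ray_mem \<tau>(3) \<rho>(1) pos by auto
    ultimately have lt: "d (\<phi> (\<tau> R0)) (\<rho> R0) < 1"
      using isometry_dist[OF \<phi>, of "\<tau> R0" "\<psi> (\<rho> R0)"] mem inv by simp
    have "cls \<sigma> \<in> boundary m" using cls_boundary axis_ray by blast
    then show ?thesis
      unfolding end_nbhd_def using boundary_map_mem[OF \<phi>] mem_boundary_map[OF \<phi> _ \<tau>(1)] lt \<tau>(2) \<rho>(2) inv p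
      by (auto intro!: bexI[of _ "\<phi> \<circ> \<tau>"])
  qed
  with r0(1) show ?thesis by (rule that)
qed

section \<open>Products\<close>

locale product_action =
  fixes r :: nat and X :: "nat \<Rightarrow> 'a metric" and \<Gamma> :: "(nat \<Rightarrow> 'a \<Rightarrow> 'a) set" and x :: "nat \<Rightarrow> 'a"
  assumes r_pos: "1 \<le> r"
    and proper: "\<And>i. i \<in> {1..r} \<Longrightarrow> proper_cat0 (X i)"
    and subgroup: "subgroup \<Gamma> (product_isometry_group r X)"
    and x_mem: "x \<in> mspace (product_metric r X)"
begin

abbreviation "I \<equiv> {1..r}"
abbreviation "P \<equiv> product_metric r X"
abbreviation "G \<equiv> product_isometry_group r X"
abbreviation "B i \<equiv> boundary_topology (X i)"
abbreviation "Iso i \<equiv> isometry_group (X i)"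
abbreviation "FB \<equiv> Furstenberg_boundary r X"
abbreviation "FL \<equiv> Furstenberg_limit_set r X \<Gamma> x"
abbreviation "act \<equiv> Furstenberg_map r X"

lemma cat0_X: "i \<in> I \<Longrightarrow> cat0 (X i)"
  using proper proper_cat0.axioms(1) by blast

lemma cat0_P: "cat0 P"
  using cat0_product_metric cat0_X by blast

lemma group_G: "group G"
  unfolding product_isometry_group_def by (rule product_group) (rule group_isometry_group)

lemma mem_P: "y \<in> mspace P \<Longrightarrow> i \<in> I \<Longrightarrow> y i \<in> mspace (X i)"
  by (auto simp: PiE_iff)

lemma component: "\<gamma> \<in> \<Gamma> \<Longrightarrow> i \<in> I \<Longrightarrow> \<gamma> i \<in> carrier (Iso i)"
  using subgroup.subset[OF subgroup] by (auto simp: product_isometry_group_def PiE_iff)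

lemma mult_component: "i \<in> I \<Longrightarrow> (\<gamma> \<otimes>\<^bsub>G\<^esub> \<delta>) i = \<gamma> i \<otimes>\<^bsub>Iso i\<^esub> \<delta> i"
  by (simp add: product_isometry_group_def)

lemma pow_component: "i \<in> I \<Longrightarrow> (\<gamma> [^]\<^bsub>G\<^esub> (n::nat)) i = \<gamma> i [^]\<^bsub>Iso i\<^esub> n"
  by (induction n) (simp_all add: product_isometry_group_def)

lemma mult_mem: "\<gamma> \<in> \<Gamma> \<Longrightarrow> \<delta> \<in> \<Gamma> \<Longrightarrow> \<gamma> \<otimes>\<^bsub>G\<^esub> \<delta> \<in> \<Gamma>"
  by (rule subgroup.m_closed[OF subgroup])

lemma inv_mem: "\<gamma> \<in> \<Gamma> \<Longrightarrow> inv\<^bsub>G\<^esub> \<gamma> \<in> \<Gamma>"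
  by (rule subgroup.m_inv_closed[OF subgroup])

lemma pow_mem: "\<gamma> \<in> \<Gamma> \<Longrightarrow> \<gamma> [^]\<^bsub>G\<^esub> (n::nat) \<in> \<Gamma>"
  by (induction n) (simp_all add: subgroup.one_closed[OF subgroup] mult_mem)

lemma topspace_F: "topspace (FB) = (\<Pi>\<^sub>E i\<in>I. boundary (X i))"
  unfolding Furstenberg_boundary_def topspace_product_topology
  by (rule PiE_cong) (simp add: cat0.topspace_boundary[OF cat0_X])

lemma F_component: "\<zeta> \<in> topspace (FB) \<Longrightarrow> i \<in> I \<Longrightarrow> \<zeta> i \<in> boundary (X i)"
  by (auto simp: topspace_F PiE_iff)

lemma act_mem:
  "\<gamma> \<in> \<Gamma> \<Longrightarrow> \<zeta> \<in> topspace (FB) \<Longrightarrow>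
    act \<gamma> \<zeta> \<in> topspace (FB)"
  unfolding Furstenberg_map_def using cat0.boundary_map_mem[OF cat0_X component] F_component
  by (auto simp: topspace_F)

lemma act_mult:
  assumes "\<gamma> \<in> \<Gamma>" "\<delta> \<in> \<Gamma>" "\<zeta> \<in> topspace (FB)"
  shows "act (\<gamma> \<otimes>\<^bsub>G\<^esub> \<delta>) \<zeta> = act \<gamma> (act \<delta> \<zeta>)"
  unfolding Furstenberg_map_def
  by (rule restrict_ext)
    (simp add: mult_component cat0.boundary_map_mult[OF cat0_X component component F_component] assms)

lemma act_inv:
  assumes "\<gamma> \<in> \<Gamma>" "\<zeta> \<in> topspace (FB)"
  shows "act \<gamma> (act (inv\<^bsub>G\<^esub> \<gamma>) \<zeta>) = \<zeta>"
proof -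
  have "\<gamma> \<in> carrier G" using assms subgroup.subset[OF subgroup] by blast
  then have "\<gamma> \<otimes>\<^bsub>G\<^esub> inv\<^bsub>G\<^esub> \<gamma> = \<one>\<^bsub>G\<^esub>" by (rule group.r_inv[OF group_G])
  then have "act \<gamma> (act (inv\<^bsub>G\<^esub> \<gamma>) \<zeta>) = act \<one>\<^bsub>G\<^esub> \<zeta>"
    using act_mult[OF assms(1) inv_mem[OF assms(1)] assms(2)] by simp
  also have "\<dots> = restrict \<zeta> I"
    unfolding Furstenberg_map_def
    by (rule restrict_ext)
      (simp add: product_isometry_group_def cat0.boundary_map_one[OF cat0_X F_component] assms)
  also have "\<dots> = \<zeta>" using assms(2) unfolding topspace_F by (metis PiE_restrict)
  finally show ?thesis .
qed

lemma continuous_act: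
  assumes "\<gamma> \<in> \<Gamma>"
  shows "continuous_map (FB) (FB) (act \<gamma>)"
  unfolding Furstenberg_boundary_def continuous_map_componentwise
proof (intro conjI ballI)
  show "act \<gamma> ` topspace (product_topology B I) \<subseteq> extensional I"
    by (auto simp: Furstenberg_map_def)
  fix i assume i: "i \<in> I"
  have "continuous_map (product_topology B I) (B i) (boundary_map (X i) (\<gamma> i) \<circ> (\<lambda>\<zeta>. \<zeta> i))"
    using proper_cat0.continuous_boundary_map[OF proper[OF i] component[OF assms i]]
      continuous_map_product_projection[OF i, of B]
    by (intro continuous_map_compose)
  then show "continuous_map (product_topology B I) (B i) (\<lambda>\<zeta>. act \<gamma> \<zeta> i)"
    using i by (simp add: Furstenberg_map_def o_def)
qed

lemma openin_F:
  assumes "openin (FB) U" "\<zeta> \<in> U"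
  obtains V where "\<And>i. i \<in> I \<Longrightarrow> openin (B i) (V i)" "\<And>i. i \<in> I \<Longrightarrow> \<zeta> i \<in> V i" "(\<Pi>\<^sub>E i\<in>I. V i) \<subseteq> U"
proof -
  obtain V where V: "\<forall>i\<in>I. openin (B i) (V i)" "\<zeta> \<in> (\<Pi>\<^sub>E i\<in>I. V i)" "(\<Pi>\<^sub>E i\<in>I. V i) \<subseteq> U"
    using bspec[OF iffD1[OF openin_product_topology_alt assms(1)[unfolded Furstenberg_boundary_def]] assms(2)]
    by (elim exE conjE)
  have "\<zeta> i \<in> V i" if "i \<in> I" for i using V(2) that by (rule PiE_mem)
  with V show ?thesis by (intro that[of V]) auto
qed

lemma openin_F_PiE:
  "(\<And>i. i \<in> I \<Longrightarrow> openin (B i) (V i)) \<Longrightarrow> openin (FB) (\<Pi>\<^sub>E i\<in>I. V i)"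
  unfolding Furstenberg_boundary_def by (subst openin_PiE_gen) auto

lemma dist_component:
  assumes "i \<in> I" shows "mdist (X i) (y i) (z i) \<le> mdist P y z"
proof -
  have "(mdist (X i) (y i) (z i))\<^sup>2 \<le> (\<Sum>i=1..r. (mdist (X i) (y i) (z i))\<^sup>2)"
    by (rule member_le_sum[OF assms]) auto
  then have "sqrt ((mdist (X i) (y i) (z i))\<^sup>2) \<le> mdist P y z"
    unfolding mdist_product_metric by (rule real_sqrt_le_mono)
  then show ?thesis by simp
qed

lemma product_map_mem: "\<gamma> \<in> \<Gamma> \<Longrightarrow> y \<in> mspace P \<Longrightarrow> product_map r \<gamma> y \<in> mspace P"
  using isometry_mem[OF component] by (auto simp: product_map_def PiE_iff)

lemma product_map_dist:
  assumes "\<gamma> \<in> \<Gamma>" "y \<in> mspace P" "z \<in> mspace P"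
  shows "mdist P (product_map r \<gamma> y) (product_map r \<gamma> z) = mdist P y z"
  unfolding mdist_product_metric
  by (intro arg_cong[where f = sqrt] sum.cong refl)
    (simp add: product_map_def isometry_dist[OF component mem_P mem_P] assms del: mspace_product_metric)

lemma product_map_geo:
  assumes \<gamma>: "\<gamma> \<in> \<Gamma>" and yz: "y \<in> mspace P" "z \<in> mspace P" "0 \<le> t" "t \<le> mdist P y z"
  shows "product_map r \<gamma> (cat0.geo P y z t) = cat0.geo P (product_map r \<gamma> y) (product_map r \<gamma> z) t"
proof -
  interpret P: cat0 P by (rule cat0_P)
  show ?thesis
    using P.geo_mem[OF yz] P.dist_geo[OF yz] product_map_mem[OF \<gamma>] product_map_dist[OF \<gamma>] yz
    by (intro P.geo_unique) (auto simp del: mspace_product_metric mdist_product_metric)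
qed

lemma product_map_mult:
  "\<gamma> \<in> \<Gamma> \<Longrightarrow> \<delta> \<in> \<Gamma> \<Longrightarrow> y \<in> mspace P \<Longrightarrow> product_map r (\<gamma> \<otimes>\<^bsub>G\<^esub> \<delta>) y = product_map r \<gamma> (product_map r \<delta> y)"
  unfolding product_map_def
  by (rule restrict_ext) (simp add: mult_component isometry_mult[OF component component mem_P] del: mspace_product_metric)

lemma orbit_subset: "(\<lambda>\<gamma>. product_map r \<gamma> x) ` \<Gamma> \<subseteq> mspace P"
  using product_map_mem x_mem by blast

lemma ray_decompositionD:
  assumes "ray_decomposition r X \<sigma> \<theta> \<rho>"
  shows "geodesic_ray P \<sigma>" "\<And>t i. 0 \<le> t \<Longrightarrow> i \<in> I \<Longrightarrow> \<sigma> t i = \<rho> i (\<theta> i * t)"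
    "\<And>i. i \<in> I \<Longrightarrow> 0 \<le> \<theta> i" "\<And>i. i \<in> I \<Longrightarrow> 0 < \<theta> i \<Longrightarrow> geodesic_ray (X i) (\<rho> i)"
  using assms unfolding ray_decomposition_def by auto

text \<open>The projection is defined as a union over all representatives and decompositions.
  Bounded distance in a factor forces equal speeds, since
  \<open>n * \<bar>\<theta> i - \<theta>' i\<bar>\<close> stays below \<open>2 * C\<close>, and
  equal positive speeds make the components asymptotic; so the union is one class.\<close>

lemma Furstenberg_proj_eq:
  assumes dec: "ray_decomposition r X \<sigma> \<theta> \<rho>" and \<theta>: "\<And>i. i \<in> I \<Longrightarrow> 0 < \<theta> i"
    and \<xi>: "\<xi> \<in> boundary P" "\<sigma> \<in> \<xi>"
  shows "Furstenberg_proj r X \<xi> = (\<lambda>i\<in>I. cat0.cls (X i) (\<rho> i))"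
  unfolding Furstenberg_proj_def
proof (rule restrict_ext)
  fix i assume i: "i \<in> I"
  interpret P: cat0 P by (rule cat0_P)
  interpret cat0 "X i" by (rule cat0_X[OF i])
  have \<rho>: "geodesic_ray (X i) (\<rho> i)" using ray_decompositionD(4)[OF dec i] \<theta>[OF i] .
  have *: "(\<rho> i, \<rho>' i) \<in> asymptotic (X i)" if \<sigma>': "\<sigma>' \<in> \<xi>" and dec': "ray_decomposition r X \<sigma>' \<theta>' \<rho>'" for \<sigma>' \<theta>' \<rho>'
  proof -
    define C where "C = P.d (\<sigma> 0) (\<sigma>' 0)"
    have C: "d (\<rho> i (\<theta> i * t)) (\<rho>' i (\<theta>' i * t)) \<le> C" if "0 \<le> t" for t
    proof -
      have "d (\<sigma> t i) (\<sigma>' t i) \<le> P.d (\<sigma> t) (\<sigma>' t)" by (rule dist_component[OF i])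
      also have "\<dots> \<le> C" unfolding C_def by (rule P.asymptotic_dist[OF P.boundary_asymptotic[OF \<xi> \<sigma>'] that])
      finally show ?thesis using ray_decompositionD(2)[OF dec that i] ray_decompositionD(2)[OF dec' that i] by simp
    qed
    have mem: "\<rho> i (\<theta> i * t) \<in> M" "\<rho>' i (\<theta>' i * t) \<in> M" if "0 \<le> t" for t
      using mem_P[OF P.ray_mem[OF ray_decompositionD(1)[OF dec] that] i]
        mem_P[OF P.ray_mem[OF ray_decompositionD(1)[OF dec'] that] i]
        ray_decompositionD(2)[OF dec that i] ray_decompositionD(2)[OF dec' that i] by simp_all
    have \<theta>': "0 \<le> \<theta>' i" using ray_decompositionD(3)[OF dec' i] .
    have len: "d (\<rho> i 0) (\<rho> i (\<theta> i * t)) = \<theta> i * t" "d (\<rho>' i 0) (\<rho>' i (\<theta>' i * t)) = \<theta>' i * t" if "0 \<le> t" for t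
    proof -
      show "d (\<rho> i 0) (\<rho> i (\<theta> i * t)) = \<theta> i * t" using ray_dist[OF \<rho>] \<theta>[OF i] that by simp
      \<comment> \<open>If \<open>\<theta>' i = 0\<close>, nothing is assumed of
        \<open>\<rho>' i\<close> away from 0, and both sides vanish.\<close>
      show "d (\<rho>' i 0) (\<rho>' i (\<theta>' i * t)) = \<theta>' i * t"
        using ray_dist[OF ray_decompositionD(4)[OF dec' i]] \<theta>' that mem(2)[of 0]
        by (cases "\<theta>' i = 0") auto
    qed
    have "real n * \<bar>\<theta> i - \<theta>' i\<bar> \<le> 2 * C" for n :: nat
    proof -
      define t where "t = real n"
      have t: "0 \<le> t" by (simp add: t_def)
      note m = mem(1)[of 0] mem(2)[of 0] mem[OF t]
      have m0: "\<rho> i 0 \<in> M" "\<rho>' i 0 \<in> M" using m(1,2) by simp_all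
      have "\<bar>\<theta> i * t - \<theta>' i * t\<bar> \<le> 2 * C"
        using mdist_triangle[OF m0(1) m0(2) m(3)] mdist_triangle[OF m0(2) m(4) m(3)]
          mdist_triangle[OF m0(2) m0(1) m(4)] mdist_triangle[OF m0(1) m(3) m(4)]
          C[OF t] C[of 0] len[OF t] mdist_commute[of "X i" "\<rho> i 0" "\<rho>' i 0"]
          mdist_commute[of "X i" "\<rho> i (\<theta> i * t)" "\<rho>' i (\<theta>' i * t)"] by simp
      moreover have "\<bar>\<theta> i * t - \<theta>' i * t\<bar> = t * \<bar>\<theta> i - \<theta>' i\<bar>"
        unfolding left_diff_distrib[symmetric] abs_mult using t by simp
      ultimately show ?thesis by (simp add: t_def)
    qed
    then have eq: "\<theta> i = \<theta>' i"
      using reals_Archimedean3[of "\<bar>\<theta> i - \<theta>' i\<bar>"] by (metis linorder_not_less zero_less_abs_iff eq_iff_diff_eq_0)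
    show ?thesis
    proof (rule asymptoticI[OF \<rho>])
      show "geodesic_ray (X i) (\<rho>' i)" using ray_decompositionD(4)[OF dec' i] \<theta>[OF i] eq by simp
      show "d (\<rho> i t) (\<rho>' i t) \<le> C" if "0 \<le> t" for t
        using C[of "t / \<theta> i"] that \<theta>[OF i] eq by simp
    qed
  qed
  show "asymptotic (X i) `` {\<rho> i |\<sigma> \<theta> \<rho>. \<sigma> \<in> \<xi> \<and> ray_decomposition r X \<sigma> \<theta> \<rho>} = cls (\<rho> i)"
  proof (intro subset_antisym subsetI)
    fix \<tau> assume "\<tau> \<in> asymptotic (X i) `` {\<rho> i |\<sigma> \<theta> \<rho>. \<sigma> \<in> \<xi> \<and> ray_decomposition r X \<sigma> \<theta> \<rho>}"
    then obtain \<sigma>' \<theta>' \<rho>' where "\<sigma>' \<in> \<xi>" "ray_decomposition r X \<sigma>' \<theta>' \<rho>'" "(\<rho>' i, \<tau>) \<in> asymptotic (X i)"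
      by blast
    then show "\<tau> \<in> cls (\<rho> i)" using * asymptotic_trans unfolding mem_cls by metis
  next
    fix \<tau> assume "\<tau> \<in> cls (\<rho> i)"
    then have "(\<rho> i, \<tau>) \<in> asymptotic (X i)" by (simp add: mem_cls)
    then show "\<tau> \<in> asymptotic (X i) `` {\<rho> i |\<sigma> \<theta> \<rho>. \<sigma> \<in> \<xi> \<and> ray_decomposition r X \<sigma> \<theta> \<rho>}"
      using dec \<xi>(2) by blast
  qed
qed

lemma limit_set_elim:
  assumes "\<zeta> \<in> FL"
  obtains \<xi> \<sigma> \<theta> \<rho> where "\<xi> \<in> boundary P" "\<sigma> \<in> \<xi>" "\<xi> \<in> geometric_limit_set r X \<Gamma> x"
    "ray_decomposition r X \<sigma> \<theta> \<rho>" "\<And>i. i \<in> I \<Longrightarrow> 0 < \<theta> i" "\<And>i. i \<in> I \<Longrightarrow> geodesic_ray (X i) (\<rho> i)"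
    "\<zeta> = (\<lambda>i\<in>I. cat0.cls (X i) (\<rho> i))"
proof -
  obtain \<xi> where \<xi>: "\<xi> \<in> geometric_limit_set r X \<Gamma> x" "\<xi> \<in> regular_boundary r X" "\<zeta> = Furstenberg_proj r X \<xi>"
    using assms unfolding Furstenberg_limit_set_def by blast
  obtain \<theta> where \<theta>: "\<xi> \<in> boundary P" "has_slope r X \<xi> \<theta>" "\<And>i. i \<in> I \<Longrightarrow> 0 < \<theta> i"
    using \<xi>(2) unfolding regular_boundary_def by blast
  obtain \<sigma> \<rho> where \<sigma>: "\<sigma> \<in> \<xi>" "ray_decomposition r X \<sigma> \<theta> \<rho>"
    using \<theta>(2) unfolding has_slope_def by blast
  show ?thesis
  proof (rule that[OF \<theta>(1) \<sigma>(1) \<xi>(1) \<sigma>(2) \<theta>(3)])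
    show "geodesic_ray (X i) (\<rho> i)" if "i \<in> I" for i
      using ray_decompositionD(4)[OF \<sigma>(2) that \<theta>(3)[OF that]] .
    show "\<zeta> = (\<lambda>i\<in>I. cat0.cls (X i) (\<rho> i))"
      using Furstenberg_proj_eq[OF \<sigma>(2) \<theta>(3) \<theta>(1) \<sigma>(1)] \<xi>(3) by simp
  qed
qed

lemma limit_set_intro:
  assumes dec: "ray_decomposition r X \<sigma> \<theta> \<rho>" and \<theta>: "\<And>i. i \<in> I \<Longrightarrow> 0 < \<theta> i"
    and lim: "\<And>R. 0 < R \<Longrightarrow> \<exists>\<gamma>\<in>\<Gamma>. R < mdist P (\<sigma> 0) (product_map r \<gamma> x) \<and>
      mdist P (cat0.geo P (\<sigma> 0) (product_map r \<gamma> x) R) (\<sigma> R) < 1"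
  shows "(\<lambda>i\<in>I. cat0.cls (X i) (\<rho> i)) \<in> FL"
proof -
  interpret P: cat0 P by (rule cat0_P)
  have ray: "geodesic_ray P \<sigma>" using ray_decompositionD(1)[OF dec] .
  have \<xi>: "P.cls \<sigma> \<in> boundary P" "\<sigma> \<in> P.cls \<sigma>" using P.cls_boundary[OF ray] P.self_mem_cls[OF ray] by auto
  have "P.cls \<sigma> \<in> geometric_limit_set r X \<Gamma> x"
    unfolding geometric_limit_set_def P.limit_points_iff[OF \<xi> orbit_subset] using lim by blast
  moreover have "P.cls \<sigma> \<in> regular_boundary r X"
    unfolding regular_boundary_def has_slope_def using \<xi> dec \<theta> by blast
  ultimately show ?thesis
    unfolding Furstenberg_limit_set_def using Furstenberg_proj_eq[OF dec \<theta> \<xi>] by (metis IntI imageI)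
qed

lemma limit_set_subset: "FL \<subseteq> topspace (FB)"
proof
  fix \<zeta> assume \<zeta>: "\<zeta> \<in> FL"
  obtain \<xi> \<sigma> \<theta> \<rho> where \<xi>: "\<xi> \<in> boundary P" "\<sigma> \<in> \<xi>" "\<xi> \<in> geometric_limit_set r X \<Gamma> x"
    and dec: "ray_decomposition r X \<sigma> \<theta> \<rho>" and \<theta>: "\<And>i. i \<in> I \<Longrightarrow> 0 < \<theta> i"
    and \<rho>: "\<And>i. i \<in> I \<Longrightarrow> geodesic_ray (X i) (\<rho> i)" and eq: "\<zeta> = (\<lambda>i\<in>I. cat0.cls (X i) (\<rho> i))"
    by (rule limit_set_elim[OF \<zeta>]) (rule that; (assumption | simp))
  show "\<zeta> \<in> topspace (FB)"
    unfolding topspace_F eq using cat0.cls_boundary[OF cat0_X \<rho>] by simp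
qed

lemma act_limit_set:
  assumes \<gamma>: "\<gamma> \<in> \<Gamma>" and \<zeta>: "\<zeta> \<in> FL"
  shows "act \<gamma> \<zeta> \<in> FL"
proof -
  interpret P: cat0 P by (rule cat0_P)
  obtain \<xi> \<sigma> \<theta> \<rho> where \<xi>: "\<xi> \<in> boundary P" "\<sigma> \<in> \<xi>" "\<xi> \<in> geometric_limit_set r X \<Gamma> x"
    and dec: "ray_decomposition r X \<sigma> \<theta> \<rho>" and \<theta>: "\<And>i. i \<in> I \<Longrightarrow> 0 < \<theta> i"
    and \<rho>: "\<And>i. i \<in> I \<Longrightarrow> geodesic_ray (X i) (\<rho> i)" and eq: "\<zeta> = (\<lambda>i\<in>I. cat0.cls (X i) (\<rho> i))"
    by (rule limit_set_elim[OF \<zeta>]) (rule that; (assumption | simp))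
  have ray: "geodesic_ray P \<sigma>" using ray_decompositionD(1)[OF dec] .
  define \<sigma>' where "\<sigma>' t = product_map r \<gamma> (\<sigma> t)" for t
  have M: "\<sigma> t \<in> mspace P" if "0 \<le> t" for t by (rule P.ray_mem[OF ray that])
  have ray': "geodesic_ray P \<sigma>'"
    unfolding geodesic_ray_def \<sigma>'_def image_subset_iff
    using product_map_mem[OF \<gamma> M] product_map_dist[OF \<gamma> M M] P.ray_dist[OF ray]
    by (auto simp del: mspace_product_metric mdist_product_metric)
  have "ray_decomposition r X \<sigma>' \<theta> (\<lambda>i. \<gamma> i \<circ> \<rho> i)"
    unfolding ray_decomposition_def
  proof (intro conjI ballI allI impI ray')
    show "(\<Sum>i=1..r. (\<theta> i)\<^sup>2) = 1" using dec unfolding ray_decomposition_def by blast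
    show "0 \<le> \<theta> i" if "i \<in> I" for i using ray_decompositionD(3)[OF dec that] .
    show "geodesic_ray (X i) (\<gamma> i \<circ> \<rho> i)" if "i \<in> I" for i
      using cat0.isometry_ray[OF cat0_X[OF that] component[OF \<gamma> that] \<rho>[OF that]] .
    show "\<sigma>' t = (\<lambda>i\<in>I. (\<gamma> i \<circ> \<rho> i) (\<theta> i * t))" if "0 \<le> t" for t
      unfolding \<sigma>'_def product_map_def
      by (rule restrict_ext) (simp add: ray_decompositionD(2)[OF dec that])
  qed
  then have "(\<lambda>i\<in>I. cat0.cls (X i) (\<gamma> i \<circ> \<rho> i)) \<in> FL"
  proof (rule limit_set_intro[OF _ \<theta>])
    fix R :: real assume R: "0 < R"
    then obtain \<delta> where \<delta>: "\<delta> \<in> \<Gamma>" "R < P.d (\<sigma> 0) (product_map r \<delta> x)"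
        "P.d (P.geo (\<sigma> 0) (product_map r \<delta> x) R) (\<sigma> R) < 1"
      using \<xi>(3) unfolding geometric_limit_set_def P.limit_points_iff[OF \<xi>(1,2) orbit_subset] by blast
    define z where "z = product_map r \<delta> x"
    have z: "z \<in> mspace P" using product_map_mem[OF \<delta>(1) x_mem] by (simp add: z_def)
    have gz: "product_map r (\<gamma> \<otimes>\<^bsub>G\<^esub> \<delta>) x = product_map r \<gamma> z"
      using product_map_mult[OF \<gamma> \<delta>(1) x_mem] by (simp add: z_def)
    have far: "R < P.d (\<sigma>' 0) (product_map r \<gamma> z)"
      unfolding \<sigma>'_def product_map_dist[OF \<gamma> M[OF order_refl] z] using \<delta>(2) by (simp add: z_def)
    have g: "P.geo (\<sigma> 0) z R \<in> mspace P"
      by (rule P.geo_mem) (use M[of 0] z R \<delta>(2) in \<open>auto simp: z_def simp del: mspace_product_metric mdist_product_metric\<close>)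
    have "P.geo (\<sigma>' 0) (product_map r \<gamma> z) R = product_map r \<gamma> (P.geo (\<sigma> 0) z R)"
      unfolding \<sigma>'_def
      by (rule product_map_geo[symmetric]) (use \<gamma> M[of 0] z R \<delta>(2) in \<open>auto simp: z_def simp del: mspace_product_metric mdist_product_metric\<close>)
    then have "P.d (P.geo (\<sigma>' 0) (product_map r \<gamma> z) R) (\<sigma>' R) < 1"
      unfolding \<sigma>'_def using product_map_dist[OF \<gamma> g M[of R]] R \<delta>(3) by (simp add: z_def del: mdist_product_metric)
    with far show "\<exists>\<gamma>\<in>\<Gamma>. R < P.d (\<sigma>' 0) (product_map r \<gamma> x) \<and> P.d (P.geo (\<sigma>' 0) (product_map r \<gamma> x) R) (\<sigma>' R) < 1"
      using mult_mem[OF \<gamma> \<delta>(1)] gz by metis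
  qed
  also have "(\<lambda>i\<in>I. cat0.cls (X i) (\<gamma> i \<circ> \<rho> i)) = act \<gamma> \<zeta>"
    unfolding Furstenberg_map_def eq
    by (rule restrict_ext) (simp add: cat0.boundary_map_cls[OF cat0_X component[OF \<gamma>] \<rho>])
  finally show ?thesis .
qed

lemma limit_set_invariant:
  assumes "\<gamma> \<in> \<Gamma>"
  shows "act \<gamma> ` FL = FL"
proof (intro subset_antisym subsetI)
  fix \<zeta> assume \<zeta>: "\<zeta> \<in> FL"
  have "\<zeta> = act \<gamma> (act (inv\<^bsub>G\<^esub> \<gamma>) \<zeta>)"
    using act_inv[OF assms] limit_set_subset \<zeta> by (simp add: subset_iff)
  then show "\<zeta> \<in> act \<gamma> ` FL"
    using act_limit_set[OF inv_mem[OF assms] \<zeta>] by (rule image_eqI)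
qed (use act_limit_set[OF assms] in auto)

end

section \<open>Contraction to the attracting points of \<open>g\<close>\<close>

locale product_rank_one = product_action +
  fixes g h :: "nat \<Rightarrow> 'a \<Rightarrow> 'a"
  assumes g_mem: "g \<in> \<Gamma>" and h_mem: "h \<in> \<Gamma>" and independent: "independent_regular_axial r X g h"
begin

abbreviation "att k i \<equiv> attracting_point (X i) (k i)"
abbreviation "rep k i \<equiv> repelling_point (X i) (k i)"

text \<open>The one point that serves as \<open>\<xi>\<close> for all boundary points in the second
  and third property.\<close>

definition base_point :: "nat \<Rightarrow> (real \<Rightarrow> 'a) set" where
  "base_point = (\<lambda>i\<in>I. att g i)"

lemma rank_one: "i \<in> I \<Longrightarrow> rank_one (X i) (g i)" "i \<in> I \<Longrightarrow> rank_one (X i) (h i)"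
  using independent by (auto simp: independent_regular_axial_def regular_axial_def)

lemma distinct_ends:
  assumes "i \<in> I"
  shows "att g i \<noteq> att h i" "att g i \<noteq> rep h i" "rep g i \<noteq> att h i" "rep g i \<noteq> rep h i"
proof -
  have "independent_isometries (X i) (g i) (h i)"
    using independent assms by (simp add: independent_regular_axial_def)
  then have "att g i \<notin> {att h i, rep h i}" "rep g i \<notin> {att h i, rep h i}"
    unfolding independent_isometries_def by blast+
  then show "att g i \<noteq> att h i" "att g i \<noteq> rep h i" "rep g i \<noteq> att h i" "rep g i \<noteq> rep h i" by simp_all
qed

lemma base_point_mem: "base_point \<in> topspace (FB)"
  using proper_cat0.rank_one_fixed_points(1)[OF proper rank_one(1)] by (simp add: topspace_F base_point_def)

lemma act_pow_component:
  "i \<in> I \<Longrightarrow> act (\<gamma> [^]\<^bsub>G\<^esub> (n::nat)) \<zeta> i = boundary_map (X i) (\<gamma> i [^]\<^bsub>Iso i\<^esub> n) (\<zeta> i)"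
  by (simp add: Furstenberg_map_def pow_component)

text \<open>Either the component is the repelling point of \<open>h i\<close>, which stays fixed, or
  it is drawn towards the attracting one; by independence neither is \<open>rep g i\<close>. Being
  eventual, the statement holds for all factors with a common exponent.\<close>

lemma leaves_repelling:
  assumes \<zeta>: "\<zeta> \<in> topspace (FB)"
  shows "\<forall>\<^sub>F n in sequentially. \<forall>i\<in>I. act (h [^]\<^bsub>G\<^esub> n) \<zeta> i \<noteq> rep g i"
proof (intro eventually_ball_finite ballI)
  fix i assume i: "i \<in> I"
  interpret proper_cat0 "X i" by (rule proper[OF i])
  note fp = rank_one_fixed_points[OF rank_one(1)[OF i]] and fh = rank_one_fixed_points[OF rank_one(2)[OF i]]
  have hc: "h i \<in> carrier (Iso i)" using component[OF h_mem i] .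
  have \<zeta>i: "\<zeta> i \<in> boundary (X i)" using F_component[OF \<zeta> i] .
  show "\<forall>\<^sub>F n in sequentially. act (h [^]\<^bsub>G\<^esub> n) \<zeta> i \<noteq> rep g i"
  proof (cases "\<zeta> i = rep h i")
    case True
    have "act (h [^]\<^bsub>G\<^esub> n) \<zeta> i = rep h i" for n :: nat
      unfolding act_pow_component[OF i] True by (rule boundary_map_pow_fixed[OF hc fh(2,4)])
    then show ?thesis using distinct_ends(4)[OF i] by simp
  next
    case False
    have "\<forall>\<^sub>F n in sequentially. \<forall>\<eta>\<in>boundary (X i) - (boundary (X i) - {\<zeta> i}).
        boundary_map (X i) (h i [^]\<^bsub>Iso i\<^esub> (n::nat)) \<eta> \<in> boundary (X i) - {rep g i}"
      using openin_minus_point fp fh \<zeta>i False distinct_ends(3)[OF i]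
      by (intro rank_one_north_south[OF rank_one(2)[OF i]]) auto
    then show ?thesis
      by eventually_elim (use act_pow_component[OF i] \<zeta>i in auto)
  qed
qed simp

text \<open>Stated for sets rather than points because the third property asks for a whole
  neighbourhood to be contracted by one element.\<close>

lemma absorbed:
  assumes S: "S \<subseteq> topspace (FB)"
    and W: "\<And>i. i \<in> I \<Longrightarrow> openin (B i) (W i)" "\<And>i. i \<in> I \<Longrightarrow> rep g i \<in> W i" "\<And>i \<zeta>. i \<in> I \<Longrightarrow> \<zeta> \<in> S \<Longrightarrow> \<zeta> i \<notin> W i"
    and U: "openin (FB) U" "base_point \<in> U"
  shows "\<exists>\<gamma>\<in>\<Gamma>. act \<gamma> ` S \<subseteq> U"
proof -
  obtain V where V: "\<And>i. i \<in> I \<Longrightarrow> openin (B i) (V i)" "\<And>i. i \<in> I \<Longrightarrow> base_point i \<in> V i" "(\<Pi>\<^sub>E i\<in>I. V i) \<subseteq> U"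
    using openin_F[OF U] by metis
  have "\<forall>\<^sub>F n in sequentially. \<forall>i\<in>I. \<forall>\<eta>\<in>boundary (X i) - W i.
      boundary_map (X i) (g i [^]\<^bsub>Iso i\<^esub> (n::nat)) \<eta> \<in> V i"
  proof (rule eventually_ball_finite[OF finite_atLeastAtMost], rule ballI)
    fix i assume i: "i \<in> I"
    have "att g i \<in> V i" using V(2)[OF i] i by (simp add: base_point_def)
    then show "\<forall>\<^sub>F n in sequentially. \<forall>\<eta>\<in>boundary (X i) - W i.
      boundary_map (X i) (g i [^]\<^bsub>Iso i\<^esub> (n::nat)) \<eta> \<in> V i"
      using W V(1) i by (intro proper_cat0.rank_one_north_south[OF proper rank_one(1)]) auto
  qed
  then obtain n :: nat where n: "\<And>i \<eta>. i \<in> I \<Longrightarrow> \<eta> \<in> boundary (X i) \<Longrightarrow> \<eta> \<notin> W i \<Longrightarrow>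
      boundary_map (X i) (g i [^]\<^bsub>Iso i\<^esub> n) \<eta> \<in> V i"
    unfolding eventually_sequentially by blast
  have "act (g [^]\<^bsub>G\<^esub> n) \<zeta> \<in> U" if \<zeta>: "\<zeta> \<in> S" for \<zeta>
  proof -
    have mem: "\<zeta> \<in> topspace (FB)" using S \<zeta> by blast
    have "act (g [^]\<^bsub>G\<^esub> n) \<zeta> \<in> (\<Pi>\<^sub>E i\<in>I. V i)"
    proof (rule PiE_I)
      show "act (g [^]\<^bsub>G\<^esub> n) \<zeta> i \<in> V i" if "i \<in> I" for i
        using n[OF that F_component[OF mem that] W(3)[OF that \<zeta>]] act_pow_component[OF that] by simp
    qed (auto simp: Furstenberg_map_def)
    then show ?thesis using V(3) by blast
  qed
  then show ?thesis using pow_mem[OF g_mem] by blast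
qed

lemma pair_to_base_point:
  assumes "\<zeta> \<in> topspace (FB)" "\<eta> \<in> topspace (FB)"
    and U: "openin (FB) U" "base_point \<in> U"
  shows "\<exists>\<gamma>\<in>\<Gamma>. act \<gamma> \<zeta> \<in> U \<and> act \<gamma> \<eta> \<in> U"
proof -
  have "\<forall>\<^sub>F n in sequentially. (\<forall>i\<in>I. act (h [^]\<^bsub>G\<^esub> n) \<zeta> i \<noteq> rep g i)
      \<and> (\<forall>i\<in>I. act (h [^]\<^bsub>G\<^esub> n) \<eta> i \<noteq> rep g i)"
    using leaves_repelling assms by (intro eventually_conj) auto
  then obtain n :: nat where n: "\<And>i. i \<in> I \<Longrightarrow> act (h [^]\<^bsub>G\<^esub> n) \<zeta> i \<noteq> rep g i"
      "\<And>i. i \<in> I \<Longrightarrow> act (h [^]\<^bsub>G\<^esub> n) \<eta> i \<noteq> rep g i"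
    unfolding eventually_sequentially by blast
  define \<delta> where "\<delta> = h [^]\<^bsub>G\<^esub> n"
  have \<delta>: "\<delta> \<in> \<Gamma>" using pow_mem[OF h_mem] by (simp add: \<delta>_def)
  let ?\<zeta> = "act \<delta> \<zeta>" and ?\<eta> = "act \<delta> \<eta>"
  have mem: "?\<zeta> \<in> topspace (FB)" "?\<eta> \<in> topspace (FB)"
    using act_mem[OF \<delta>] assms by auto
  have "\<exists>\<gamma>\<in>\<Gamma>. act \<gamma> ` {?\<zeta>, ?\<eta>} \<subseteq> U"
  proof (rule absorbed[OF _ _ _ _ U])
    fix i assume i: "i \<in> I"
    interpret proper_cat0 "X i" by (rule proper[OF i])
    show "openin (B i) ((boundary (X i) - {?\<zeta> i}) \<inter> (boundary (X i) - {?\<eta> i}))"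
      using openin_minus_point F_component[OF mem(1) i] F_component[OF mem(2) i] by (intro openin_Int) auto
    show "rep g i \<in> (boundary (X i) - {?\<zeta> i}) \<inter> (boundary (X i) - {?\<eta> i})"
      using n[OF i] rank_one_fixed_points(2)[OF rank_one(1)[OF i]] by (auto simp: \<delta>_def)
  qed (use mem in auto)
  then obtain \<gamma> where \<gamma>: "\<gamma> \<in> \<Gamma>" "act \<gamma> ?\<zeta> \<in> U" "act \<gamma> ?\<eta> \<in> U" by auto
  then show ?thesis
    using act_mult[OF \<gamma>(1) \<delta>] assms mult_mem[OF \<gamma>(1) \<delta>] by (intro bexI[of _ "\<gamma> \<otimes>\<^bsub>G\<^esub> \<delta>"]) auto
qed

text \<open>\<open>V\<close> must not depend on \<open>U\<close>. A fixed power of \<open>h\<close>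
  moves \<open>\<zeta>\<close> off the repelling points, Hausdorff separation then determines
  \<open>V\<close>, and only the power of \<open>g\<close> is chosen after \<open>U\<close>.\<close>

lemma nbhd_to_base_point:
  assumes \<zeta>: "\<zeta> \<in> topspace (FB)"
  shows "\<exists>V. openin (FB) V \<and> \<zeta> \<in> V \<and>
    (\<forall>U. openin (FB) U \<and> base_point \<in> U \<longrightarrow> (\<exists>\<gamma>\<in>\<Gamma>. act \<gamma> ` V \<subseteq> U))"
proof -
  obtain n :: nat where n: "\<And>i. i \<in> I \<Longrightarrow> act (h [^]\<^bsub>G\<^esub> n) \<zeta> i \<noteq> rep g i"
    using leaves_repelling[OF \<zeta>] unfolding eventually_sequentially by blast
  define \<delta> where "\<delta> = h [^]\<^bsub>G\<^esub> n"
  have \<delta>: "\<delta> \<in> \<Gamma>" using pow_mem[OF h_mem] by (simp add: \<delta>_def)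
  have mem: "act \<delta> \<zeta> \<in> topspace FB" using act_mem[OF \<delta> \<zeta>] .
  have "\<forall>i. \<exists>A W. i \<in> I \<longrightarrow> openin (B i) A \<and> openin (B i) W \<and> act \<delta> \<zeta> i \<in> A \<and> rep g i \<in> W \<and> A \<inter> W = {}"
  proof
    fix i
    show "\<exists>A W. i \<in> I \<longrightarrow> openin (B i) A \<and> openin (B i) W \<and> act \<delta> \<zeta> i \<in> A \<and> rep g i \<in> W \<and> A \<inter> W = {}"
    proof (cases "i \<in> I")
      case True
      interpret proper_cat0 "X i" by (rule proper[OF True])
      show ?thesis
        using Hausdorff_boundary n[OF True] F_component[OF mem True] rank_one_fixed_points(2)[OF rank_one(1)[OF True]]
        unfolding Hausdorff_space_def disjnt_def topspace_boundary \<delta>_def by metis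
    qed blast
  qed
  then obtain A W where AW: "\<And>i. i \<in> I \<Longrightarrow> openin (B i) (A i)" "\<And>i. i \<in> I \<Longrightarrow> openin (B i) (W i)"
      "\<And>i. i \<in> I \<Longrightarrow> act \<delta> \<zeta> i \<in> A i" "\<And>i. i \<in> I \<Longrightarrow> rep g i \<in> W i" "\<And>i. i \<in> I \<Longrightarrow> A i \<inter> W i = {}"
    by metis
  define V where "V = {\<eta> \<in> topspace FB. act \<delta> \<eta> \<in> (\<Pi>\<^sub>E i\<in>I. A i)}"
  have "openin FB V"
    unfolding V_def using openin_F_PiE[OF AW(1)] continuous_act[OF \<delta>] by (intro openin_continuous_map_preimage)
  moreover have "act \<delta> \<zeta> \<in> (\<Pi>\<^sub>E i\<in>I. A i)"
    using AW(3) by (intro PiE_I) (auto simp: Furstenberg_map_def)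
  then have "\<zeta> \<in> V" using \<zeta> by (simp add: V_def)
  moreover have "\<exists>\<gamma>\<in>\<Gamma>. act \<gamma> ` V \<subseteq> U" if U: "openin FB U" "base_point \<in> U" for U
  proof -
    have "\<exists>\<gamma>\<in>\<Gamma>. act \<gamma> ` (act \<delta> ` V) \<subseteq> U"
    proof (rule absorbed[OF _ AW(2,4) _ U])
      show "act \<delta> ` V \<subseteq> topspace FB" using act_mem[OF \<delta>] by (auto simp: V_def)
      fix i \<eta> assume i: "i \<in> I" and "\<eta> \<in> act \<delta> ` V"
      then have "\<eta> i \<in> A i" by (auto simp: V_def)
      then show "\<eta> i \<notin> W i" using AW(5)[OF i] by blast
    qed
    then obtain \<gamma> where \<gamma>: "\<gamma> \<in> \<Gamma>" "act \<gamma> ` (act \<delta> ` V) \<subseteq> U" by blast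
    have "act (\<gamma> \<otimes>\<^bsub>G\<^esub> \<delta>) ` V \<subseteq> U"
    proof (rule image_subsetI)
      fix \<eta> assume \<eta>: "\<eta> \<in> V"
      then have "\<eta> \<in> topspace FB" by (simp add: V_def)
      then show "act (\<gamma> \<otimes>\<^bsub>G\<^esub> \<delta>) \<eta> \<in> U"
        using act_mult[OF \<gamma>(1) \<delta>] \<gamma>(2) \<eta> by auto
    qed
    then show ?thesis using mult_mem[OF \<gamma>(1) \<delta>] by blast
  qed
  ultimately show ?thesis by blast
qed

lemma g_axes:
  obtains \<sigma> l where
    "\<And>i. i \<in> I \<Longrightarrow> rank_one_axis (X i) (\<sigma> i) (l i) (\<lambda>n. g i [^]\<^bsub>Iso i\<^esub> n)"
    "\<And>i. i \<in> I \<Longrightarrow> att g i = cat0.cls (X i) (\<sigma> i)"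
proof -
  have "\<forall>i. \<exists>\<sigma> l. i \<in> I \<longrightarrow> rank_one_axis (X i) \<sigma> l (\<lambda>n. g i [^]\<^bsub>Iso i\<^esub> n) \<and>
      att g i = cat0.cls (X i) \<sigma>"
  proof
    fix i
    show "\<exists>\<sigma> l. i \<in> I \<longrightarrow> rank_one_axis (X i) \<sigma> l (\<lambda>n. g i [^]\<^bsub>Iso i\<^esub> n) \<and> att g i = cat0.cls (X i) \<sigma>"
    proof (cases "i \<in> I")
      case True
      show ?thesis by (rule proper_cat0.rank_one_axis_ex[OF proper[OF True] rank_one(1)[OF True]]) blast
    qed blast
  qed
  then show ?thesis using that by metis
qed

text \<open>The axes of the \<open>g i\<close>, run with speeds proportional to the translation
  lengths, form an axis of \<open>g\<close> in the product. The orbit of \<open>x\<close> under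
  powers of \<open>g\<close> stays at distance \<open>Y\<close> from it and so converges to its
  end.\<close>

lemma base_point_limit: "base_point \<in> FL"
proof -
  interpret P: cat0 P by (rule cat0_P)
  obtain \<sigma> l where ax: "\<And>i. i \<in> I \<Longrightarrow> rank_one_axis (X i) (\<sigma> i) (l i) (\<lambda>n. g i [^]\<^bsub>Iso i\<^esub> n)"
    and att: "\<And>i. i \<in> I \<Longrightarrow> att g i = cat0.cls (X i) (\<sigma> i)"
    by (rule g_axes) (rule that; (assumption | simp))
  have l: "0 < l i" if "i \<in> I" for i using rank_one_axis.l_pos[OF ax[OF that]] .
  define L where "L = sqrt (\<Sum>i=1..r. (l i)\<^sup>2)"
  have "0 < (l i)\<^sup>2" if "i \<in> I" for i using l[OF that] by simp
  then have "0 < (\<Sum>i=1..r. (l i)\<^sup>2)" using r_pos by (intro sum_pos) auto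
  then have L: "0 < L" "L\<^sup>2 = (\<Sum>i=1..r. (l i)\<^sup>2)" by (simp_all add: L_def)
  \<comment> \<open>With these speeds, \<open>g\<close> shifts every component by the same product
    parameter \<open>L\<close>. They are positive, so the end of the axis is regular.\<close>
  define \<theta> where "\<theta> i = l i / L" for i
  have \<theta>: "0 < \<theta> i" if "i \<in> I" for i using l[OF that] L by (simp add: \<theta>_def)
  have \<theta>sum: "(\<Sum>i=1..r. (\<theta> i)\<^sup>2) = 1"
    unfolding \<theta>_def power_divide sum_divide_distrib[symmetric] L(2)[symmetric] using L(1) by simp
  define \<Sigma> where "\<Sigma> t = (\<lambda>i\<in>I. \<sigma> i (\<theta> i * t))" for t
  have \<Sigma>_mem: "\<Sigma> t \<in> mspace P" for t
    using rank_one_axis.axis_mem[OF ax] by (simp add: \<Sigma>_def)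
  have \<Sigma>_dist: "mdist P (\<Sigma> s) (\<Sigma> t) = \<bar>s - t\<bar>" for s t
  proof -
    have "mdist P (\<Sigma> s) (\<Sigma> t) = sqrt (\<Sum>i=1..r. (\<theta> i)\<^sup>2 * (s - t)\<^sup>2)"
      unfolding mdist_product_metric
    proof (intro arg_cong[where f = sqrt] sum.cong refl)
      fix i assume i: "i \<in> {1..r}"
      then show "(mdist (X i) (\<Sigma> s i) (\<Sigma> t i))\<^sup>2 = (\<theta> i)\<^sup>2 * (s - t)\<^sup>2"
        using rank_one_axis.axis_dist[OF ax[OF i]]
        by (simp add: \<Sigma>_def right_diff_distrib[symmetric] abs_mult power_mult_distrib)
    qed
    also have "\<dots> = \<bar>s - t\<bar>" unfolding sum_distrib_right[symmetric] \<theta>sum by simp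
    finally show ?thesis .
  qed
  have ray: "geodesic_ray P \<Sigma>"
    unfolding geodesic_ray_def using \<Sigma>_mem \<Sigma>_dist by (auto simp del: mspace_product_metric mdist_product_metric)
  have dec: "ray_decomposition r X \<Sigma> \<theta> \<sigma>"
    unfolding ray_decomposition_def
    using ray \<theta>sum \<theta> rank_one_axis.axis_ray(1)[OF ax] by (auto simp: less_imp_le \<Sigma>_def)
  have "(\<lambda>i\<in>I. cat0.cls (X i) (\<sigma> i)) \<in> FL"
  proof (rule limit_set_intro[OF dec \<theta>])
    fix R :: real assume R: "0 < R"
    define Y where "Y = mdist P (\<Sigma> 0) x"
    have Y: "0 \<le> Y" unfolding Y_def by (rule mdist_nonneg)
    obtain n :: nat where n: "(Y + R + 1 + 4 * R * Y) / L < real n" using reals_Archimedean2 by blast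
    define u where "u = real n * L"
    have u: "Y + R + 1 + 4 * R * Y < u" using n L by (simp add: u_def divide_less_eq)
    have RY: "0 \<le> 4 * R * Y" using R Y by simp
    have uY: "R < u - Y" "0 < u - Y" "4 * R * Y < u - Y" using u RY R Y by linarith+
    define \<gamma> where "\<gamma> = g [^]\<^bsub>G\<^esub> n"
    have \<gamma>: "\<gamma> \<in> \<Gamma>" using pow_mem[OF g_mem] by (simp add: \<gamma>_def)
    have "product_map r \<gamma> (\<Sigma> 0) = \<Sigma> u"
      unfolding product_map_def \<Sigma>_def
    proof (rule restrict_ext)
      fix i assume i: "i \<in> I"
      have "(g i [^]\<^bsub>Iso i\<^esub> int n) (\<sigma> i 0) = \<sigma> i (0 + real_of_int (int n) * l i)"
        by (rule rank_one_axis.T_axis[OF ax[OF i]])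
      moreover have "real n * l i = \<theta> i * u" using L by (simp add: \<theta>_def u_def)
      ultimately show "\<gamma> i ((\<lambda>i\<in>I. \<sigma> i (\<theta> i * 0)) i) = \<sigma> i (\<theta> i * u)"
        using i by (simp add: \<gamma>_def pow_component int_pow_int)
    qed
    then have near: "mdist P (\<Sigma> u) (product_map r \<gamma> x) \<le> Y"
      using product_map_dist[OF \<gamma> \<Sigma>_mem x_mem, of 0] by (simp add: Y_def del: mdist_product_metric)
    note close = P.geo_near_ray[OF ray product_map_mem[OF \<gamma> x_mem] near less_imp_le[OF R] less_imp_le[OF uY(1)] uY(2)]
    have "R / (u - Y) * (2 * Y) < 1" using uY R Y by (simp add: divide_less_eq)
    then have "mdist P (P.geo (\<Sigma> 0) (product_map r \<gamma> x) R) (\<Sigma> R) < 1"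
      using close(1) by linarith
    moreover have "R < mdist P (\<Sigma> 0) (product_map r \<gamma> x)" using close(2) uY(1) by linarith
    ultimately show "\<exists>\<gamma>\<in>\<Gamma>. R < mdist P (\<Sigma> 0) (product_map r \<gamma> x) \<and>
        mdist P (P.geo (\<Sigma> 0) (product_map r \<gamma> x) R) (\<Sigma> R) < 1"
      using \<gamma> by blast
  qed
  also have "(\<lambda>i\<in>I. cat0.cls (X i) (\<sigma> i)) = base_point"
    unfolding base_point_def by (rule restrict_ext) (simp add: att)
  finally show ?thesis .
qed

end

text \<open>Regularity enters here: as all speeds are positive, an orbit point close to the limit
  point in the product is far out, and in the right direction, in every factor.\<close>

lemma (in product_action) orbit_near_limit_point:
  assumes dec: "ray_decomposition r X \<sigma> \<theta> \<rho>" and \<theta>: "\<And>i. i \<in> I \<Longrightarrow> 0 < \<theta> i"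
    and \<xi>: "\<xi> \<in> boundary P" "\<sigma> \<in> \<xi>" "\<xi> \<in> geometric_limit_set r X \<Gamma> x" and R0: "0 < R0"
  shows "\<exists>\<gamma>\<in>\<Gamma>. \<forall>i\<in>I. R0 \<le> mdist (X i) (\<rho> i 0) (\<gamma> i (x i)) \<and>
    (\<forall>s\<in>{0..R0}. mdist (X i) (cat0.geo (X i) (\<rho> i 0) (\<gamma> i (x i)) s) (\<rho> i s) \<le> 2)"
proof -
  interpret P: cat0 P by (rule cat0_P)
  have ray: "geodesic_ray P \<sigma>" using ray_decompositionD(1)[OF dec] .
  have nn: "0 \<le> (R0 + 1) / \<theta> i" if "i \<in> I" for i using \<theta>[OF that] R0 by simp
  \<comment> \<open>Chosen so that \<open>\<theta> i * R\<close> is at least \<open>R0 + 1\<close>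
    in every factor; the 1 absorbs the distance between geodesic and ray at radius
    \<open>R\<close>.\<close>
  define R where "R = 1 + (\<Sum>i=1..r. (R0 + 1) / \<theta> i)"
  have R: "0 < R" using sum_nonneg[of "{1..r}" "\<lambda>i. (R0 + 1) / \<theta> i"] nn by (simp add: R_def)
  have \<theta>R: "R0 + 1 \<le> \<theta> i * R" if i: "i \<in> I" for i
  proof -
    have "(R0 + 1) / \<theta> i \<le> (\<Sum>i=1..r. (R0 + 1) / \<theta> i)" by (rule member_le_sum) (use i nn in auto)
    then have "(R0 + 1) / \<theta> i \<le> R" by (simp add: R_def)
    then show ?thesis using \<theta>[OF i] by (simp add: divide_le_eq mult.commute)
  qed
  obtain \<gamma> where \<gamma>: "\<gamma> \<in> \<Gamma>" "R < P.d (\<sigma> 0) (product_map r \<gamma> x)"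
    "P.d (P.geo (\<sigma> 0) (product_map r \<gamma> x) R) (\<sigma> R) < 1"
    using \<xi>(3) R unfolding geometric_limit_set_def P.limit_points_iff[OF \<xi>(1,2) orbit_subset] by blast
  define z where "z = product_map r \<gamma> x"
  define D where "D = P.d (\<sigma> 0) z"
  define \<kappa> where "\<kappa> = R / D"
  have D: "R < D" using \<gamma>(2) by (simp only: D_def z_def)
  have \<kappa>: "0 \<le> \<kappa>" "\<kappa> \<le> 1" using D R by (simp_all add: \<kappa>_def)
  have z: "z \<in> mspace P" using product_map_mem[OF \<gamma>(1) x_mem] by (simp only: z_def)
  have p: "\<sigma> 0 \<in> mspace P" by (rule P.ray_mem[OF ray order_refl])
  \<comment> \<open>A product geodesic is the tuple of the factor geodesics at the same fraction, so
    \<open>q\<close> is its point at radius \<open>R\<close>.\<close>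
  define q where "q = (\<lambda>i\<in>I. cat0.cmb (X i) (\<sigma> 0 i) (z i) \<kappa>)"
  have pi: "\<sigma> 0 i \<in> mspace (X i)" "z i \<in> mspace (X i)" if "i \<in> I" for i using mem_P p z that by auto
  have q: "q \<in> mspace P" using cat0.cmb_mem[OF cat0_X pi \<kappa>] by (simp add: q_def)
  have scale: "sqrt (\<Sum>i=1..r. (c * mdist (X i) (\<sigma> 0 i) (z i))\<^sup>2) = c * D" if "0 \<le> c" for c
    unfolding D_def using that by (simp add: power_mult_distrib sum_distrib_left[symmetric] real_sqrt_mult)
  have "q = P.cmb (\<sigma> 0) z \<kappa>"
  proof (rule P.cmb_unique[OF p z \<kappa> q])
    have "P.d (\<sigma> 0) q = sqrt (\<Sum>i=1..r. (\<kappa> * mdist (X i) (\<sigma> 0 i) (z i))\<^sup>2)"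
      unfolding mdist_product_metric
      by (intro arg_cong[where f = sqrt] sum.cong refl) (simp add: q_def cat0.dist_cmb(1)[OF cat0_X pi \<kappa>])
    then show "P.d (\<sigma> 0) q \<le> \<kappa> * P.d (\<sigma> 0) z" using scale[OF \<kappa>(1)] by (simp only: D_def order_refl)
    have "P.d q z = sqrt (\<Sum>i=1..r. ((1 - \<kappa>) * mdist (X i) (\<sigma> 0 i) (z i))\<^sup>2)"
      unfolding mdist_product_metric
      by (intro arg_cong[where f = sqrt] sum.cong refl) (simp add: q_def cat0.dist_cmb(2)[OF cat0_X pi \<kappa>])
    then show "P.d q z \<le> (1 - \<kappa>) * P.d (\<sigma> 0) z" using scale[of "1 - \<kappa>"] \<kappa> by (simp add: D_def del: mdist_product_metric)
  qed
  then have near: "P.d q (\<sigma> R) < 1" using \<gamma>(3) by (simp only: z_def \<kappa>_def D_def P.geo_def)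
  have "R0 \<le> mdist (X i) (\<rho> i 0) (\<gamma> i (x i)) \<and>
    (\<forall>s\<in>{0..R0}. mdist (X i) (cat0.geo (X i) (\<rho> i 0) (\<gamma> i (x i)) s) (\<rho> i s) \<le> 2)" if i: "i \<in> I" for i
  proof -
    interpret cat0 "X i" by (rule cat0_X[OF i])
    have \<rho>: "geodesic_ray (X i) (\<rho> i)" using ray_decompositionD(4)[OF dec i \<theta>[OF i]] .
    have zi: "z i = \<gamma> i (x i)" using i by (simp add: z_def product_map_def)
    have p0: "\<sigma> 0 i = \<rho> i 0" using ray_decompositionD(2)[OF dec order_refl i] by simp
    have pM: "\<rho> i 0 \<in> M" and yM: "\<gamma> i (x i) \<in> M" using pi[OF i] by (simp_all add: p0 zi)
    have qi: "q i = cmb (\<rho> i 0) (\<gamma> i (x i)) \<kappa>" using i by (simp add: q_def p0 zi)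
    have qM: "q i \<in> M" using mem_P[OF q i] .
    define a where "a = d (\<rho> i 0) (q i)"
    have a: "a = \<kappa> * d (\<rho> i 0) (\<gamma> i (x i))" unfolding a_def qi by (rule dist_cmb(1)[OF pM yM \<kappa>])
    have T: "0 \<le> \<theta> i * R" "\<rho> i (\<theta> i * R) \<in> M" "d (\<rho> i 0) (\<rho> i (\<theta> i * R)) = \<theta> i * R"
      using \<theta>[OF i] R ray_mem[OF \<rho>] ray_dist[OF \<rho>, of 0 "\<theta> i * R"] by auto
    have "d (q i) (\<sigma> R i) \<le> P.d q (\<sigma> R)" by (rule dist_component[OF i])
    then have close: "d (q i) (\<rho> i (\<theta> i * R)) \<le> 1"
      using near ray_decompositionD(2)[OF dec less_imp_le[OF R] i] by (simp del: mdist_product_metric)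
    have "\<theta> i * R \<le> a + 1"
      using mdist_triangle[OF pM qM T(2)] close T(3) by (simp add: a_def)
    then have aR: "R0 \<le> a" using \<theta>R[OF i] by linarith
    have ad: "a \<le> d (\<rho> i 0) (\<gamma> i (x i))" unfolding a using \<kappa> by (simp add: mult_left_le_one_le)
    have pos: "0 < d (\<rho> i 0) (\<gamma> i (x i))" using aR ad R0 by linarith
    have "q i = geo (\<rho> i 0) (\<gamma> i (x i)) a" unfolding geo_def qi using pos by (simp add: a)
    then have gq: "geo (\<rho> i 0) (q i) s = geo (\<rho> i 0) (\<gamma> i (x i)) s" if "0 \<le> s" "s \<le> a" for s
      using geo_geo[OF pM yM that ad] by simp
    have "d (geo (\<rho> i 0) (\<gamma> i (x i)) s) (\<rho> i s) \<le> 2" if s: "s \<in> {0..R0}" for s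
    proof -
      have s': "0 \<le> s" "s \<le> a" "s \<le> \<theta> i * R" using s aR \<theta>R[OF i] by auto
      have "d (geo (\<rho> i 0) (q i) s) (geo (\<rho> i 0) (\<rho> i (\<theta> i * R)) s) \<le> 2 * d (q i) (\<rho> i (\<theta> i * R))"
        using pM qM T s' by (intro geo_lipschitz) (auto simp: a_def)
      then show ?thesis using close gq[OF s'(1,2)] ray_geo[OF \<rho> s'(1,3)] by simp
    qed
    then show ?thesis using aR ad by auto
  qed
  with \<gamma>(1) show ?thesis by blast
qed

section \<open>Density of the orbit of the base point\<close>

context product_rank_one
begin

lemma inv_pow_moves:
  assumes i: "i \<in> I" and c: "0 < c"
  shows "boundary_map (X i) (inv\<^bsub>Iso i\<^esub> (h i [^]\<^bsub>Iso i\<^esub> (c::nat))) (att g i) \<noteq> att g i"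
proof
  interpret proper_cat0 "X i" by (rule proper[OF i])
  interpret H: group "Iso i" by (rule group_isometry_group)
  define k where "k = h i [^]\<^bsub>Iso i\<^esub> c"
  have k: "k \<in> carrier (Iso i)" using component[OF h_mem i] by (simp add: k_def)
  have a: "att g i \<in> boundary (X i)" by (rule rank_one_fixed_points(1)[OF rank_one(1)[OF i]])
  assume "boundary_map (X i) (inv\<^bsub>Iso i\<^esub> (h i [^]\<^bsub>Iso i\<^esub> c)) (att g i) = att g i"
  then have same: "boundary_map (X i) (inv\<^bsub>Iso i\<^esub> k) (att g i) = att g i" by (simp only: k_def)
  have "boundary_map (X i) k (att g i) = boundary_map (X i) k (boundary_map (X i) (inv\<^bsub>Iso i\<^esub> k) (att g i))"
    by (simp only: same)
  also have "\<dots> = boundary_map (X i) (k \<otimes>\<^bsub>Iso i\<^esub> inv\<^bsub>Iso i\<^esub> k) (att g i)"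
    by (rule boundary_map_mult[symmetric]) (use k a in auto)
  also have "\<dots> = att g i" using k a by (simp add: boundary_map_one)
  finally show False
    using rank_one_moves[OF rank_one(2)[OF i] a _ _ c] distinct_ends[OF i] by (simp add: k_def)
qed

text \<open>Here \<open>c\<close> ranges over exponents, not over factors: differences of two
  numbers among 0, ..., \<open>r\<close> fill \<open>I\<close>. The condition says that
  \<open>w\<close> and its image under the inverse of the power cannot both be seen from
  \<open>\<sigma> 0\<close> near the attracting point.\<close>

definition separates :: "nat \<Rightarrow> (real \<Rightarrow> 'a) \<Rightarrow> real \<Rightarrow> bool" where
  "separates i \<sigma> Rw \<longleftrightarrow> (\<forall>w\<in>mspace (X i). \<forall>c\<in>I. Rw \<le> mdist (X i) (\<sigma> 0) w \<longrightarrow>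
     Rw \<le> mdist (X i) (\<sigma> 0) ((inv\<^bsub>Iso i\<^esub> (h i [^]\<^bsub>Iso i\<^esub> c)) w) \<longrightarrow>
     mdist (X i) (cat0.geo (X i) (\<sigma> 0) w Rw) (\<sigma> Rw) < 1 \<longrightarrow>
     1 \<le> mdist (X i) (cat0.geo (X i) (\<sigma> 0) ((inv\<^bsub>Iso i\<^esub> (h i [^]\<^bsub>Iso i\<^esub> c)) w) Rw) (\<sigma> Rw))"

definition moves_near :: "nat \<Rightarrow> (real \<Rightarrow> 'a) \<Rightarrow> (real \<Rightarrow> 'a) \<Rightarrow> (real \<Rightarrow> 'a) set set \<Rightarrow> real \<Rightarrow> real \<Rightarrow> real \<Rightarrow> bool" where
  "moves_near i \<sigma> \<rho> V e0 Rw r0 \<longleftrightarrow> (\<forall>\<phi>\<in>carrier (Iso i). \<forall>y\<in>mspace (X i).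
     mdist (X i) (\<phi> (\<sigma> 0)) y \<le> e0 \<longrightarrow>
     r0 \<le> mdist (X i) (\<rho> 0) y \<longrightarrow> mdist (X i) (cat0.geo (X i) (\<rho> 0) y r0) (\<rho> r0) \<le> 2 \<longrightarrow>
     Rw \<le> mdist (X i) (\<phi> (\<sigma> 0)) (\<rho> 0) \<longrightarrow>
     1 \<le> mdist (X i) (cat0.geo (X i) (\<sigma> 0) ((inv\<^bsub>Iso i\<^esub> \<phi>) (\<rho> 0)) Rw) (\<sigma> Rw) \<longrightarrow>
     boundary_map (X i) \<phi> (att g i) \<in> V)"

text \<open>The order of choice matters: \<open>Rw\<close> comes from separation alone, then a
  radius from \<open>V\<close>, and \<open>r0\<close> depends on both and on
  \<open>e0\<close>.\<close>

lemma factor_constants: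
  assumes i: "i \<in> I" and ax: "rank_one_axis (X i) \<sigma> l (\<lambda>n. g i [^]\<^bsub>Iso i\<^esub> n)"
    and att: "att g i = cat0.cls (X i) \<sigma>" and \<rho>: "geodesic_ray (X i) \<rho>"
    and V: "openin (B i) V" "cat0.cls (X i) \<rho> \<in> V" and e0: "0 \<le> e0"
  shows "\<exists>Rw r0. 0 < Rw \<and> 0 < r0 \<and> separates i \<sigma> Rw \<and> moves_near i \<sigma> \<rho> V e0 Rw r0"
proof -
  interpret rank_one_axis "X i" \<sigma> l "\<lambda>n. g i [^]\<^bsub>Iso i\<^esub> n" by (rule ax)
  interpret H: group "Iso i" by (rule group_isometry_group)
  define k where "k c = inv\<^bsub>Iso i\<^esub> (h i [^]\<^bsub>Iso i\<^esub> (c::nat))" for c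
  have k: "k c \<in> carrier (Iso i)" for c using component[OF h_mem i] by (simp add: k_def)
  define Q where "Q c R \<longleftrightarrow> (\<forall>w\<in>M. R \<le> d (\<sigma> 0) w \<longrightarrow> R \<le> d (\<sigma> 0) (k c w) \<longrightarrow>
    d (geo (\<sigma> 0) w R) (\<sigma> R) < 1 \<longrightarrow> 1 \<le> d (geo (\<sigma> 0) (k c w) R) (\<sigma> R))" for c R
  have "\<forall>\<^sub>F R in at_top. \<forall>c\<in>I. Q c R"
  proof (rule eventually_ball_finite[OF finite_atLeastAtMost], rule ballI)
    fix c assume "c \<in> I"
    then have "boundary_map (X i) (k c) (cls \<sigma>) \<noteq> cls \<sigma>" using inv_pow_moves[OF i, of c] by (simp add: k_def att)
    then obtain R1 where "\<And>R. R1 \<le> R \<Longrightarrow> Q c R"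
      using moved_end_separates[OF axis_ray(1) k, of c] unfolding Q_def by auto
    then show "\<forall>\<^sub>F R in at_top. Q c R" unfolding eventually_at_top_linorder by blast
  qed
  then have "\<forall>\<^sub>F R in at_top. 0 < R \<and> (\<forall>c\<in>I. Q c R)"
    using eventually_gt_at_top[of 0] by eventually_elim simp
  then obtain Rw where Rw: "0 < Rw" "\<And>c. c \<in> I \<Longrightarrow> Q c Rw"
    using eventually_happens'[OF trivial_limit_at_top_linorder] by blast
  obtain R0 where R0: "0 < R0" "\<And>R. R0 \<le> R \<Longrightarrow> end_nbhd \<rho> R \<subseteq> V"
    using end_nbhd_basis[OF V self_mem_cls[OF \<rho>]] by metis
  obtain r0 where r0: "0 < r0"
    "\<And>\<phi> p y \<rho>. \<phi> \<in> carrier (Iso i) \<Longrightarrow> p \<in> M \<Longrightarrow> y \<in> M \<Longrightarrow> geodesic_ray (X i) \<rho> \<Longrightarrow> \<rho> 0 = p \<Longrightarrow>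
      d (\<phi> (\<sigma> 0)) y \<le> e0 \<Longrightarrow> r0 \<le> d p y \<Longrightarrow> d (geo p y r0) (\<rho> r0) \<le> 2 \<Longrightarrow>
      Rw \<le> d (\<phi> (\<sigma> 0)) p \<Longrightarrow> 1 \<le> d (geo (\<sigma> 0) ((inv\<^bsub>Iso i\<^esub> \<phi>) p) Rw) (\<sigma> Rw) \<Longrightarrow>
      boundary_map (X i) \<phi> (cls \<sigma>) \<in> end_nbhd \<rho> R0"
    by (rule axis_end_behind_translate[OF Rw(1) R0(1) e0]) blast
  show ?thesis
  proof (rule exI[of _ Rw], rule exI[of _ r0], intro conjI Rw(1) r0(1))
    show "separates i \<sigma> Rw"
      unfolding separates_def
    proof (intro ballI impI)
      fix w c assume "w \<in> M" "c \<in> I" and *: "Rw \<le> d (\<sigma> 0) w"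
        "Rw \<le> d (\<sigma> 0) ((inv\<^bsub>Iso i\<^esub> (h i [^]\<^bsub>Iso i\<^esub> c)) w)"
        "d (geo (\<sigma> 0) w Rw) (\<sigma> Rw) < 1"
      then show "1 \<le> d (geo (\<sigma> 0) ((inv\<^bsub>Iso i\<^esub> (h i [^]\<^bsub>Iso i\<^esub> c)) w) Rw) (\<sigma> Rw)"
        using Rw(2)[of c] unfolding Q_def k_def by simp
    qed
    show "moves_near i \<sigma> \<rho> V e0 Rw r0"
      unfolding moves_near_def
    proof (intro ballI impI)
      fix \<phi> y assume *: "\<phi> \<in> carrier (Iso i)" "y \<in> M" "d (\<phi> (\<sigma> 0)) y \<le> e0"
        "r0 \<le> d (\<rho> 0) y" "d (geo (\<rho> 0) y r0) (\<rho> r0) \<le> 2" "Rw \<le> d (\<phi> (\<sigma> 0)) (\<rho> 0)"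
        "1 \<le> d (geo (\<sigma> 0) ((inv\<^bsub>Iso i\<^esub> \<phi>) (\<rho> 0)) Rw) (\<sigma> Rw)"
      have "boundary_map (X i) \<phi> (cls \<sigma>) \<in> end_nbhd \<rho> R0"
        by (rule r0(2)[OF *(1) ray_mem[OF \<rho> order_refl] *(2) \<rho> refl *(3-7)])
      then show "boundary_map (X i) \<phi> (att g i) \<in> V" using R0(2)[OF order_refl] att by auto
    qed
  qed
qed

text \<open>For \<open>\<gamma>\<close> with \<open>\<gamma> x\<close> near a limit point, \<open>\<gamma>\<close> moves the base point near it unless, in some factor,
  the backward orbit of the limit ray's origin is near the base point.  Among the \<open>r + 1\<close> elements
  \<open>\<gamma> h\<^sup>j\<close> each of the \<open>r\<close> factors can spoil at most one.\<close>

lemma base_point_dense: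
  assumes U: "openin (FB) U" "\<zeta> \<in> U" and \<zeta>: "\<zeta> \<in> FL"
  shows "\<exists>\<gamma>\<in>\<Gamma>. act \<gamma> base_point \<in> U"
proof -
  obtain \<xi> \<Sigma> \<theta> \<rho> where \<xi>: "\<xi> \<in> boundary P" "\<Sigma> \<in> \<xi>" "\<xi> \<in> geometric_limit_set r X \<Gamma> x"
    and dec: "ray_decomposition r X \<Sigma> \<theta> \<rho>" and \<theta>: "\<And>i. i \<in> I \<Longrightarrow> 0 < \<theta> i"
    and \<rho>: "\<And>i. i \<in> I \<Longrightarrow> geodesic_ray (X i) (\<rho> i)" and \<zeta>_eq: "\<zeta> = (\<lambda>i\<in>I. cat0.cls (X i) (\<rho> i))"
    by (rule limit_set_elim[OF \<zeta>]) (rule that; (assumption | simp))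
  obtain V where V: "\<And>i. i \<in> I \<Longrightarrow> openin (B i) (V i)" "\<And>i. i \<in> I \<Longrightarrow> \<zeta> i \<in> V i" "(\<Pi>\<^sub>E i\<in>I. V i) \<subseteq> U"
    using openin_F[OF U] by metis
  obtain \<sigma> l where ax: "\<And>i. i \<in> I \<Longrightarrow> rank_one_axis (X i) (\<sigma> i) (l i) (\<lambda>n. g i [^]\<^bsub>Iso i\<^esub> n)"
    and att: "\<And>i. i \<in> I \<Longrightarrow> att g i = cat0.cls (X i) (\<sigma> i)"
    by (rule g_axes) (rule that; (assumption | simp))
  \<comment> \<open>One bound for all exponents \<open>j \<le> r\<close>: every
    \<open>\<gamma> h^j\<close> moves \<open>\<sigma> i 0\<close> to within \<open>e0 i\<close> of
    the orbit point \<open>\<gamma> x\<close>.\<close>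
  define e0 where "e0 i = (\<Sum>j\<le>r. mdist (X i) ((h i [^]\<^bsub>Iso i\<^esub> j) (\<sigma> i 0)) (x i))" for i
  have e0: "0 \<le> e0 i" "\<And>j. j \<le> r \<Longrightarrow> mdist (X i) ((h i [^]\<^bsub>Iso i\<^esub> j) (\<sigma> i 0)) (x i) \<le> e0 i" for i
    unfolding e0_def by (auto intro!: sum_nonneg member_le_sum)
  have "\<forall>i\<in>I. \<exists>Rw r0. 0 < Rw \<and> 0 < r0 \<and> separates i (\<sigma> i) Rw \<and>
      moves_near i (\<sigma> i) (\<rho> i) (V i) (e0 i) Rw r0"
  proof (rule ballI, rule factor_constants)
    fix i assume i: "i \<in> I"
    show "cat0.cls (X i) (\<rho> i) \<in> V i" using V(2)[OF i] i by (simp add: \<zeta>_eq)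
  qed (use ax att \<rho> V(1) e0(1) in auto)
  then obtain Rw r0 where Rw: "\<And>i. i \<in> I \<Longrightarrow> 0 < Rw i" and r0: "\<And>i. i \<in> I \<Longrightarrow> 0 < r0 i"
    and separate: "\<And>i. i \<in> I \<Longrightarrow> separates i (\<sigma> i) (Rw i)"
    and close: "\<And>i. i \<in> I \<Longrightarrow> moves_near i (\<sigma> i) (\<rho> i) (V i) (e0 i) (Rw i) (r0 i)"
    by metis
  \<comment> \<open>An orbit point at this distance has its direction controlled at
    \<open>r0 i\<close>, and points within \<open>e0 i\<close> of it are still \<open>Rw i\<close>
    away from the origin of the limit ray.\<close>
  define R where "R = 1 + (\<Sum>i=1..r. r0 i + Rw i + e0 i)"
  have nn: "0 \<le> r0 i + Rw i + e0 i" if "i \<in> I" for i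
    using r0[OF that] Rw[OF that] e0(1)[of i] by linarith
  have "0 \<le> (\<Sum>i=1..r. r0 i + Rw i + e0 i)" using nn by (rule sum_nonneg)
  then have R: "0 < R" by (simp add: R_def)
  have R_ge: "r0 i + Rw i + e0 i \<le> R" if "i \<in> I" for i
  proof -
    have "r0 i + Rw i + e0 i \<le> (\<Sum>i=1..r. r0 i + Rw i + e0 i)" by (rule member_le_sum) (use that nn in auto)
    then show ?thesis by (simp add: R_def)
  qed
  obtain \<gamma> where \<gamma>: "\<gamma> \<in> \<Gamma>" and far: "\<And>i. i \<in> I \<Longrightarrow> R \<le> mdist (X i) (\<rho> i 0) (\<gamma> i (x i))"
    and dir: "\<And>i s. i \<in> I \<Longrightarrow> 0 \<le> s \<Longrightarrow> s \<le> R \<Longrightarrow> mdist (X i) (cat0.geo (X i) (\<rho> i 0) (\<gamma> i (x i)) s) (\<rho> i s) \<le> 2"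
    using orbit_near_limit_point[OF dec \<theta> \<xi> R] by auto
  define \<phi> where "\<phi> j i = \<gamma> i \<otimes>\<^bsub>Iso i\<^esub> (h i [^]\<^bsub>Iso i\<^esub> j)" for j :: nat and i
  define w where "w j i = (inv\<^bsub>Iso i\<^esub> (\<phi> j i)) (\<rho> i 0)" for j i
  have \<phi>: "\<phi> j i \<in> carrier (Iso i)" if "i \<in> I" for i j
    unfolding \<phi>_def using component[OF \<gamma> that] component[OF h_mem that]
    by (intro monoid.m_closed monoid.nat_pow_closed group.is_monoid group_isometry_group)
  have near: "mdist (X i) (\<phi> j i (\<sigma> i 0)) (\<gamma> i (x i)) \<le> e0 i"
    and outside: "Rw i \<le> mdist (X i) (\<phi> j i (\<sigma> i 0)) (\<rho> i 0)"
    and w_mem: "w j i \<in> mspace (X i)" and w_far: "Rw i \<le> mdist (X i) (\<sigma> i 0) (w j i)"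
    and yM: "\<gamma> i (x i) \<in> mspace (X i)"
    if i: "i \<in> I" and j: "j \<le> r" for i j
  proof -
    interpret rank_one_axis "X i" "\<sigma> i" "l i" "\<lambda>n. g i [^]\<^bsub>Iso i\<^esub> n" by (rule ax[OF i])
    interpret H: group "Iso i" by (rule group_isometry_group)
    have c: "\<gamma> i \<in> carrier (Iso i)" "h i [^]\<^bsub>Iso i\<^esub> j \<in> carrier (Iso i)"
      using component[OF \<gamma> i] component[OF h_mem i] by auto
    have xM: "x i \<in> M" by (rule mem_P[OF x_mem i])
    have hM: "(h i [^]\<^bsub>Iso i\<^esub> j) (\<sigma> i 0) \<in> M" using isometry_mem[OF c(2)] by simp
    have "\<phi> j i (\<sigma> i 0) = \<gamma> i ((h i [^]\<^bsub>Iso i\<^esub> j) (\<sigma> i 0))"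
      unfolding \<phi>_def using isometry_mult[OF c] by simp
    then show n: "d (\<phi> j i (\<sigma> i 0)) (\<gamma> i (x i)) \<le> e0 i"
      using isometry_dist[OF c(1) hM xM] e0(2)[OF j, of i] by simp
    show yM: "\<gamma> i (x i) \<in> M" by (rule isometry_mem[OF c(1) xM])
    have \<rho>M: "\<rho> i 0 \<in> M" by (rule ray_mem[OF \<rho>[OF i] order_refl])
    have \<phi>M: "\<phi> j i (\<sigma> i 0) \<in> M" using isometry_mem[OF \<phi>[OF i]] by simp
    have "d (\<rho> i 0) (\<gamma> i (x i)) \<le> d (\<rho> i 0) (\<phi> j i (\<sigma> i 0)) + d (\<phi> j i (\<sigma> i 0)) (\<gamma> i (x i))"
      by (rule mdist_triangle[OF \<rho>M \<phi>M yM])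
    then show o: "Rw i \<le> d (\<phi> j i (\<sigma> i 0)) (\<rho> i 0)"
      using n far[OF i] R_ge[OF i] r0[OF i] mdist_commute[of "X i" "\<rho> i 0"] by simp
    have inv: "inv\<^bsub>Iso i\<^esub> (\<phi> j i) \<in> carrier (Iso i)" using \<phi>[OF i] by simp
    show "w j i \<in> M" unfolding w_def by (rule isometry_mem[OF inv \<rho>M])
    have "d (\<sigma> i 0) (w j i) = d ((inv\<^bsub>Iso i\<^esub> (\<phi> j i)) (\<phi> j i (\<sigma> i 0))) ((inv\<^bsub>Iso i\<^esub> (\<phi> j i)) (\<rho> i 0))"
      unfolding w_def using isometry_inv(1)[OF \<phi>[OF i], of "\<sigma> i 0" j] by simp
    also have "\<dots> = d (\<phi> j i (\<sigma> i 0)) (\<rho> i 0)" by (rule isometry_dist[OF inv \<phi>M \<rho>M])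
    finally show "Rw i \<le> d (\<sigma> i 0) (w j i)" using o by simp
  qed
  define bad where "bad j i \<longleftrightarrow> mdist (X i) (cat0.geo (X i) (\<sigma> i 0) (w j i) (Rw i)) (\<sigma> i (Rw i)) < 1" for j i
  \<comment> \<open>For two exponents with difference \<open>c\<close>, the point
    \<open>w j' i\<close> is the image of \<open>w j i\<close> under the inverse of
    \<open>h i\<close> to the power \<open>c\<close>, so \<open>separates\<close> rules out that
    both are near the attracting point.\<close>
  have once: False if i: "i \<in> I" and jj: "j < j'" "j' \<le> r" and bad: "bad j i" "bad j' i" for i j j'
  proof -
    interpret H: group "Iso i" by (rule group_isometry_group)
    define c where "c = j' - j"
    have c: "c \<in> I" "j' = j + c" using jj by (auto simp: c_def)
    have hc: "h i [^]\<^bsub>Iso i\<^esub> n \<in> carrier (Iso i)" for n :: nat using component[OF h_mem i] by auto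
    have "\<phi> j' i = \<phi> j i \<otimes>\<^bsub>Iso i\<^esub> (h i [^]\<^bsub>Iso i\<^esub> c)"
      unfolding \<phi>_def c(2) using component[OF \<gamma> i] component[OF h_mem i]
      by (simp add: H.m_assoc H.nat_pow_mult)
    then have "inv\<^bsub>Iso i\<^esub> (\<phi> j' i) = inv\<^bsub>Iso i\<^esub> (h i [^]\<^bsub>Iso i\<^esub> c) \<otimes>\<^bsub>Iso i\<^esub> inv\<^bsub>Iso i\<^esub> (\<phi> j i)"
      using \<phi>[OF i] hc by (simp add: H.inv_mult_group)
    then have w': "w j' i = (inv\<^bsub>Iso i\<^esub> (h i [^]\<^bsub>Iso i\<^esub> c)) (w j i)"
      unfolding w_def using cat0.ray_mem[OF cat0_X[OF i] \<rho>[OF i] order_refl] \<phi>[OF i] hc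
      by (simp add: isometry_mult)
    have "1 \<le> mdist (X i) (cat0.geo (X i) (\<sigma> i 0) (w j' i) (Rw i)) (\<sigma> i (Rw i))"
      unfolding w'
      by (rule separate[OF i, unfolded separates_def, rule_format, OF w_mem[OF i] c(1) w_far[OF i]])
        (use jj bad(1) w_far[OF i jj(2)] in \<open>simp_all add: bad_def w'\<close>)
    with bad(2) show False by (simp add: bad_def)
  qed
  have "\<exists>j\<le>r. \<forall>i\<in>I. \<not> bad j i"
  proof (rule ccontr)
    assume "\<not> ?thesis"
    then have ex: "\<forall>j\<in>{..r}. \<exists>i. i \<in> I \<and> bad j i" by blast
    obtain b where "\<forall>j\<in>{..r}. b j \<in> I \<and> bad j (b j)" using bchoice[OF ex] by (rule exE)
    then have b: "\<And>j. j \<le> r \<Longrightarrow> b j \<in> I \<and> bad j (b j)" by simp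
    have "b ` {..r} \<subseteq> {1..r}"
    proof (rule image_subsetI)
      show "b j \<in> {1..r}" if "j \<in> {..r}" for j using b[of j] that by blast
    qed
    then have "card (b ` {..r}) \<le> card {1..r}" by (intro card_mono) auto
    then have "\<not> inj_on b {..r}" by (intro pigeonhole) simp
    then obtain j j' where jj: "j \<le> r" "j' \<le> r" "b j = b j'" "j \<noteq> j'" unfolding inj_on_def by auto
    then consider "j < j'" | "j' < j" by linarith
    then show False
    proof cases
      case 1
      show False by (rule once[OF _ 1 jj(2)]) (use b[OF jj(1)] b[OF jj(2)] jj(3) in auto)
    next
      case 2
      show False by (rule once[OF _ 2 jj(1)]) (use b[OF jj(1)] b[OF jj(2)] jj(3) in auto)
    qed
  qed
  then obtain j where j: "j \<le> r" "\<And>i. i \<in> I \<Longrightarrow> \<not> bad j i" by blast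
  define \<delta> where "\<delta> = \<gamma> \<otimes>\<^bsub>G\<^esub> (h [^]\<^bsub>G\<^esub> j)"
  have \<delta>: "\<delta> \<in> \<Gamma>" unfolding \<delta>_def by (rule mult_mem[OF \<gamma> pow_mem[OF h_mem]])
  have "act \<delta> base_point \<in> (\<Pi>\<^sub>E i\<in>I. V i)"
  proof (rule PiE_I)
    fix i assume i: "i \<in> I"
    have r0R: "r0 i \<le> R" using R_ge[OF i] Rw[OF i] e0(1)[of i] by linarith
    have "boundary_map (X i) (\<phi> j i) (att g i) \<in> V i"
    proof (rule close[OF i, unfolded moves_near_def, rule_format, OF \<phi>[OF i] yM[OF i j(1)] near[OF i j(1)] _ _ outside[OF i j(1)]])
      show "r0 i \<le> mdist (X i) (\<rho> i 0) (\<gamma> i (x i))" using far[OF i] r0R by linarith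
      show "mdist (X i) (cat0.geo (X i) (\<rho> i 0) (\<gamma> i (x i)) (r0 i)) (\<rho> i (r0 i)) \<le> 2"
        using dir[OF i _ r0R] r0[OF i] by simp
      show "1 \<le> mdist (X i) (cat0.geo (X i) (\<sigma> i 0) ((inv\<^bsub>Iso i\<^esub> \<phi> j i) (\<rho> i 0)) (Rw i)) (\<sigma> i (Rw i))"
        using j(2)[OF i] by (simp add: bad_def w_def)
    qed
    moreover have "\<delta> i = \<phi> j i" using i by (simp add: \<delta>_def \<phi>_def mult_component pow_component)
    ultimately show "act \<delta> base_point i \<in> V i"
      using i by (simp add: Furstenberg_map_def base_point_def)
  qed (auto simp: Furstenberg_map_def)
  with V(3) \<delta> show ?thesis by blast
qed

text \<open>Some \<open>\<gamma>\<close> moves the base point into \<open>U\<close>; the preimage of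
  \<open>U\<close> under \<open>\<gamma>\<close> is then a neighbourhood of the base point, into
  which every \<open>\<zeta>\<close> can be moved.\<close>

lemma orbit_dense:
  assumes \<zeta>: "\<zeta> \<in> topspace (FB)"
    and U: "openin (FB) U" "U \<inter> FL \<noteq> {}"
  shows "\<exists>\<gamma>\<in>\<Gamma>. act \<gamma> \<zeta> \<in> U"
proof -
  obtain \<xi> where "\<xi> \<in> U" "\<xi> \<in> FL" using U(2) by blast
  then obtain \<gamma> where \<gamma>: "\<gamma> \<in> \<Gamma>" "act \<gamma> base_point \<in> U"
    using base_point_dense[OF U(1)] by blast
  define W where "W = {\<eta> \<in> topspace (FB). act \<gamma> \<eta> \<in> U}"
  have "openin (FB) W"
    unfolding W_def by (rule openin_continuous_map_preimage[OF continuous_act[OF \<gamma>(1)] U(1)])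
  moreover have "base_point \<in> W" using \<gamma>(2) base_point_mem by (simp add: W_def)
  ultimately obtain \<delta> where \<delta>: "\<delta> \<in> \<Gamma>" "act \<delta> \<zeta> \<in> W"
    using pair_to_base_point[OF \<zeta> \<zeta>] by blast
  then have "act (\<gamma> \<otimes>\<^bsub>G\<^esub> \<delta>) \<zeta> \<in> U"
    using act_mult[OF \<gamma>(1) \<delta>(1) \<zeta>] by (simp add: W_def)
  then show ?thesis using mult_mem[OF \<gamma>(1) \<delta>(1)] by blast
qed

lemma boundary_limit_set:
  "boundary_limit_set \<Gamma> (act) (FB) (FL)"
  unfolding boundary_limit_set_def
proof (intro conjI ballI allI impI)
  show "FL \<subseteq> topspace FB" by (rule limit_set_subset)
  show "act \<gamma> ` FL = FL" if "\<gamma> \<in> \<Gamma>" for \<gamma>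
    by (rule limit_set_invariant[OF that])
  show "\<exists>\<gamma>\<in>\<Gamma>. act \<gamma> \<zeta> \<in> U"
    if "\<zeta> \<in> topspace FB" "openin FB U \<and> U \<inter> FL \<noteq> {}" for \<zeta> U
    using orbit_dense that by blast
next
  fix \<zeta> \<eta> assume \<zeta>: "\<zeta> \<in> topspace FB" "\<eta> \<in> topspace FB"
  show "\<exists>\<xi>\<in>FL. \<forall>U. U \<subseteq> topspace FB \<and> \<xi> \<in> FB interior_of U \<longrightarrow>
     (\<exists>\<gamma>\<in>\<Gamma>. {act \<gamma> \<zeta>, act \<gamma> \<eta>} \<subseteq> U)"
  proof (intro bexI[OF _ base_point_limit] allI impI)
    fix U assume "U \<subseteq> topspace FB \<and> base_point \<in> FB interior_of U"
    then obtain \<gamma> where "\<gamma> \<in> \<Gamma>" "act \<gamma> \<zeta> \<in> FB interior_of U" "act \<gamma> \<eta> \<in> FB interior_of U"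
      using pair_to_base_point[OF \<zeta> openin_interior_of] by blast
    then show "\<exists>\<gamma>\<in>\<Gamma>. {act \<gamma> \<zeta>, act \<gamma> \<eta>} \<subseteq> U"
      using interior_of_subset[of FB U] by blast
  qed
next
  fix \<zeta> assume \<zeta>: "\<zeta> \<in> topspace FB"
  obtain V where V: "openin FB V" "\<zeta> \<in> V"
    "\<And>U. openin FB U \<Longrightarrow> base_point \<in> U \<Longrightarrow> \<exists>\<gamma>\<in>\<Gamma>. act \<gamma> ` V \<subseteq> U"
    using nbhd_to_base_point[OF \<zeta>] by blast
  show "\<exists>V. V \<subseteq> topspace FB \<and> \<zeta> \<in> FB interior_of V \<and> (\<exists>\<xi>\<in>FL.
      \<forall>U. U \<subseteq> topspace FB \<and> \<xi> \<in> FB interior_of U \<longrightarrow> (\<exists>\<gamma>\<in>\<Gamma>. act \<gamma> ` V \<subseteq> U))"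
  proof (intro exI[of _ V] conjI bexI[OF _ base_point_limit] allI impI)
    show "V \<subseteq> topspace FB" using V(1) openin_subset by blast
    show "\<zeta> \<in> FB interior_of V" using V(1,2) by (simp add: interior_of_openin)
    fix U assume "U \<subseteq> topspace FB \<and> base_point \<in> FB interior_of U"
    then obtain \<gamma> where "\<gamma> \<in> \<Gamma>" "act \<gamma> ` V \<subseteq> FB interior_of U"
      using V(3)[OF openin_interior_of] by blast
    then show "\<exists>\<gamma>\<in>\<Gamma>. act \<gamma> ` V \<subseteq> U"
      using interior_of_subset[of FB U] by blast
  qed
qed

end

theorem theoremA:
  fixes r :: nat
    and X :: "nat \<Rightarrow> 'a metric"
    and \<Gamma> :: "(nat \<Rightarrow> 'a \<Rightarrow> 'a) set"
    and x :: "nat \<Rightarrow> 'a"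
  assumes "1 \<le> r"
    and "\<And>i. i \<in> {1..r} \<Longrightarrow> Hadamard_space (X i)"
    and "\<And>i. i \<in> {1..r} \<Longrightarrow> locally_compact_space (mtopology_of (X i))"
    and "subgroup \<Gamma> (product_isometry_group r X)"
    and "properly_discontinuous r X \<Gamma>"
    and "\<exists>g\<in>\<Gamma>. \<exists>h\<in>\<Gamma>. independent_regular_axial r X g h"
    and "x \<in> mspace (product_metric r X)"
  shows "boundary_limit_set \<Gamma> (Furstenberg_map r X) (Furstenberg_boundary r X)
           (Furstenberg_limit_set r X \<Gamma> x)"
proof -
  obtain g h where gh: "g \<in> \<Gamma>" "h \<in> \<Gamma>" "independent_regular_axial r X g h"
    using assms(6) by blast
  have "product_action r X \<Gamma> x"
    by (rule product_action.intro[OF assms(1) proper_cat0I[OF assms(2,3)] assms(4,7)])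
  then have "product_rank_one r X \<Gamma> x g h"
    by (rule product_rank_one.intro) (rule product_rank_one_axioms.intro[OF gh])
  then show ?thesis by (rule product_rank_one.boundary_limit_set)
qed

end
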